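(* Let $d\in\mathbb N$, $d\ge2$, $s\in(0,1)$, $\delta\in(0,\frac d2)$ and $\epsilon\in(0,1)$. Then: (a) The function $u_{s,\delta}(x)=|x|^{s-\delta}\frac{x_1}{|x|}$ belongs to $W^{s,2}_{\mathrm{loc}}(B_1(0))$ and satisfies, for $t\in(0,1)$ and $q\in(1,\infty)$, $$u_{s,\delta}\in W^{t,q}_{\mathrm{loc}}(B_1(0))\quad\text{if and only if}\quad s-\delta>t-\tfrac dq .$$ (b) Let $\epsilon=\frac{d-\delta}{d-1}\delta$ and $\mathbb A_\epsilon(x)=(1-\epsilon)\mathrm{Id}+\epsilon\,\widehat x\otimes\widehat x$. Then $u_{s,\delta}$ solves $$-\operatorname{div}^s\bigl(\mathbb A_\epsilon(x)\nabla^su_{s,\delta}(x)\bigr)=0$$ in the sense of tempered distributions. Moreover, for all Schwartz functions $\xi\in\mathcal S(\mathbb R^d)$, $$\int_{\mathbb R^d}\mathbb A_\epsilon\nabla^su_{s,\delta}\cdot\nabla^s\xi\,dx=0 .$$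
   Context: For $x\in\mathbb R^d\setminus\{0\}$ write $\widehat x=x/|x|$, $(\widehat x\otimes\widehat x)_{ij}=\widehat x_i\widehat x_j$. The Riesz kernel of order $1-s$ is $$I_{1-s}(x)=\frac{2^{-1+s}\,\Gamma\left(\frac{d-1+s}{2}\right)}{\pi^{d/2}\,\Gamma\left(\frac{1-s}{2}\right)}\,\frac1{|x|^{d-1+s}} ,$$ and $I_{1-s}v=I_{1-s}*v$. The fractional gradient is $\nabla^sv=\nabla(I_{1-s}*v)$. For $v=u_{s,\delta}$ the convolution is understood as the principal value $$(I_{1-s}*u_{s,\delta})(x)=\lim_{r\to0}\int_{r\le|h|\le1/r}I_{1-s}(h)\,u_{s,\delta}(x-h)\,dh .$$ The fractional divergence of a vector field $w$ is $\operatorname{div}^sw=\sum_j\frac{\partial}{\partial x_j}(I_{1-s}w_j)$; for $w=\mathbb A_\epsilon\nabla^su_{s,\delta}$ (where $I_{1-s}*w$ need not converge) it is understood as $I_{1-s}*\operatorname{div}w$, so that the equation reads $-I_{1-s}*\operatorname{div}\bigl(\mathbb A_\epsilon\nabla(I_{1-s}*u_{s,\delta})\bigr)=0$. $W^{t,q}$ denotes the fractional (Sobolev–Slobodeckij) Sobolev space, and $B_1(0)$ is the open unit ball of $\mathbb R^d$. *)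

theory Defs
  imports "HOL-Analysis.Analysis"
begin

text \<open>Sobolev--Slobodeckij spaces for \<open>0 < t < 1\<close> and \<open>1 < q < \<infinity>\<close>.\<close>

definition sobolev_frac :: "real \<Rightarrow> real \<Rightarrow> (real^'n) set \<Rightarrow> (real^'n \<Rightarrow> real) set" where
  "sobolev_frac t q U = {v. v \<in> borel_measurable (lebesgue_on U)
     \<and> (\<integral>\<^sup>+x. ennreal (\<bar>v x\<bar> powr q) \<partial>lebesgue_on U) < \<infinity>
     \<and> (\<integral>\<^sup>+x. (\<integral>\<^sup>+y. ennreal (\<bar>v x - v y\<bar> powr q / norm (x - y) powr (real CARD('n) + t * q))
           \<partial>lebesgue_on U) \<partial>lebesgue_on U) < \<infinity>}"

definition sobolev_frac_loc :: "real \<Rightarrow> real \<Rightarrow> (real^'n) set \<Rightarrow> (real^'n \<Rightarrow> real) set" where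
  "sobolev_frac_loc t q \<Omega> =
     {v. \<forall>U. open U \<and> compact (closure U) \<and> closure U \<subseteq> \<Omega> \<longrightarrow> v \<in> sobolev_frac t q U}"

definition partial :: "'n \<Rightarrow> (real^'n \<Rightarrow> real) \<Rightarrow> real^'n \<Rightarrow> real" where
  "partial j f x = frechet_derivative f (at x) (axis j 1)"

definition grad :: "(real^'n \<Rightarrow> real) \<Rightarrow> real^'n \<Rightarrow> real^'n" where
  "grad f x = (\<chi> j. partial j f x)"

text \<open>Iterated partial derivatives are indexed by lists of coordinates in place of multi-indices.
  Total differentiability of all of them makes a Schwartz function smooth.\<close>

fun partials :: "'n list \<Rightarrow> (real^'n \<Rightarrow> real) \<Rightarrow> real^'n \<Rightarrow> real" where
  "partials [] f = f"
| "partials (j # js) f = partial j (partials js f)"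

definition schwartz :: "(real^'n \<Rightarrow> real) set" where
  "schwartz = {f. \<forall>js. (\<forall>x. partials js f differentiable (at x))
     \<and> (\<forall>N::nat. bdd_above (range (\<lambda>x. (1 + norm x) ^ N * \<bar>partials js f x\<bar>)))}"

text \<open>A functional is defined on all functions, but only its values on \<open>schwartz\<close> matter.\<close>

definition tempered_distribution :: "((real^'n \<Rightarrow> real) \<Rightarrow> real) \<Rightarrow> bool" where
  "tempered_distribution T \<longleftrightarrow>
     (\<forall>\<phi>\<in>schwartz. \<forall>\<psi>\<in>schwartz. T (\<lambda>x. \<phi> x + \<psi> x) = T \<phi> + T \<psi>)
   \<and> (\<forall>\<phi>\<in>schwartz. \<forall>c. T (\<lambda>x. c * \<phi> x) = c * T \<phi>)
   \<and> (\<exists>C. \<exists>N::nat. \<forall>\<phi>\<in>schwartz.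
        \<bar>T \<phi>\<bar> \<le> C * (\<Sum>js | length js \<le> N. SUP x. (1 + norm x) ^ N * \<bar>partials js \<phi> x\<bar>))"

definition dist_of_fun :: "(real^'n \<Rightarrow> real) \<Rightarrow> (real^'n \<Rightarrow> real) \<Rightarrow> real" where
  "dist_of_fun f \<phi> = (LINT x|lebesgue. f x * \<phi> x)"

definition tempered_fun :: "(real^'n \<Rightarrow> real) \<Rightarrow> bool" where
  "tempered_fun f \<longleftrightarrow> (\<forall>\<phi>\<in>schwartz. integrable lebesgue (\<lambda>x. f x * \<phi> x))
     \<and> tempered_distribution (dist_of_fun f)"

definition has_dist_grad :: "(real^'n \<Rightarrow> real) \<Rightarrow> (real^'n \<Rightarrow> real^'n) \<Rightarrow> bool" where
  "has_dist_grad f g \<longleftrightarrow> tempered_fun f \<and> (\<forall>j. tempered_fun (\<lambda>x. g x $ j))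
     \<and> (\<forall>\<phi>\<in>schwartz. \<forall>j. dist_of_fun (\<lambda>x. g x $ j) \<phi> = - dist_of_fun f (partial j \<phi>))"

definition dist_div :: "(real^'n \<Rightarrow> real^'n) \<Rightarrow> (real^'n \<Rightarrow> real) \<Rightarrow> real" where
  "dist_div w \<phi> = - (\<Sum>j\<in>UNIV. dist_of_fun (\<lambda>x. w x $ j) (partial j \<phi>))"

text \<open>The Riesz kernel of order \<open>1 - s\<close>.\<close>

definition riesz_kernel :: "real \<Rightarrow> real^'n \<Rightarrow> real" where
  "riesz_kernel s x =
     (2 powr (- 1 + s) * Gamma ((real CARD('n) - 1 + s) / 2))
       / (pi powr (real CARD('n) / 2) * Gamma ((1 - s) / 2))
     * (1 / norm x powr (real CARD('n) - 1 + s))"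

definition riesz_pot :: "real \<Rightarrow> (real^'n \<Rightarrow> real) \<Rightarrow> real^'n \<Rightarrow> real" where
  "riesz_pot s v x = (LINT h|lebesgue. riesz_kernel s h * v (x - h))"

definition annulus :: "real \<Rightarrow> (real^'n) set" where
  "annulus r = {h. r \<le> norm h \<and> norm h \<le> 1 / r}"

definition riesz_trunc :: "real \<Rightarrow> real \<Rightarrow> (real^'n \<Rightarrow> real) \<Rightarrow> real^'n \<Rightarrow> real" where
  "riesz_trunc s r v x = (LINT h:annulus r|lebesgue. riesz_kernel s h * v (x - h))"

definition riesz_pv :: "real \<Rightarrow> (real^'n \<Rightarrow> real) \<Rightarrow> real^'n \<Rightarrow> real" where
  "riesz_pv s v x = Lim (at_right 0) (\<lambda>r. riesz_trunc s r v x)"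

definition riesz_pv_exists :: "real \<Rightarrow> (real^'n \<Rightarrow> real) \<Rightarrow> real^'n \<Rightarrow> bool" where
  "riesz_pv_exists s v x \<longleftrightarrow>
     (\<forall>r>0. set_integrable lebesgue (annulus r) (\<lambda>h. riesz_kernel s h * v (x - h)))
   \<and> (\<exists>l. ((\<lambda>r. riesz_trunc s r v x) \<longlongrightarrow> l) (at_right 0))"

text \<open>Convolution of the Riesz kernel with a tempered distribution \<open>T\<close>. The truncated kernel is
  integrable, even and compactly supported, so its convolution with \<open>T\<close> is
  \<open>\<phi> \<mapsto> T (riesz_trunc s r \<phi>)\<close>, where \<open>riesz_trunc s r \<phi>\<close> is again Schwartz. As for functions,
  the full convolution is the limit as the truncation is removed, taken in the weak
  topology of tempered distributions.\<close>

definition has_riesz_dist ::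
  "real \<Rightarrow> ((real^'n \<Rightarrow> real) \<Rightarrow> real) \<Rightarrow> ((real^'n \<Rightarrow> real) \<Rightarrow> real) \<Rightarrow> bool" where
  "has_riesz_dist s T D \<longleftrightarrow> tempered_distribution T \<and> tempered_distribution D
     \<and> (\<forall>\<phi>\<in>schwartz. ((\<lambda>r. T (riesz_trunc s r \<phi>)) \<longlongrightarrow> D \<phi>) (at_right 0))"

text \<open>Fractional divergence, understood as the Riesz potential of the distributional divergence.\<close>

definition has_frac_div :: "real \<Rightarrow> (real^'n \<Rightarrow> real^'n) \<Rightarrow> ((real^'n \<Rightarrow> real) \<Rightarrow> real) \<Rightarrow> bool" where
  "has_frac_div s w D \<longleftrightarrow> (\<forall>j. tempered_fun (\<lambda>x. w x $ j)) \<and> has_riesz_dist s (dist_div w) D"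

definition frac_grad :: "real \<Rightarrow> (real^'n \<Rightarrow> real) \<Rightarrow> real^'n \<Rightarrow> real^'n" where
  "frac_grad s v = grad (riesz_pot s v)"

definition frac_grad_pv :: "real \<Rightarrow> (real^'n \<Rightarrow> real) \<Rightarrow> real^'n \<Rightarrow> real^'n" where
  "frac_grad_pv s v = grad (riesz_pv s v)"

text \<open>The coordinate \<open>i\<close> plays the role of the first one. Values at the origin are irrelevant
  (both functions below are then given by \<open>0 / 0 = 0\<close>).\<close>

definition u_fun :: "'n \<Rightarrow> real \<Rightarrow> real \<Rightarrow> real^'n \<Rightarrow> real" where
  "u_fun i s \<delta> x = norm x powr (s - \<delta>) * (x $ i / norm x)"

definition A_mat :: "real \<Rightarrow> real^'n \<Rightarrow> real^'n^'n" where
  "A_mat \<epsilon> x = (1 - \<epsilon>) *\<^sub>R mat 1 + \<epsilon> *\<^sub>R (\<chi> j k. (x $ j / norm x) * (x $ k / norm x))"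

end

theory Submission imports Defs
begin

text \<open>Part (a) is scaling: \<open>u\<close> is homogeneous of degree \<open>a = s - \<delta>\<close>, so the Gagliardo energy of \<open>u\<close> on a ball
  of radius \<open>r\<close> is \<open>r\<close> to the power \<open>d + (a - t) q\<close> times its energy on the unit ball. If that exponent
  is \<open>\<le> 0\<close>, shrinking the ball does not decrease the energy, which is therefore infinite; if it is
  \<open>> 0\<close>, one integrates over \<open>|y| \<le> |x|\<close> first and only has to know that the inner integral is finite on
  the unit sphere.

  For part (b), averaging over \<open>h\<close> and \<open>-h\<close> makes the principal value absolutely convergent, and
  homogeneity together with rotation equivariance forces it to be \<open>v(x) = c |x|^(-\<delta>) x\<^sub>i\<close> for some constant \<open>c\<close>,
  whose value is irrelevant. The divergence of the flux \<open>A\<^sub>\<epsilon> \<nabla>v\<close> off the origin is a multiple of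
  \<open>\<epsilon> (d - 1) - \<delta> (d - \<delta>) = 0\<close>. Since the flux has size \<open>|x|^(-\<delta>)\<close> with \<open>\<delta> + 1 < d\<close>, the origin carries no
  divergence either: regularise \<open>|x|\<close> to the square root of \<open>|x|\<^sup>2 + 1/n\<close>, integrate by parts, and pass to
  the limit. The test functions for this are the Riesz potentials of Schwartz functions \<open>\<xi>\<close>, whose
  gradients decay faster than \<open>|x|^(-d)\<close> because partial derivatives of \<open>\<xi>\<close> have mean zero.\<close>

section \<open>Integration of powers of the norm\<close>

text \<open>The flux \<open>w\<close> has size |x|^(-\<delta>), and \<delta> may be arbitrarily
  small. A Riesz potential decays like |x|^(-(d-1+s)), and the same rate for its gradient would make
  the pairing with \<open>w\<close> absolutely convergent only for \<delta> > 1 - s. The mean-zero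
  gain raises the order of the gradient to d + s, which serves every \<delta> > 0.

  The two forms of the equation use different test functions: the distributional form evaluates div
  w at potentials with truncated kernel, the weak form at full potentials. Both are placed in one
  class, \<open>admissible\<close>, with decay of order d - 1 for the function and d for its first
  derivatives, and the vanishing of div w is proved once on that class. For \<delta> \<le> 1 this
  decay does not make the product of \<open>w\<close> and a test function integrable, so integration
  by parts also needs a cutoff at infinity, not only a regularisation at the origin.

  The hypotheses d \<ge> 2 and \<delta> < d/2 enter part (b) through \<delta> < d/2 \<le> d -
  1.\<close>

abbreviation (input) decay :: "real \<Rightarrow> 'a::real_normed_vector \<Rightarrow> real" where
  "decay p x \<equiv> (1 + norm x) powr (- p)"

section \<open>Affine and orthogonal changes of variables\<close>

lemma nn_integral_lborel_affine:
  fixes t :: "'a::euclidean_space"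
  assumes [measurable]: "f \<in> borel_measurable borel" and "c \<noteq> 0"
  shows "(\<integral>\<^sup>+x. f x \<partial>lborel) = ennreal (\<bar>c\<bar>^DIM('a)) * (\<integral>\<^sup>+x. f (t + c *\<^sub>R x) \<partial>lborel)"
  by (subst lborel_affine[OF \<open>c \<noteq> 0\<close>, of t])
     (simp add: nn_integral_density nn_integral_distr nn_integral_cmult)

lemma integrable_lborel_affine:
  fixes t :: "'a::euclidean_space" and f :: "'a \<Rightarrow> real"
  assumes f: "integrable lborel f" and "c \<noteq> 0"
  shows "integrable lborel (\<lambda>x. f (t + c *\<^sub>R x))"
  using f f[THEN borel_measurable_integrable] unfolding integrable_iff_bounded
  by (subst (asm) nn_integral_lborel_affine[where c=c and t=t]) (auto simp: \<open>c \<noteq> 0\<close> ennreal_mult_less_top)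

lemma integral_lborel_affine:
  fixes t :: "'a::euclidean_space" and f :: "'a \<Rightarrow> real"
  assumes [measurable]: "f \<in> borel_measurable borel" and "c \<noteq> 0"
  shows "integral\<^sup>L lborel f = \<bar>c\<bar>^DIM('a) * (LINT x|lborel. f (t + c *\<^sub>R x))"
  by (subst lborel_affine[OF \<open>c \<noteq> 0\<close>, of t]) (simp add: integral_density integral_distr)

text \<open>The library has linear changes of variables only for well-ordered index types. Here one evaluates
  \<open>\<integral>\<integral> g (Q x) f (Q x - y) dx dy\<close> in both orders, with \<open>f\<close> the indicator of the unit ball, which \<open>Q\<close> preserves.\<close>

lemma nn_integral_lborel_orthogonal:
  fixes Q :: "'a::euclidean_space \<Rightarrow> 'a"
  assumes Q: "orthogonal_transformation Q" and [measurable]: "g \<in> borel_measurable borel"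
  shows "(\<integral>\<^sup>+x. g (Q x) \<partial>lborel) = (\<integral>\<^sup>+x. g x \<partial>lborel)"
proof -
  define f :: "'a \<Rightarrow> ennreal" where "f = indicator (ball 0 1)"
  have [measurable]: "f \<in> borel_measurable borel"
    unfolding f_def by (intro borel_measurable_indicator) simp
  have [measurable]: "Q \<in> borel_measurable borel"
    using orthogonal_transformation_linear[OF Q]
    by (auto intro!: borel_measurable_continuous_onI linear_continuous_on simp: linear_linear)
  have fQ: "f (Q x) = f x" for x
    by (simp add: f_def indicator_def orthogonal_transformation_norm[OF Q])
  obtain Q' where Q': "\<And>y. Q (Q' y) = y"
    using orthogonal_transformation_surj[OF Q] by (metis surj_def)
  let ?F = "\<integral>\<^sup>+y. f y \<partial>lborel"
  have shift: "(\<integral>\<^sup>+x. h (t + x) \<partial>lborel) = (\<integral>\<^sup>+x. h x \<partial>lborel)"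
    if "h \<in> borel_measurable borel" for t and h :: "'a \<Rightarrow> ennreal"
    using nn_integral_lborel_affine[OF that, of 1 t] by simp
  have refl: "(\<integral>\<^sup>+y. f (z - y) \<partial>lborel) = ?F" for z
    using nn_integral_lborel_affine[of f "-1" z] by simp
  have "?F * (\<integral>\<^sup>+x. g (Q x) \<partial>lborel) = (\<integral>\<^sup>+x. g (Q x) * (\<integral>\<^sup>+y. f (Q x - y) \<partial>lborel) \<partial>lborel)"
    by (simp add: refl nn_integral_multc mult.commute[of ?F])
  also have "\<dots> = (\<integral>\<^sup>+x. \<integral>\<^sup>+y. g (Q x) * f (Q x - y) \<partial>lborel \<partial>lborel)"
    by (simp add: nn_integral_cmult)
  also have "\<dots> = (\<integral>\<^sup>+y. \<integral>\<^sup>+x. g (Q x) * f (Q x - y) \<partial>lborel \<partial>lborel)"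
    by (rule lborel_pair.Fubini'[symmetric]) simp
  \<comment> \<open>Shifting x by \<open>Q' y\<close>, a preimage of y, moves y from the argument of
    \<open>f\<close> to that of \<open>g\<close>. Then y can be integrated out against
    \<open>g\<close> alone, and \<open>f (Q x) = f x\<close> removes the last
    \<open>Q\<close>.\<close>
  also have "\<dots> = (\<integral>\<^sup>+y. \<integral>\<^sup>+x. g (y + Q x) * f (Q x) \<partial>lborel \<partial>lborel)"
  proof (rule nn_integral_cong)
    fix y :: 'a
    have "(\<integral>\<^sup>+x. g (Q x) * f (Q x - y) \<partial>lborel) = (\<integral>\<^sup>+x. g (Q (Q' y + x)) * f (Q (Q' y + x) - y) \<partial>lborel)"
      by (subst shift[where t="Q' y"]) auto
    then show "(\<integral>\<^sup>+x. g (Q x) * f (Q x - y) \<partial>lborel) = (\<integral>\<^sup>+x. g (y + Q x) * f (Q x) \<partial>lborel)"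
      by (simp add: linear_add[OF orthogonal_transformation_linear[OF Q]] Q')
  qed
  also have "\<dots> = (\<integral>\<^sup>+x. \<integral>\<^sup>+y. g (y + Q x) * f x \<partial>lborel \<partial>lborel)"
    by (subst lborel_pair.Fubini') (simp_all add: fQ)
  also have "\<dots> = (\<integral>\<^sup>+x. f x * (\<integral>\<^sup>+y. g y \<partial>lborel) \<partial>lborel)"
    by (subst nn_integral_multc) (simp_all add: shift add.commute[of _ "Q _"] mult.commute)
  also have "\<dots> = ?F * (\<integral>\<^sup>+y. g y \<partial>lborel)"
    by (simp add: nn_integral_multc)
  finally have eq: "?F * (\<integral>\<^sup>+x. g (Q x) \<partial>lborel) = ?F * (\<integral>\<^sup>+y. g y \<partial>lborel)" .
  have "?F = emeasure lborel (ball (0::'a) 1)" by (simp add: f_def)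
  then have "?F \<noteq> 0" "?F \<noteq> \<infinity>"
    using content_ball_pos[of 1 "0::'a"] emeasure_lborel_ball_finite[of "0::'a" 1]
    by (auto simp: measure_def)
  with eq show ?thesis
    by (simp add: ennreal_mult_cancel_left)
qed

text \<open>On indicators the nonnegative version says that \<open>Q\<close> pushes Lebesgue measure
  forward to itself. In this form it reaches signed integrands, integrable or not.\<close>

lemma integral_lborel_orthogonal:
  fixes Q :: "'a::euclidean_space \<Rightarrow> 'a" and f :: "'a \<Rightarrow> real"
  assumes Q: "orthogonal_transformation Q" and [measurable]: "f \<in> borel_measurable borel"
  shows "(LINT x|lborel. f (Q x)) = (LINT x|lborel. f x)"
proof -
  have [measurable]: "Q \<in> borel_measurable borel"
    using orthogonal_transformation_linear[OF Q]
    by (auto intro!: borel_measurable_continuous_onI linear_continuous_on simp: linear_linear)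
  have "distr lborel borel Q = lborel"
  proof (rule measure_eqI)
    fix A assume "A \<in> sets (distr lborel borel Q)"
    then have [measurable]: "A \<in> sets borel" by simp
    have "emeasure (distr lborel borel Q) A = (\<integral>\<^sup>+x. indicator A x \<partial>distr lborel borel Q)"
      by simp
    also have "\<dots> = (\<integral>\<^sup>+x. indicator A (Q x) \<partial>lborel)"
      by (rule nn_integral_distr) simp_all
    also have "\<dots> = (\<integral>\<^sup>+x. indicator A x \<partial>lborel)"
      by (rule nn_integral_lborel_orthogonal[OF Q]) simp
    finally show "emeasure (distr lborel borel Q) A = emeasure lborel A"
      by simp
  qed simp
  then have "(LINT x|lborel. f x) = (LINT x|distr lborel borel Q. f x)" by simp
  also have "\<dots> = (LINT x|lborel. f (Q x))"
    by (rule integral_distr) simp_all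
  finally show ?thesis by simp
qed

text \<open>The shells \<open>c^k \<le> |x| \<le> 2 c^k\<close> contribute a geometric series.\<close>

lemma nn_integral_norm_powr_scales:
  fixes S :: "'a::euclidean_space set" and c \<beta> :: real
  assumes c: "0 < c" "c powr (real DIM('a) - \<beta>) < 1"
    and S: "\<And>x. x \<in> S \<Longrightarrow> \<exists>k::nat. c^k \<le> norm x \<and> norm x \<le> 2 * c^k"
  shows "(\<integral>\<^sup>+x. ennreal (norm x powr (-\<beta>)) * indicator S x \<partial>lborel) < \<infinity>"
proof -
  let ?d = "real DIM('a)"
  define f :: "'a \<Rightarrow> ennreal" where
    "f x = ennreal (norm x powr (-\<beta>)) * indicator {x. 1 \<le> norm x \<and> norm x \<le> 2} x" for x
  have [measurable]: "f \<in> borel_measurable borel" unfolding f_def by measurable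
  let ?B = "max 1 (2 powr (-\<beta>))"
  have "f x \<le> ennreal ?B * indicator (cball 0 2) x" for x
  proof (cases "1 \<le> norm x \<and> norm x \<le> 2")
    case True
    then have "norm x powr (-\<beta>) \<le> ?B"
      using powr_mono2'[of "-\<beta>" 1 "norm x"] powr_mono2[of "-\<beta>" "norm x" 2]
      by (cases "\<beta> \<ge> 0") auto
    then show ?thesis using True by (simp add: f_def ennreal_leI)
  qed (auto simp: f_def)
  then have "(\<integral>\<^sup>+x. f x \<partial>lborel) \<le> (\<integral>\<^sup>+x. ennreal ?B * indicator (cball (0::'a) 2) x \<partial>lborel)"
    by (intro nn_integral_mono) auto
  also have "\<dots> = ennreal ?B * emeasure lborel (cball (0::'a) 2)"
    by (rule nn_integral_cmult_indicator) simp
  also have "\<dots> < \<infinity>"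
    using emeasure_lborel_cball_finite[of "0::'a" 2] by (simp add: ennreal_mult_less_top)
  finally have F: "(\<integral>\<^sup>+x. f x \<partial>lborel) < \<infinity>" .
  have "ennreal (norm x powr (-\<beta>)) * indicator S x
      \<le> (\<Sum>k. ennreal (c powr (- \<beta> * real k)) * f (x /\<^sub>R c^k))" for x
  proof (cases "x \<in> S")
    case True
    then obtain k :: nat where k: "c^k \<le> norm x" "norm x \<le> 2 * c^k" using S by blast
    have ck: "c ^ k > 0" using c by simp
    have "norm x powr (-\<beta>) = c powr (- \<beta> * real k) * (norm x / c^k) powr (-\<beta>)"
      using c by (simp add: powr_divide powr_realpow[symmetric] powr_powr mult.commute)
    moreover have "1 \<le> norm x / c^k" "norm x / c^k \<le> 2"
      using k ck by (simp_all add: field_simps)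
    ultimately have "ennreal (norm x powr (-\<beta>)) = ennreal (c powr (- \<beta> * real k)) * f (x /\<^sub>R c^k)"
      using c by (simp add: f_def ennreal_mult' divide_inverse mult.commute)
    also have "\<dots> \<le> (\<Sum>k. ennreal (c powr (- \<beta> * real k)) * f (x /\<^sub>R c^k))"
      using sum_le_suminf[of "\<lambda>k. ennreal (c powr (- \<beta> * real k)) * f (x /\<^sub>R c^k)" "{k}"]
      by simp
    finally show ?thesis by (simp add: True)
  qed simp
  then have "(\<integral>\<^sup>+x. ennreal (norm x powr (-\<beta>)) * indicator S x \<partial>lborel)
     \<le> (\<integral>\<^sup>+x. (\<Sum>k. ennreal (c powr (- \<beta> * real k)) * f (x /\<^sub>R c^k)) \<partial>lborel)"
    by (intro nn_integral_mono)
  also have "\<dots> = (\<Sum>k. ennreal (c powr (- \<beta> * real k)) * (\<integral>\<^sup>+x. f (x /\<^sub>R c^k) \<partial>lborel))"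
    by (subst nn_integral_suminf) (simp_all add: nn_integral_cmult)
  \<comment> \<open>Rescaling the k-th shell to the reference shell contributes \<open>c^k\<close>
    to the power of the dimension, so the series has ratio \<open>c powr (?d - \<beta>)\<close>. The
    same hypothesis thus covers small scales (\<open>c = 1/2\<close>) and large ones
    (\<open>c = 2\<close>).\<close>
  also have "\<dots> = (\<Sum>k. ennreal ((c powr (?d - \<beta>))^k) * (\<integral>\<^sup>+x. f x \<partial>lborel))"
  proof (intro suminf_cong)
    fix k :: nat
    have "(\<integral>\<^sup>+x. f (x /\<^sub>R c^k) \<partial>lborel) = ennreal (\<bar>c^k\<bar>^DIM('a)) * (\<integral>\<^sup>+x. f (0 + x) \<partial>lborel)"
      using nn_integral_lborel_affine[of "\<lambda>x. f (x /\<^sub>R c^k)" "c^k" 0] c by simp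
    moreover have "c powr (- \<beta> * real k) * (c^k)^DIM('a) = (c powr (?d - \<beta>))^k"
      using c by (simp add: powr_realpow[symmetric] powr_powr powr_add[symmetric] algebra_simps)
    ultimately show "ennreal (c powr (- \<beta> * real k)) * (\<integral>\<^sup>+x. f (x /\<^sub>R c^k) \<partial>lborel)
       = ennreal ((c powr (?d - \<beta>))^k) * (\<integral>\<^sup>+x. f x \<partial>lborel)"
      using c by (simp add: mult.assoc[symmetric] ennreal_mult'[symmetric])
  qed
  also have "\<dots> = ennreal (\<Sum>k. (c powr (?d - \<beta>))^k) * (\<integral>\<^sup>+x. f x \<partial>lborel)"
    using c by (simp add: suminf_ennreal_eq[OF _ summable_sums[OF summable_geometric]])
  also have "\<dots> < \<infinity>" using F by (simp add: ennreal_mult_less_top)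
  finally show ?thesis .
qed

lemma ex_dyadic_scale:
  fixes y :: real
  assumes "1 \<le> y"
  shows "\<exists>k::nat. 2^k \<le> y \<and> y \<le> 2 * 2^k"
proof -
  have "(2::real) ^ nat \<lfloor>log 2 y\<rfloor> = 2 powr \<lfloor>log 2 y\<rfloor>"
    using assms by (simp add: powr_realpow[symmetric])
  moreover have "2 powr \<lfloor>log 2 y\<rfloor> \<le> 2 powr log 2 y" "2 powr log 2 y \<le> 2 powr (\<lfloor>log 2 y\<rfloor> + 1)"
    by (auto intro!: powr_mono) linarith?
  ultimately show ?thesis
    using assms by (intro exI[of _ "nat \<lfloor>log 2 y\<rfloor>"]) (simp add: powr_add)
qed

lemma nn_integral_norm_powr_cball:
  assumes "\<beta> < real DIM('a::euclidean_space)"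
  shows "(\<integral>\<^sup>+x. ennreal (norm x powr (-\<beta>)) * indicator (cball (0::'a) 1) x \<partial>lborel) < \<infinity>"
proof -
  have "(\<integral>\<^sup>+x. ennreal (norm x powr (-\<beta>)) * indicator (cball (0::'a) 1) x \<partial>lborel)
     \<le> (\<integral>\<^sup>+x. ennreal (norm x powr (-\<beta>)) * indicator (cball (0::'a) 1 - {0}) x \<partial>lborel)"
    by (intro nn_integral_mono) (auto simp: indicator_def)
  also have "\<dots> < \<infinity>"
  proof (rule nn_integral_norm_powr_scales[where c="1/2"])
    show "(1/2) powr (real DIM('a) - \<beta>) < 1"
      using assms powr_less_mono'[of "1/2" 0 "real DIM('a) - \<beta>"] by simp
  next
    fix x :: 'a assume "x \<in> cball 0 1 - {0}"
    then have x: "0 < norm x" "norm x \<le> 1" by auto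
    then have "1 \<le> 2 / norm x" "1 \<le> 1 / norm x" by (auto simp: field_simps)
    with ex_dyadic_scale[of "1 / norm x"] obtain k where k: "2^k \<le> 1 / norm x" "1 / norm x \<le> 2 * 2^k"
      by auto
    then have "2^k * norm x \<le> 1" "1 \<le> 2 * 2^k * norm x" using x by (auto simp: field_simps)
    \<comment> \<open>The index is \<open>k+1\<close> because inversion turns the upper bound
      \<open>2 * 2^k\<close> for \<open>1 / norm x\<close> into the lower bound for
      \<open>norm x\<close>.\<close>
    then have "(1/2)^(k+1) \<le> norm x \<and> norm x \<le> 2 * (1/2)^(k+1)"
      by (auto simp: field_simps power_divide)
    then show "\<exists>k::nat. (1/2)^k \<le> norm x \<and> norm x \<le> 2 * (1/2)^k" by blast
  qed simp
  finally show ?thesis .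
qed

lemma nn_integral_norm_powr_outside:
  assumes "real DIM('a::euclidean_space) < \<beta>"
  shows "(\<integral>\<^sup>+x. ennreal (norm x powr (-\<beta>)) * indicator {x::'a. 1 \<le> norm x} x \<partial>lborel) < \<infinity>"
proof (rule nn_integral_norm_powr_scales[where c=2])
  show "2 powr (real DIM('a) - \<beta>) < 1" using assms by (simp add: powr_less_one)
qed (use ex_dyadic_scale in auto)

text \<open>Made to serve as a majorant: singularity and decay sit in one product, with one
  condition for the origin and one for infinity. \<open>p\<close> may have either sign, whence the
  absolute value in the constant.\<close>

lemma integrable_norm_powr_weight:
  assumes "\<beta> < real DIM('a::euclidean_space)" "real DIM('a) < \<beta> + p"
  shows "integrable lborel (\<lambda>x::'a. norm x powr (-\<beta>) * decay p x)"
proof (rule integrableI_bounded)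
  let ?C = "2 powr \<bar>p\<bar>"
  let ?f = "\<lambda>x::'a. ennreal (norm x powr (-\<beta>)) * indicator (cball (0::'a) 1) x"
  let ?g = "\<lambda>x::'a. ennreal (norm x powr (-(\<beta>+p))) * indicator {x::'a. 1 \<le> norm x} x"
  have [measurable]: "cball (0::'a) 1 \<in> sets borel" by simp
  have *: "ennreal (norm (norm x powr (-\<beta>) * decay p x)) \<le> ennreal ?C * (?f x + ?g x)" for x :: 'a
  proof (cases "norm x \<le> 1")
    case True
    have "decay p x \<le> (1 + norm x) powr \<bar>p\<bar>"
      by (intro powr_mono) auto
    also have "\<dots> \<le> ?C" using True by (intro powr_mono2) auto
    finally have "norm x powr (-\<beta>) * decay p x \<le> norm x powr (-\<beta>) * ?C"
      by (rule mult_left_mono) simp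
    then have "norm x powr (-\<beta>) * decay p x \<le> ?C * norm x powr (-\<beta>)"
      by (simp only: mult.commute)
    then have "ennreal (norm (norm x powr (-\<beta>) * decay p x)) \<le> ennreal ?C * ?f x"
      using True by (simp add: ennreal_mult'[symmetric] ennreal_leI)
    also have "\<dots> \<le> ennreal ?C * (?f x + ?g x)" by (intro mult_left_mono) auto
    finally show ?thesis .
  next
    case False
    then have x: "norm x > 1" by simp
    have x0: "x \<noteq> 0" using x by auto
    have "decay p x = norm x powr (-p) * ((1 + norm x) / norm x) powr (-p)"
      using x x0 by (subst powr_divide) auto
    also have "((1 + norm x) / norm x) powr (-p) \<le> ((1 + norm x) / norm x) powr \<bar>p\<bar>"
      using x x0 by (intro powr_mono) (simp_all add: le_divide_eq)
    also have "((1 + norm x) / norm x) powr \<bar>p\<bar> \<le> ?C"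
      using x x0 by (intro powr_mono2) (simp_all add: divide_le_eq)
    finally have "decay p x \<le> norm x powr (-p) * ?C"
      by (simp add: mult_left_mono)
    then have "norm x powr (-\<beta>) * decay p x \<le> norm x powr (-\<beta>) * (norm x powr (-p) * ?C)"
      by (rule mult_left_mono) simp
    also have "\<dots> = ?C * norm x powr (-(\<beta>+p))"
      using x by (simp add: powr_add[symmetric] mult_ac)
    finally have "ennreal (norm (norm x powr (-\<beta>) * decay p x)) \<le> ennreal ?C * ?g x"
      using x by (simp add: ennreal_mult'[symmetric] ennreal_leI)
    also have "\<dots> \<le> ennreal ?C * (?f x + ?g x)" by (intro mult_left_mono) auto
    finally show ?thesis .
  qed
  have "(\<integral>\<^sup>+x. ennreal (norm (norm x powr (-\<beta>) * decay p (x::'a))) \<partial>lborel)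
     \<le> (\<integral>\<^sup>+x. ennreal ?C * (?f x + ?g x) \<partial>lborel)"
    by (intro nn_integral_mono *)
  also have "\<dots> = ennreal ?C * ((\<integral>\<^sup>+x. ?f x \<partial>lborel) + (\<integral>\<^sup>+x. ?g x \<partial>lborel))"
    by (subst nn_integral_cmult) (simp_all add: nn_integral_add)
  also have "\<dots> < \<infinity>"
    using nn_integral_norm_powr_cball[OF assms(1)] nn_integral_norm_powr_outside[of "\<beta>+p", where 'a='a] assms(2)
    by (simp add: ennreal_mult_less_top)
  finally show "(\<integral>\<^sup>+x. ennreal (norm (norm (x::'a) powr (-\<beta>) * decay p x)) \<partial>lborel) < \<infinity>" .
qed simp

lemma integrable_weight:
  assumes "real DIM('a::euclidean_space) < p"
  shows "integrable lborel (\<lambda>x::'a. decay p x)"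
proof -
  \<comment> \<open>At the origin the left side is \<open>0\<close>, since
    \<open>0 powr 0 = 0\<close>, so the two functions agree only almost everywhere.\<close>
  have "AE x in lborel. norm (x::'a) powr (-0) * decay p x = decay p x"
    using AE_lborel_singleton[of "0::'a"] by eventually_elim simp
  moreover have "integrable lborel (\<lambda>x::'a. norm x powr (-0) * decay p x)"
    by (rule integrable_norm_powr_weight) (use assms in simp_all)
  ultimately show ?thesis
    by (subst integrable_cong_AE[symmetric]) auto
qed

section \<open>Fractional Sobolev regularity\<close>

lemma borel_measurable_vec_nth [measurable]: "(\<lambda>x::real^'n. x $ i) \<in> borel_measurable borel"
  by (intro borel_measurable_continuous_onI continuous_intros)

lemma u_fun_measurable [measurable]: "u_fun i s \<delta> \<in> borel_measurable borel"
  unfolding u_fun_def[abs_def] by measurable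

lemma u_fun_scale: "r > 0 \<Longrightarrow> u_fun i s \<delta> (r *\<^sub>R x) = r powr (s - \<delta>) * u_fun i s \<delta> x"
  by (simp add: u_fun_def powr_mult)

lemma u_fun_minus: "u_fun i s \<delta> (- x) = - u_fun i s \<delta> x"
  by (simp add: u_fun_def)

lemma abs_u_fun_le: "\<bar>u_fun i s \<delta> x\<bar> \<le> norm x powr (s - \<delta>)"
proof -
  have "\<bar>x $ i\<bar> / norm x \<le> 1"
    using component_le_norm_cart[of x i] by (cases "x = 0") (auto simp: divide_le_eq)
  then have "norm x powr (s - \<delta>) * (\<bar>x $ i\<bar> / norm x) \<le> norm x powr (s - \<delta>) * 1"
    by (intro mult_left_mono) auto
  then show ?thesis by (simp add: u_fun_def abs_mult)
qed

lemma u_fun_eq: "u_fun i s \<delta> x = norm x powr (s - \<delta> - 1) * x $ i"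
  by (cases "x = 0") (auto simp: u_fun_def powr_diff)

lemma powr_lipschitz:
  fixes b l h :: real
  assumes "0 < l"
  shows "\<exists>C\<ge>0. \<forall>r t. l \<le> r \<and> r \<le> h \<and> l \<le> t \<and> t \<le> h \<longrightarrow> \<bar>r powr b - t powr b\<bar> \<le> C * \<bar>r - t\<bar>"
proof -
  let ?C = "\<bar>b\<bar> * max (l powr (b - 1)) (h powr (b - 1))"
  have "\<bar>r powr b - t powr b\<bar> \<le> ?C * \<bar>r - t\<bar>"
    if "l \<le> r" "r \<le> h" "l \<le> t" "t \<le> h" for r t
  proof -
    have "norm (r powr b - t powr b) \<le> ?C * norm (r - t)"
    proof (rule field_differentiable_bound[where S="{l..h}" and f'="\<lambda>z. b * z powr (b - 1)"])
      fix z assume z: "z \<in> {l..h}"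
      then show "((\<lambda>a. a powr b) has_field_derivative b * z powr (b - 1)) (at z within {l..h})"
        using assms by (intro has_real_derivative_powr[THEN has_field_derivative_at_within]) auto
      have "z powr (b - 1) \<le> max (l powr (b - 1)) (h powr (b - 1))"
        using z assms powr_mono2'[of "b-1" l z] powr_mono2[of "b-1" z h]
        by (cases "b \<ge> 1") auto
      then show "norm (b * z powr (b - 1)) \<le> ?C"
        by (simp add: abs_mult mult_left_mono)
    qed (use that in auto)
    then show ?thesis by simp
  qed
  moreover have "?C \<ge> 0" by (simp add: le_max_iff_disj)
  ultimately show ?thesis by blast
qed

text \<open>The annulus is not convex, so the mean value theorem is applied to the radial profile on
  an interval, and the linear factor \<open>x $ i\<close> is split off separately.\<close>

lemma u_fun_lipschitz:
  "\<exists>C\<ge>0. \<forall>x y::real^'n. 1/2 \<le> norm x \<and> norm x \<le> 2 \<and> 1/2 \<le> norm y \<and> norm y \<le> 2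
     \<longrightarrow> \<bar>u_fun i s \<delta> x - u_fun i s \<delta> y\<bar> \<le> C * norm (x - y)"
proof -
  define b where "b = s - \<delta> - 1"
  obtain C where C: "C \<ge> 0" "\<And>r t. 1/2 \<le> r \<and> r \<le> 2 \<and> 1/2 \<le> t \<and> t \<le> 2 \<Longrightarrow> \<bar>r powr b - t powr b\<bar> \<le> C * \<bar>r - t\<bar>"
    using powr_lipschitz[of "1/2" 2 b] by auto
  let ?M = "max ((1/2) powr b) (2 powr b)"
  have "\<bar>u_fun i s \<delta> x - u_fun i s \<delta> y\<bar> \<le> (?M + 2 * C) * norm (x - y)"
    if "1/2 \<le> norm x" "norm x \<le> 2" "1/2 \<le> norm y" "norm y \<le> 2" for x y :: "real^'n"
  proof -
    have 1: "norm x powr b \<le> ?M"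
      using that powr_mono2'[of b "1/2" "norm x"] powr_mono2[of b "norm x" 2]
      by (cases "b \<ge> 0") auto
    have 2: "\<bar>x $ i - y $ i\<bar> \<le> norm (x - y)" "\<bar>y $ i\<bar> \<le> 2"
      using component_le_norm_cart[of "x - y" i] component_le_norm_cart[of y i] that by auto
    have "\<bar>norm x powr b - norm y powr b\<bar> \<le> C * \<bar>norm x - norm y\<bar>"
      using C(2) that by auto
    also have "\<dots> \<le> C * norm (x - y)"
      by (intro mult_left_mono norm_triangle_ineq3 C)
    finally have 3: "\<bar>norm x powr b - norm y powr b\<bar> \<le> C * norm (x - y)" .
    have "u_fun i s \<delta> x - u_fun i s \<delta> y
        = norm x powr b * (x $ i - y $ i) + y $ i * (norm x powr b - norm y powr b)"
      by (simp add: u_fun_eq b_def algebra_simps)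
    also have "\<bar>\<dots>\<bar> \<le> norm x powr b * \<bar>x $ i - y $ i\<bar> + \<bar>y $ i\<bar> * \<bar>norm x powr b - norm y powr b\<bar>"
      by (rule order_trans[OF abs_triangle_ineq]) (simp add: abs_mult)
    also have "\<dots> \<le> ?M * norm (x - y) + 2 * (C * norm (x - y))"
      using 1 2 3 C by (intro add_mono mult_mono) (auto simp: le_max_iff_disj)
    finally show ?thesis by (simp add: algebra_simps)
  qed
  then show ?thesis using C(1)
    by (intro exI[of _ "?M + 2 * C"]) (auto intro!: add_nonneg_nonneg max.coboundedI1)
qed

section \<open>Gagliardo energies of a homogeneous function\<close>

lemma nn_integral_lebesgue_on_open:
  assumes "open U"
  shows "(\<integral>\<^sup>+x. f x \<partial>lebesgue_on U) = (\<integral>\<^sup>+x. f x * indicator U x \<partial>lborel)"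
  using assms by (subst nn_integral_restrict_space) (auto simp: nn_integral_completion)

definition gagliardo :: "real \<Rightarrow> real \<Rightarrow> (real^'n \<Rightarrow> real) \<Rightarrow> real^'n \<Rightarrow> real^'n \<Rightarrow> ennreal" where
  "gagliardo t q v x y = ennreal (\<bar>v x - v y\<bar> powr q / norm (x - y) powr (real CARD('n) + t * q))"

lemma gagliardo_measurable [measurable]:
  assumes [measurable]: "v \<in> borel_measurable borel" "f \<in> borel_measurable M" "g \<in> borel_measurable M"
  shows "(\<lambda>x. gagliardo t q v (f x) (g x)) \<in> borel_measurable M"
  unfolding gagliardo_def by measurable

lemma gagliardo_commute: "gagliardo t q v x y = gagliardo t q v y x"
  by (simp add: gagliardo_def norm_minus_commute abs_minus_commute)

lemma sobolev_frac_iff: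
  fixes v :: "real^'n \<Rightarrow> real"
  assumes U: "open U" and v: "v \<in> borel_measurable borel"
  shows "v \<in> sobolev_frac t q U \<longleftrightarrow>
    (\<integral>\<^sup>+x. ennreal (\<bar>v x\<bar> powr q) * indicator U x \<partial>lborel) < \<infinity> \<and>
    (\<integral>\<^sup>+x. (\<integral>\<^sup>+y. gagliardo t q v x y * indicator U y \<partial>lborel) * indicator U x \<partial>lborel) < \<infinity>"
proof -
  have "v \<in> borel_measurable (lebesgue_on U)"
    using v by (intro measurable_restrict_space1 measurable_completion) simp
  then show ?thesis
    by (simp add: sobolev_frac_def nn_integral_lebesgue_on_open[OF U] gagliardo_def)
qed

lemma sobolev_frac_mono:
  fixes v :: "real^'n \<Rightarrow> real"
  assumes "open U" "open V" "U \<subseteq> V" "v \<in> borel_measurable borel" and V: "v \<in> sobolev_frac t q V"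
  shows "v \<in> sobolev_frac t q U"
proof -
  have ind: "indicator U x \<le> (indicator V x :: ennreal)" for x
    using \<open>U \<subseteq> V\<close> by (auto simp: indicator_def)
  have "(\<integral>\<^sup>+x. ennreal (\<bar>v x\<bar> powr q) * indicator U x \<partial>lborel)
      \<le> (\<integral>\<^sup>+x. ennreal (\<bar>v x\<bar> powr q) * indicator V x \<partial>lborel)"
    by (intro nn_integral_mono mult_left_mono ind) auto
  moreover have "(\<integral>\<^sup>+x. (\<integral>\<^sup>+y. gagliardo t q v x y * indicator U y \<partial>lborel) * indicator U x \<partial>lborel)
      \<le> (\<integral>\<^sup>+x. (\<integral>\<^sup>+y. gagliardo t q v x y * indicator V y \<partial>lborel) * indicator V x \<partial>lborel)"
    by (intro nn_integral_mono mult_mono mult_left_mono ind) auto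
  ultimately show ?thesis
    using V unfolding sobolev_frac_iff[OF assms(1,4)] sobolev_frac_iff[OF assms(2,4)]
    by (meson order.strict_trans1)
qed

context
  fixes i :: "'n::finite" and s \<delta> t q :: real
  assumes t: "0 < t" "t < 1" and q: "1 < q"
begin

private abbreviation (input) "u \<equiv> u_fun i s \<delta>"
private abbreviation (input) "a \<equiv> s - \<delta>"

lemma gagliardo_u_fun_scale:
  assumes "r > 0"
  shows "gagliardo t q u (r *\<^sub>R x) (r *\<^sub>R y) = ennreal (r powr ((a - t) * q - real CARD('n))) * gagliardo t q u x y"
proof -
  have "\<bar>u (r *\<^sub>R x) - u (r *\<^sub>R y)\<bar> = r powr a * \<bar>u x - u y\<bar>"
    using assms by (simp add: u_fun_scale abs_mult flip: right_diff_distrib)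
  moreover have "norm (r *\<^sub>R x - r *\<^sub>R y) = r * norm (x - y)"
    using assms by (simp flip: scaleR_diff_right)
  moreover have "(r powr a) powr q / r powr (real CARD('n) + t * q) = r powr ((a - t) * q - real CARD('n))"
    by (simp add: powr_powr algebra_simps flip: powr_diff)
  ultimately show ?thesis
    using assms by (simp add: gagliardo_def powr_mult ennreal_mult'[symmetric] flip: times_divide_times_eq)
qed

text \<open>Away from the origin the Lipschitz bound leaves a singularity of order d + t q - q at
  \<open>e\<close>, integrable because t < 1. Near the origin the kernel is bounded, and what
  remains is of size 1 + |y|^(a q), integrable because -a q < d. None of the constants depends on
  \<open>e\<close>, so the bound is uniform although \<open>u\<close> is not radial.\<close>

lemma gagliardo_u_fun_sphere:
  assumes ad: "t * q - a * q < real CARD('n)"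
  obtains M :: real where
    "\<And>e. norm e = 1 \<Longrightarrow> (\<integral>\<^sup>+y. gagliardo t q u e y * indicator (cball 0 1) y \<partial>lborel) \<le> ennreal M"
proof -
  obtain L where L: "L \<ge> 0" "\<And>x y. 1/2 \<le> norm x \<and> norm x \<le> 2 \<and> 1/2 \<le> norm y \<and> norm y \<le> 2
     \<Longrightarrow> \<bar>u x - u y\<bar> \<le> L * norm (x - y)"
    using u_fun_lipschitz[of i s \<delta>] by blast
  define b where "b = real CARD('n) + t * q - q"
  \<comment> \<open>\<open>N\<close> only has to be large. On the region where the bound is needed
    \<open>decay N\<close> costs a constant factor, and it makes the three majorants integrable over
    the whole space.\<close>
  define N where "N = 2 * real CARD('n) + \<bar>b\<bar> + \<bar>a * q\<bar> + 1"
  define W1 :: "real^'n \<Rightarrow> real" where "W1 = (\<lambda>y. norm y powr (-b) * decay N y)"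
  define W2 :: "real^'n \<Rightarrow> real" where "W2 = (\<lambda>y. decay N y)"
  define W3 :: "real^'n \<Rightarrow> real" where "W3 = (\<lambda>y. norm y powr (-(-(a*q))) * decay N y)"
  have d1: "real CARD('n) \<ge> 1" by simp
  have tq: "t * q < q" "0 < t * q" using t q by auto
  have "-(a*q) < real CARD('n)" using ad tq by linarith
  have "b < real CARD('n)" "real CARD('n) < b + N" using tq d1 by (auto simp: b_def N_def)
  then have W1: "integrable lborel W1"
    unfolding W1_def by (intro integrable_norm_powr_weight) auto
  have W2: "integrable lborel W2"
    unfolding W2_def by (rule integrable_weight) (use d1 in \<open>simp add: N_def\<close>)
  have "real CARD('n) < -(a*q) + N" using d1 by (simp add: N_def)
  then have W3: "integrable lborel W3"
    unfolding W3_def using \<open>-(a*q) < real CARD('n)\<close> by (intro integrable_norm_powr_weight) auto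
  have N0: "N > 0" using d1 by (simp add: N_def)
  define C where "C = max (L powr q * 3 powr N) (2 powr q * 2 powr (real CARD('n) + t * q) * 2 powr N)"
  have C0: "C \<ge> 0" by (auto simp: C_def intro!: max.coboundedI1)
  have W0: "W1 y \<ge> 0" "W2 y \<ge> 0" "W3 y \<ge> 0" for y by (auto simp: W1_def W2_def W3_def)
  have bound: "\<bar>u e - u y\<bar> powr q / norm (e - y) powr (real CARD('n) + t * q) \<le> C * (W1 (e - y) + W2 y + W3 y)"
    if e: "norm e = 1" and y: "norm y \<le> 1" for e y
  proof (cases "norm y \<ge> 1/2")
    case True
    have "\<bar>u e - u y\<bar> powr q \<le> (L * norm (e - y)) powr q"
      using True e y q by (intro powr_mono2 L) auto
    then have "\<bar>u e - u y\<bar> powr q / norm (e - y) powr (real CARD('n) + t * q)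
       \<le> (L * norm (e - y)) powr q / norm (e - y) powr (real CARD('n) + t * q)"
      by (rule divide_right_mono) simp
    also have "\<dots> = L powr q * norm (e - y) powr (-b)"
    proof -
      have "- b = q - (real CARD('n) + t * q)" by (simp add: b_def)
      then show ?thesis using L by (simp only: powr_diff) (simp add: powr_mult)
    qed
    also have "\<dots> \<le> L powr q * norm (e - y) powr (-b) * (3 powr N * decay N (e - y))"
    proof -
      have "norm (e - y) \<le> 2" using norm_triangle_ineq4[of e y] e y by simp
      then have "1 \<le> 3 powr N * decay N (e - y)"
        using N0 powr_mono2'[of "-N" "1 + norm (e - y)" 3]
        by (simp add: powr_minus field_simps add_pos_nonneg)
      then show ?thesis using mult_left_mono[of 1 _ "L powr q * norm (e - y) powr (-b)"] by simp
    qed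
    also have "\<dots> = (L powr q * 3 powr N) * W1 (e - y)" by (simp add: W1_def)
    also have "\<dots> \<le> C * W1 (e - y)" using W0 by (intro mult_right_mono) (auto simp: C_def)
    also have "\<dots> \<le> C * (W1 (e - y) + W2 y + W3 y)" using W0 C0 by (intro mult_left_mono) auto
    finally show ?thesis .
  next
    case False
    then have y2: "norm y < 1/2" by simp
    then have ey: "norm (e - y) \<ge> 1/2" using norm_triangle_ineq2[of e y] e by simp
    have "\<bar>u e - u y\<bar> \<le> \<bar>u e\<bar> + \<bar>u y\<bar>" by (rule abs_triangle_ineq4)
    also have "\<dots> \<le> 1 + norm y powr a"
      using abs_u_fun_le[of i s \<delta> e] abs_u_fun_le[of i s \<delta> y] e by simp
    also have "\<dots> \<le> 2 * max 1 (norm y powr a)" by simp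
    finally have "\<bar>u e - u y\<bar> powr q \<le> (2 * max 1 (norm y powr a)) powr q"
      using q by (intro powr_mono2) auto
    also have "\<dots> = 2 powr q * max 1 (norm y powr a) powr q" by (simp add: powr_mult)
    also have "max 1 (norm y powr a) powr q \<le> 1 + norm y powr (a * q)"
      by (auto simp: max_def powr_powr)
    finally have 1: "\<bar>u e - u y\<bar> powr q \<le> 2 powr q * (1 + norm y powr (a * q))" by simp
    have "(1/2) powr (real CARD('n) + t * q) \<le> norm (e - y) powr (real CARD('n) + t * q)"
      using ey d1 tq by (intro powr_mono2) auto
    then have 2: "1 / norm (e - y) powr (real CARD('n) + t * q) \<le> 2 powr (real CARD('n) + t * q)"
    proof -
      have "norm (e - y) powr (real CARD('n) + t * q) > 0" using ey by auto
      then show ?thesis using \<open>(1/2) powr _ \<le> _\<close>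
        by (simp add: powr_divide divide_le_eq mult.commute)
    qed
    have 3: "1 \<le> 2 powr N * decay N y"
      using N0 powr_mono2'[of "-N" "1 + norm y" 2] y
      by (simp add: powr_minus field_simps add_pos_nonneg)
    have "\<bar>u e - u y\<bar> powr q / norm (e - y) powr (real CARD('n) + t * q)
      = \<bar>u e - u y\<bar> powr q * (1 / norm (e - y) powr (real CARD('n) + t * q)) * 1" by simp
    also have "\<dots> \<le> (2 powr q * (1 + norm y powr (a * q))) * 2 powr (real CARD('n) + t * q) * (2 powr N * decay N y)"
      using 1 2 3 by (intro mult_mono) auto
    also have "\<dots> = (2 powr q * 2 powr (real CARD('n) + t * q) * 2 powr N) * (W2 y + W3 y)"
      by (simp add: W2_def W3_def algebra_simps)
    also have "\<dots> \<le> C * (W2 y + W3 y)" using W0 by (intro mult_right_mono) (auto simp: C_def)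
    also have "\<dots> \<le> C * (W1 (e - y) + W2 y + W3 y)" using W0 C0 by (intro mult_left_mono) auto
    finally show ?thesis .
  qed
  show thesis
  proof (rule that[of "C * (integral\<^sup>L lborel W1 + integral\<^sup>L lborel W2 + integral\<^sup>L lborel W3)"])
    fix e :: "real^'n" assume e: "norm e = 1"
    have W1e: "integrable lborel (\<lambda>y. W1 (e - y))" "(LINT y|lborel. W1 (e - y)) = integral\<^sup>L lborel W1"
      using integrable_lborel_affine[OF W1, of "-1" e] integral_lborel_affine[of W1 "-1" e] W1
      by auto
    have "(\<integral>\<^sup>+y. gagliardo t q u e y * indicator (cball 0 1) y \<partial>lborel)
       \<le> (\<integral>\<^sup>+y. ennreal (C * (W1 (e - y) + W2 y + W3 y)) \<partial>lborel)"
      using bound[OF e] by (intro nn_integral_mono) (auto simp: gagliardo_def indicator_def ennreal_leI)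
    also have "\<dots> = ennreal (LINT y|lborel. C * (W1 (e - y) + W2 y + W3 y))"
      using W1e W2 W3 C0 W0 by (intro nn_integral_eq_integral) auto
    also have "(LINT y|lborel. C * (W1 (e - y) + W2 y + W3 y))
        = C * (integral\<^sup>L lborel W1 + integral\<^sup>L lborel W2 + integral\<^sup>L lborel W3)"
      using W1e W2 W3 by (simp add: Bochner_Integration.integral_add)
    finally show "(\<integral>\<^sup>+y. gagliardo t q u e y * indicator (cball 0 1) y \<partial>lborel)
       \<le> ennreal (C * (integral\<^sup>L lborel W1 + integral\<^sup>L lborel W2 + integral\<^sup>L lborel W3))" .
  qed
qed

lemma u_fun_sobolev_frac_ball:
  assumes ad: "t * q - a * q < real CARD('n)"
  shows "u \<in> sobolev_frac t q (ball 0 1)"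
proof -
  obtain M where M: "\<And>e. norm e = 1 \<Longrightarrow>
      (\<integral>\<^sup>+y. gagliardo t q u e y * indicator (cball 0 1) y \<partial>lborel) \<le> ennreal M"
    using gagliardo_u_fun_sphere[OF ad] by blast
  let ?B = "ball (0::real^'n) 1"
  have [measurable]: "?B \<in> sets borel" "cball (0::real^'n) 1 \<in> sets borel" by auto
  have tq: "0 < t * q" using t q by auto
  have "(\<integral>\<^sup>+x. ennreal (\<bar>u x\<bar> powr q) * indicator ?B x \<partial>lborel)
      \<le> (\<integral>\<^sup>+x. ennreal (norm x powr (-(-(a*q)))) * indicator (cball (0::real^'n) 1) x \<partial>lborel)"
  proof (intro nn_integral_mono mult_mono ennreal_leI)
    fix x :: "real^'n"
    have "\<bar>u x\<bar> powr q \<le> (norm x powr a) powr q"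
      using q by (intro powr_mono2 abs_u_fun_le) auto
    then show "\<bar>u x\<bar> powr q \<le> norm x powr (-(-(a*q)))" by (simp add: powr_powr)
  qed (auto simp: indicator_def)
  also have "\<dots> < \<infinity>"
    by (rule nn_integral_norm_powr_cball) (use ad tq in auto)
  finally have 1: "(\<integral>\<^sup>+x. ennreal (\<bar>u x\<bar> powr q) * indicator ?B x \<partial>lborel) < \<infinity>" .
  define H where "H x = (\<integral>\<^sup>+y. gagliardo t q u x y * indicator {y. norm y \<le> norm x} y \<partial>lborel)" for x
  have [measurable]: "H \<in> borel_measurable borel"
    unfolding H_def by measurable
  \<comment> \<open>Substituting \<open>r *\<^sub>R y\<close> for y gives a factor r^d from the
    measure and r^((a - t) q - d) from the integrand, so the dimension cancels.\<close>
  have H: "H x \<le> ennreal M * ennreal (norm x powr (-((t - a)*q)))" if "x \<noteq> 0" for x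
  proof -
    define r where "r = norm x"
    have r: "r > 0" using that by (simp add: r_def)
    define e where "e = x /\<^sub>R r"
    have e: "norm e = 1" "x = r *\<^sub>R e" using r by (auto simp: e_def r_def)
    have "H x = ennreal (\<bar>r\<bar>^CARD('n)) * (\<integral>\<^sup>+y. gagliardo t q u x (0 + r *\<^sub>R y) * indicator {y. norm y \<le> norm x} (0 + r *\<^sub>R y) \<partial>lborel)"
      unfolding H_def using r by (subst nn_integral_lborel_affine[where c=r and t=0]) auto
    also have "(\<integral>\<^sup>+y. gagliardo t q u x (0 + r *\<^sub>R y) * indicator {y. norm y \<le> norm x} (0 + r *\<^sub>R y) \<partial>lborel)
       = (\<integral>\<^sup>+y. ennreal (r powr ((a - t) * q - real CARD('n))) * (gagliardo t q u e y * indicator (cball 0 1) y) \<partial>lborel)"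
    proof (rule nn_integral_cong)
      fix y :: "real^'n"
      have "indicator {y. norm y \<le> norm x} (0 + r *\<^sub>R y) = (indicator (cball 0 1) y :: ennreal)"
        using r e by (auto simp: indicator_def)
      moreover have "gagliardo t q u x (0 + r *\<^sub>R y) = ennreal (r powr ((a - t) * q - real CARD('n))) * gagliardo t q u e y"
        using gagliardo_u_fun_scale[OF r, of e y] e by simp
      ultimately show "gagliardo t q u x (0 + r *\<^sub>R y) * indicator {y. norm y \<le> norm x} (0 + r *\<^sub>R y)
        = ennreal (r powr ((a - t) * q - real CARD('n))) * (gagliardo t q u e y * indicator (cball 0 1) y)"
        by (simp add: mult.assoc)
    qed
    also have "\<dots> = ennreal (r powr ((a - t) * q - real CARD('n))) * (\<integral>\<^sup>+y. gagliardo t q u e y * indicator (cball 0 1) y \<partial>lborel)"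
      by (rule nn_integral_cmult) measurable
    also have "\<dots> \<le> ennreal (r powr ((a - t) * q - real CARD('n))) * ennreal M"
      by (intro mult_left_mono M e) auto
    finally have "H x \<le> ennreal (\<bar>r\<bar>^CARD('n)) * (ennreal (r powr ((a - t) * q - real CARD('n))) * ennreal M)"
      by (simp add: mult_left_mono)
    also have "\<dots> = ennreal (r powr (-((t - a)*q))) * ennreal M"
      using r by (simp add: mult.assoc[symmetric] ennreal_mult'[symmetric] powr_realpow[symmetric]
          powr_add[symmetric] algebra_simps)
    finally show ?thesis by (simp add: r_def mult.commute)
  qed
  let ?I = "\<lambda>x y. gagliardo t q u x y * indicator ?B x * indicator {y. norm y \<le> norm x} y"
  have "(\<integral>\<^sup>+x. (\<integral>\<^sup>+y. gagliardo t q u x y * indicator ?B y \<partial>lborel) * indicator ?B x \<partial>lborel)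
     = (\<integral>\<^sup>+x. \<integral>\<^sup>+y. gagliardo t q u x y * indicator ?B y * indicator ?B x \<partial>lborel \<partial>lborel)"
    by (simp add: nn_integral_multc)
  \<comment> \<open>In every pair one point has norm at most that of the other, so by symmetry one
    of the two terms accounts for it. Pairs of equal norm are counted twice, which an upper bound
    tolerates.\<close>
  also have "\<dots> \<le> (\<integral>\<^sup>+x. \<integral>\<^sup>+y. ?I x y + ?I y x \<partial>lborel \<partial>lborel)"
    by (intro nn_integral_mono) (auto simp: indicator_def gagliardo_commute)
  also have "\<dots> = (\<integral>\<^sup>+x. (\<integral>\<^sup>+y. ?I x y \<partial>lborel) + (\<integral>\<^sup>+y. ?I y x \<partial>lborel) \<partial>lborel)"
    by (intro nn_integral_cong nn_integral_add) measurable
  also have "\<dots> = (\<integral>\<^sup>+x. \<integral>\<^sup>+y. ?I x y \<partial>lborel \<partial>lborel) + (\<integral>\<^sup>+x. \<integral>\<^sup>+y. ?I y x \<partial>lborel \<partial>lborel)"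
    by (rule nn_integral_add) measurable
  also have "(\<integral>\<^sup>+x. \<integral>\<^sup>+y. ?I y x \<partial>lborel \<partial>lborel) = (\<integral>\<^sup>+y. \<integral>\<^sup>+x. ?I y x \<partial>lborel \<partial>lborel)"
    by (rule lborel_pair.Fubini') measurable
  also have "(\<integral>\<^sup>+x. \<integral>\<^sup>+y. ?I x y \<partial>lborel \<partial>lborel) = (\<integral>\<^sup>+x. H x * indicator ?B x \<partial>lborel)"
    unfolding H_def by (subst nn_integral_multc[symmetric]) (measurable, simp add: mult_ac)
  finally have 2: "(\<integral>\<^sup>+x. (\<integral>\<^sup>+y. gagliardo t q u x y * indicator ?B y \<partial>lborel) * indicator ?B x \<partial>lborel)
      \<le> (\<integral>\<^sup>+x. H x * indicator ?B x \<partial>lborel) + (\<integral>\<^sup>+x. H x * indicator ?B x \<partial>lborel)" .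
  have "(\<integral>\<^sup>+x. H x * indicator ?B x \<partial>lborel)
     \<le> (\<integral>\<^sup>+x. ennreal M * (ennreal (norm x powr (-((t - a)*q))) * indicator (cball (0::real^'n) 1) x) \<partial>lborel)"
  proof (rule nn_integral_mono_AE)
    show "AE x in lborel. H x * indicator ?B x
      \<le> ennreal M * (ennreal (norm x powr (-((t - a)*q))) * indicator (cball (0::real^'n) 1) x)"
      using AE_lborel_singleton[of "0::real^'n"]
    proof eventually_elim
      case (elim x)
      then show ?case using H[OF elim] by (auto simp: indicator_def)
    qed
  qed
  also have "\<dots> = ennreal M * (\<integral>\<^sup>+x. ennreal (norm x powr (-((t - a)*q))) * indicator (cball (0::real^'n) 1) x \<partial>lborel)"
    by (rule nn_integral_cmult) measurable
  also have "\<dots> < \<infinity>"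
    using nn_integral_norm_powr_cball[of "(t - a) * q", where 'a="real^'n"] ad
    by (simp add: ennreal_mult_less_top algebra_simps)
  finally have "(\<integral>\<^sup>+x. H x * indicator ?B x \<partial>lborel) < \<infinity>" .
  with 2 have "(\<integral>\<^sup>+x. (\<integral>\<^sup>+y. gagliardo t q u x y * indicator ?B y \<partial>lborel) * indicator ?B x \<partial>lborel) < \<infinity>"
    by (auto intro: order.strict_trans1)
  with 1 show ?thesis by (simp add: sobolev_frac_iff)
qed

text \<open>If the energy on the ball of radius 1/2 were finite, a smaller ball with at least the
  same energy would leave nothing for the pairs in the shell between. But \<open>u\<close> is
  positive on the half-shell \<open>P\<close> and negative on \<open>Q\<close>, so those pairs
  contribute a positive amount.\<close>

lemma u_fun_not_sobolev_frac_ball: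
  assumes ad: "real CARD('n) \<le> t * q - a * q"
  shows "u \<notin> sobolev_frac t q (ball 0 (1/2))"
proof
  assume mem: "u \<in> sobolev_frac t q (ball 0 (1/2))"
  define G where "G R = (\<integral>\<^sup>+x. \<integral>\<^sup>+y. gagliardo t q u x y * indicator (ball 0 R) y * indicator (ball 0 R) x \<partial>lborel \<partial>lborel)" for R
  have [measurable]: "ball (0::real^'n) R \<in> sets borel" for R by auto
  have fin: "G (1/2) < \<infinity>"
    using mem by (simp add: sobolev_frac_iff G_def nn_integral_multc)
  let ?k = "(a - t) * q - real CARD('n)"
  have "G (1/4) = (\<integral>\<^sup>+x. ennreal ((1/2)^CARD('n)) * (\<integral>\<^sup>+y. gagliardo t q u x ((1/2) *\<^sub>R y) * indicator (ball 0 (1/4)) ((1/2) *\<^sub>R y) * indicator (ball 0 (1/4)) x \<partial>lborel) \<partial>lborel)"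
    unfolding G_def
    by (subst nn_integral_lborel_affine[where c="1/2" and t=0]) simp_all
  also have "\<dots> = ennreal ((1/2)^CARD('n)) * (\<integral>\<^sup>+x. \<integral>\<^sup>+y. gagliardo t q u x ((1/2) *\<^sub>R y) * indicator (ball 0 (1/4)) ((1/2) *\<^sub>R y) * indicator (ball 0 (1/4)) x \<partial>lborel \<partial>lborel)"
    by (rule nn_integral_cmult) measurable
  also have "(\<integral>\<^sup>+x. \<integral>\<^sup>+y. gagliardo t q u x ((1/2) *\<^sub>R y) * indicator (ball 0 (1/4)) ((1/2) *\<^sub>R y) * indicator (ball 0 (1/4)) x \<partial>lborel \<partial>lborel)
     = ennreal ((1/2)^CARD('n)) * (\<integral>\<^sup>+x. \<integral>\<^sup>+y. gagliardo t q u ((1/2) *\<^sub>R x) ((1/2) *\<^sub>R y) * indicator (ball 0 (1/4)) ((1/2) *\<^sub>R y) * indicator (ball 0 (1/4)) ((1/2) *\<^sub>R x) \<partial>lborel \<partial>lborel)"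
    by (subst nn_integral_lborel_affine[where c="1/2" and t=0]) simp_all
  also have "(\<integral>\<^sup>+x. \<integral>\<^sup>+y. gagliardo t q u ((1/2) *\<^sub>R x) ((1/2) *\<^sub>R y) * indicator (ball 0 (1/4)) ((1/2) *\<^sub>R y) * indicator (ball 0 (1/4)) ((1/2) *\<^sub>R x) \<partial>lborel \<partial>lborel)
     = (\<integral>\<^sup>+x. \<integral>\<^sup>+y. ennreal ((1/2) powr ?k) * (gagliardo t q u x y * indicator (ball 0 (1/2)) y * indicator (ball 0 (1/2)) x) \<partial>lborel \<partial>lborel)"
    by (intro nn_integral_cong) (subst gagliardo_u_fun_scale, auto simp: indicator_def)
  also have "\<dots> = ennreal ((1/2) powr ?k) * G (1/2)"
    by (simp add: nn_integral_cmult G_def)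
  finally have "G (1/4) = ennreal ((1/2)^CARD('n) * (1/2)^CARD('n) * (1/2) powr ?k) * G (1/2)"
    by (simp add: ennreal_mult' mult.assoc)
  also have "(1/2::real)^CARD('n) * (1/2)^CARD('n) * (1/2) powr ?k = (1/2) powr (real CARD('n) + (a - t) * q)"
    by (simp add: powr_realpow[symmetric] powr_add[symmetric] del: power_one_over)
  finally have scale: "G (1/4) = ennreal ((1/2) powr (real CARD('n) + (a - t) * q)) * G (1/2)" .
  have "(1/2) powr (real CARD('n) + (a - t) * q) \<ge> (1::real)"
    using powr_mono'[of "real CARD('n) + (a - t) * q" 0 "1/2"] ad by (simp add: algebra_simps)
  then have "ennreal 1 * G (1/2) \<le> G (1/4)"
    unfolding scale by (intro mult_right_mono ennreal_leI) auto
  then have ge: "G (1/2) \<le> G (1/4)" by simp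
  define P where "P = {x::real^'n. 1/4 < norm x \<and> norm x < 1/2 \<and> 0 < x $ i}"
  define Q where "Q = {x::real^'n. 1/4 < norm x \<and> norm x < 1/2 \<and> x $ i < 0}"
  have "open P" "open Q" unfolding P_def Q_def
    by (intro open_Collect_conj open_Collect_less continuous_intros)+
  moreover have "(3/8) *\<^sub>R axis i 1 \<in> P" "(-3/8) *\<^sub>R axis i 1 \<in> Q"
    by (auto simp: P_def Q_def)
  ultimately have nn: "emeasure lborel P \<noteq> 0" "emeasure lborel Q \<noteq> 0"
    using open_not_negligible[of P] open_not_negligible[of Q]
    by (auto simp: negligible_iff_null_sets null_sets_def)
  have [measurable]: "P \<in> sets borel" "Q \<in> sets borel" using \<open>open P\<close> \<open>open Q\<close> by auto
  define A where "A = (\<integral>\<^sup>+x. \<integral>\<^sup>+y. gagliardo t q u x y * indicator Q y * indicator P x \<partial>lborel \<partial>lborel)"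
  have "G (1/4) + A = (\<integral>\<^sup>+x. (\<integral>\<^sup>+y. gagliardo t q u x y * indicator (ball 0 (1/4)) y * indicator (ball 0 (1/4)) x \<partial>lborel)
       + (\<integral>\<^sup>+y. gagliardo t q u x y * indicator Q y * indicator P x \<partial>lborel) \<partial>lborel)"
    unfolding G_def A_def by (rule nn_integral_add[symmetric]) measurable
  also have "\<dots> = (\<integral>\<^sup>+x. \<integral>\<^sup>+y. gagliardo t q u x y * indicator (ball 0 (1/4)) y * indicator (ball 0 (1/4)) x 
       + gagliardo t q u x y * indicator Q y * indicator P x \<partial>lborel \<partial>lborel)"
    by (intro nn_integral_cong nn_integral_add[symmetric]) measurable
  also have "\<dots> \<le> G (1/2)"
    unfolding G_def by (intro nn_integral_mono) (auto simp: indicator_def P_def Q_def)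
  finally have GA: "G (1/4) + A \<le> G (1/2)" .
  \<comment> \<open>Cancelling \<open>G (1/4)\<close> in the extended reals requires that it be
    finite.\<close>
  have "G (1/4) \<le> G (1/4) + A" by simp
  with GA fin have "G (1/4) \<noteq> \<infinity>" by (metis order.trans leD)
  moreover have "G (1/4) + A \<le> G (1/4) + 0"
    using order_trans[OF GA ge] by simp
  ultimately have "A = 0"
    unfolding ennreal_add_left_cancel_le by simp
  then have "AE x in lborel. (\<integral>\<^sup>+y. gagliardo t q u x y * indicator Q y * indicator P x \<partial>lborel) = 0"
    unfolding A_def by (subst (asm) nn_integral_0_iff_AE) measurable
  then have "AE x in lborel. x \<notin> P"
  proof eventually_elim
    case (elim x)
    show ?case
    proof
      assume x: "x \<in> P"
      have "AE y in lborel. gagliardo t q u x y * indicator Q y * indicator P x = 0"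
        using elim by (subst (asm) nn_integral_0_iff_AE) measurable
      then have "AE y in lborel. y \<notin> Q"
      proof eventually_elim
        case (elim y)
        show ?case
        proof
          assume y: "y \<in> Q"
          have "x \<noteq> 0" "y \<noteq> 0" using x y by (auto simp: P_def Q_def)
          then have "u x > 0" "u y < 0" using x y
            by (simp_all add: P_def Q_def u_fun_eq mult_less_0_iff)
          then have "\<bar>u x - u y\<bar> > 0" by auto
          moreover have "norm (x - y) > 0" using x y by (auto simp: P_def Q_def)
          ultimately have "gagliardo t q u x y > 0"
            by (auto simp: gagliardo_def ennreal_less_zero_iff)
          with elim x y show False by simp
        qed
      qed
      with nn(2) show False by (simp add: AE_iff_measurable[of Q])
    qed
  qed
  with nn(1) show False by (simp add: AE_iff_measurable[of P])
qed

text \<open>The two directions use different balls: membership on the whole unit ball passes to all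
  compactly contained open subsets, while failure is visible on the ball of radius 1/2, which is
  such a subset.\<close>

lemma u_fun_sobolev_frac_loc_iff:
  "u \<in> sobolev_frac_loc t q (ball 0 1) \<longleftrightarrow> s - \<delta> > t - real CARD('n) / q"
proof -
  have iff: "s - \<delta> > t - real CARD('n) / q \<longleftrightarrow> t * q - a * q < real CARD('n)"
    using q by (simp add: field_simps)
  show ?thesis unfolding iff
  proof
    assume "u \<in> sobolev_frac_loc t q (ball 0 1)"
    moreover have "open (ball (0::real^'n) (1/2))" "compact (closure (ball (0::real^'n) (1/2)))"
      "closure (ball (0::real^'n) (1/2)) \<subseteq> ball 0 1"
      by auto
    ultimately have "u \<in> sobolev_frac t q (ball 0 (1/2))"
      unfolding sobolev_frac_loc_def by blast
    with u_fun_not_sobolev_frac_ball show "t * q - a * q < real CARD('n)" by force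
  next
    assume "t * q - a * q < real CARD('n)"
    then have "u \<in> sobolev_frac t q (ball 0 1)" by (rule u_fun_sobolev_frac_ball)
    then show "u \<in> sobolev_frac_loc t q (ball 0 1)"
      unfolding sobolev_frac_loc_def
      using closure_subset by (auto intro!: sobolev_frac_mono[of _ "ball 0 1" u t q])
  qed
qed

end

section \<open>Vanishing integrals of partial derivatives\<close>

lemma partial_eqI: "(f has_derivative D) (at x) \<Longrightarrow> partial j f x = D (axis j 1)"
  unfolding partial_def using frechet_derivative_at by metis

lemma partial_add:
  assumes "f differentiable (at x)" "g differentiable (at x)"
  shows "partial j (\<lambda>x. f x + g x) x = partial j f x + partial j g x"
proof -
  have "((\<lambda>x. f x + g x) has_derivative
      (\<lambda>h. frechet_derivative f (at x) h + frechet_derivative g (at x) h)) (at x)"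
    using assms by (intro has_derivative_add) (auto simp: frechet_derivative_works)
  from partial_eqI[OF this] show ?thesis by (simp add: partial_def)
qed

lemma partial_cmult:
  assumes "f differentiable (at x)"
  shows "partial j (\<lambda>x. c * f x) x = c * partial j f x"
proof -
  have "((\<lambda>x. c * f x) has_derivative (\<lambda>h. c * frechet_derivative f (at x) h)) (at x)"
    using assms by (intro has_derivative_mult_right) (auto simp: frechet_derivative_works)
  from partial_eqI[OF this] show ?thesis by (simp add: partial_def)
qed

lemma partial_mult:
  assumes "f differentiable (at x)" "g differentiable (at x)"
  shows "partial j (\<lambda>x. f x * g x) x = partial j f x * g x + f x * partial j g x"
proof -
  have "((\<lambda>x. f x * g x) has_derivative
      (\<lambda>h. f x * frechet_derivative g (at x) h + frechet_derivative f (at x) h * g x)) (at x)"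
    using assms by (intro has_derivative_mult) (auto simp: frechet_derivative_works)
  from partial_eqI[OF this] show ?thesis by (simp add: partial_def)
qed

lemma has_real_derivative_along_axis:
  fixes f :: "real^'n \<Rightarrow> real"
  assumes "f differentiable (at (x + \<tau> *\<^sub>R axis j 1))"
  shows "((\<lambda>\<tau>. f (x + \<tau> *\<^sub>R axis j 1)) has_real_derivative partial j f (x + \<tau> *\<^sub>R axis j 1)) (at \<tau>)"
proof -
  let ?D = "frechet_derivative f (at (x + \<tau> *\<^sub>R axis j 1))"
  have D: "(f has_derivative ?D) (at (x + \<tau> *\<^sub>R axis j 1))"
    using assms by (simp add: frechet_derivative_works)
  have "((\<lambda>\<tau>. f (x + \<tau> *\<^sub>R axis j 1)) has_derivative (\<lambda>h. ?D (h *\<^sub>R axis j 1))) (at \<tau>)"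
    by (rule has_derivative_compose[where f="\<lambda>\<tau>. x + \<tau> *\<^sub>R axis j 1" and g=f])
       (auto intro!: derivative_eq_intros D)
  moreover have "?D (h *\<^sub>R axis j 1) = partial j f (x + \<tau> *\<^sub>R axis j 1) * h" for h
    using D[THEN has_derivative_linear] by (simp add: linear_cmul partial_def)
  ultimately show ?thesis
    by (simp add: has_field_derivative_def)
qed

lemma differentiable_continuous:
  fixes f :: "real^'n \<Rightarrow> real"
  assumes "\<And>x. f differentiable (at x)"
  shows "continuous_on UNIV f" "f \<in> borel_measurable borel"
proof -
  show "continuous_on UNIV f"
    using assms by (simp add: continuous_at_imp_continuous_on differentiable_imp_continuous_within)
  then show "f \<in> borel_measurable borel" by (rule borel_measurable_continuous_onI)
qed

lemma diff_quotient_LIMSEQ: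
  fixes f :: "real^'n \<Rightarrow> real"
  assumes "f differentiable (at x)"
  shows "(\<lambda>n. real (Suc n) * (f (x + (1 / real (Suc n)) *\<^sub>R axis j 1) - f x)) \<longlonglongrightarrow> partial j f x"
proof -
  have "((\<lambda>h. (f (x + h *\<^sub>R axis j 1) - f x) / h) \<longlongrightarrow> partial j f x) (at 0)"
    using has_real_derivative_along_axis[of f x 0 j] assms by (simp add: DERIV_def)
  moreover have "filterlim (\<lambda>n. 1 / real (Suc n)) (at 0) sequentially"
    unfolding filterlim_at using LIMSEQ_inverse_real_of_nat by (simp add: inverse_eq_divide)
  ultimately have "(\<lambda>n. (f (x + (1 / real (Suc n)) *\<^sub>R axis j 1) - f x) / (1 / real (Suc n))) \<longlonglongrightarrow> partial j f x"
    by (rule filterlim_compose)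
  then show ?thesis by (simp add: mult.commute)
qed

text \<open>The derivative is not assumed continuous, so measurability comes from the difference
  quotients.\<close>

lemma partial_measurable:
  fixes f :: "real^'n \<Rightarrow> real"
  assumes "\<And>x. f differentiable (at x)"
  shows "partial j f \<in> borel_measurable borel"
proof (rule borel_measurable_LIMSEQ_real)
  have [measurable]: "f \<in> borel_measurable borel"
    by (rule differentiable_continuous) (rule assms)
  show "(\<lambda>x. real (Suc n) * (f (x + (1 / real (Suc n)) *\<^sub>R axis j 1) - f x)) \<in> borel_measurable borel" for n
    by measurable
qed (rule diff_quotient_LIMSEQ[OF assms])

text \<open>Peetre's inequality: a translation changes a polynomial weight by at most a polynomial
  factor in the length of the translation.\<close>

lemma weight_shift_le:
  fixes x y :: "'a::real_normed_vector"
  assumes "p \<ge> 0"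
  shows "decay p (x + y) \<le> (1 + norm y) powr p * decay p x"
proof -
  have "norm x \<le> norm (x + y) + norm y"
    using norm_triangle_ineq4[of "x + y" y] by simp
  moreover have "(1 + norm (x + y)) * (1 + norm y) = 1 + norm (x + y) + norm y + norm y * norm (x + y)"
    by (simp add: algebra_simps)
  moreover have "0 \<le> norm y * norm (x + y)" by simp
  ultimately have "1 + norm x \<le> (1 + norm (x + y)) * (1 + norm y)" by linarith
  then have "(1 + norm x) powr p \<le> ((1 + norm (x + y)) * (1 + norm y)) powr p"
    using assms by (intro powr_mono2) auto
  then have "(1 + norm x) powr p \<le> (1 + norm (x + y)) powr p * (1 + norm y) powr p"
    by (simp add: powr_mult)
  moreover have "(1 + norm x) powr p > 0" "(1 + norm (x + y)) powr p > 0"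
    using norm_ge_zero[of x] norm_ge_zero[of "x + y"] by (auto simp: powr_gt_zero simp del: norm_ge_zero)
  ultimately show ?thesis
    by (simp add: powr_minus divide_simps mult.commute)
qed

text \<open>By translation invariance every difference quotient has integral zero. The mean value
  theorem expresses it as a partial derivative at a shifted point, and the shifted weight dominates
  it, so the limit has integral zero as well.\<close>

lemma integral_partial_eq_0_integrable:
  fixes f :: "real^'n \<Rightarrow> real"
  assumes diff: "\<And>x. f differentiable (at x)"
    and f: "\<And>x. \<bar>f x\<bar> \<le> C * decay p x"
    and df: "\<And>x. \<bar>partial j f x\<bar> \<le> C * decay p x"
    and p: "real CARD('n) < p"
  shows "(LINT x|lborel. partial j f x) = 0"
proof -
  let ?e = "axis j 1 :: real^'n"
  let ?q = "\<lambda>n x. real (Suc n) * (f (x + (1 / real (Suc n)) *\<^sub>R ?e) - f x)"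
  have [measurable]: "f \<in> borel_measurable borel"
    by (rule differentiable_continuous) (rule diff)
  have W: "integrable lborel (\<lambda>x::real^'n. decay p x)"
    by (rule integrable_weight) (use p in simp)
  have C: "C \<ge> 0" using f[of 0] by simp
  have fint: "integrable lborel f"
    by (rule Bochner_Integration.integrable_bound[where f="\<lambda>x. C * decay p x"])
       (use W f C in auto)
  have "(\<lambda>n. LINT x|lborel. ?q n x) \<longlonglongrightarrow> (LINT x|lborel. partial j f x)"
  proof (rule integral_dominated_convergence[where w="\<lambda>x. C * (2 powr p * decay p x)"])
    show "AE x in lborel. (\<lambda>n. ?q n x) \<longlonglongrightarrow> partial j f x"
      using diff_quotient_LIMSEQ[OF diff] by simp
    show "integrable lborel (\<lambda>x::real^'n. C * (2 powr p * decay p x))"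
      using W by simp
    show "AE x in lborel. norm (?q n x) \<le> C * (2 powr p * decay p x)" for n
    proof (rule AE_I2)
      fix x :: "real^'n"
      obtain z where z: "0 < z" "z < 1 / real (Suc n)"
        "f (x + (1 / real (Suc n)) *\<^sub>R ?e) - f (x + 0 *\<^sub>R ?e) = (1 / real (Suc n) - 0) * partial j f (x + z *\<^sub>R ?e)"
        using MVT2[of 0 "1 / real (Suc n)" "\<lambda>\<tau>. f (x + \<tau> *\<^sub>R ?e)" "\<lambda>\<tau>. partial j f (x + \<tau> *\<^sub>R ?e)"]
          has_real_derivative_along_axis[OF diff] by auto
      have "1 / real (Suc n) \<le> 1" by simp
      with z have z1: "z \<le> 1" by linarith
      have "\<bar>?q n x\<bar> = \<bar>partial j f (x + z *\<^sub>R ?e)\<bar>" using z(3) by simp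
      also have "\<dots> \<le> C * decay p (x + z *\<^sub>R ?e)" by (rule df)
      also have "\<dots> \<le> C * ((1 + norm (z *\<^sub>R ?e)) powr p * decay p x)"
        using C p by (intro mult_left_mono weight_shift_le) auto
      also have "\<dots> \<le> C * (2 powr p * decay p x)"
        using C p z z1 by (intro mult_left_mono mult_right_mono powr_mono2) auto
      finally show "norm (?q n x) \<le> C * (2 powr p * decay p x)" by simp
    qed
  qed (use partial_measurable[OF diff] in auto)
  moreover have "(LINT x|lborel. ?q n x) = 0" for n
  proof -
    have "integrable lborel (\<lambda>x. f ((1 / real (Suc n)) *\<^sub>R ?e + 1 *\<^sub>R x))"
      by (rule integrable_lborel_affine) (use fint in auto)
    moreover have "(LINT x|lborel. f ((1 / real (Suc n)) *\<^sub>R ?e + 1 *\<^sub>R x)) = (LINT x|lborel. f x)"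
      by (subst integral_lborel_affine[of f 1 "(1 / real (Suc n)) *\<^sub>R ?e"]) auto
    ultimately show ?thesis
      using fint by (simp add: add.commute)
  qed
  ultimately show ?thesis by (simp add: LIMSEQ_const_iff)
qed

text \<open>The factor \<open>1 / (1 + \<eta> |x|\<^sup>2)\<close> makes \<open>f\<close> integrable, at the price of an error
  of size \<open>|f x| / (1 + |x|)\<close> in the derivative, uniformly in \<open>\<eta>\<close>.\<close>

lemma integral_partial_eq_0:
  fixes f :: "real^'n \<Rightarrow> real"
  assumes diff: "\<And>x. f differentiable (at x)"
    and f: "\<And>x. \<bar>f x\<bar> \<le> C * decay p x"
    and df: "\<And>x. \<bar>partial j f x\<bar> \<le> C * decay q x"
    and p: "real CARD('n) < p + 1" and q: "real CARD('n) < q"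
  shows "integrable lborel (partial j f)" "(LINT x|lborel. partial j f x) = 0"
proof -
  have C: "C \<ge> 0" using f[of 0] by simp
  have mpd: "partial j f \<in> borel_measurable borel"
    by (rule partial_measurable) (rule diff)
  have "integrable lborel (\<lambda>x::real^'n. C * decay q x)"
    using integrable_weight[of q, where 'a="real^'n"] q by simp
  then show "integrable lborel (partial j f)"
    by (rule Bochner_Integration.integrable_bound) (use mpd df C in auto)
  define \<eta> where "\<eta> n = 1 / real (Suc n)" for n
  have \<eta>: "0 < \<eta> n" "\<eta> n \<le> 1" for n by (auto simp: \<eta>_def)
  define m where "m n x = 1 / (1 + \<eta> n * (x \<bullet> x))" for n and x :: "real^'n"
  define dm where "dm n x = - 2 * \<eta> n * x $ j / (1 + \<eta> n * (x \<bullet> x))\<^sup>2" for n and x :: "real^'n"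
  have pos: "1 + \<eta> n * (x \<bullet> x) > 0" for n x
    using \<eta>[of n] by (intro add_pos_nonneg) auto
  have m_deriv: "(m n has_derivative (\<lambda>h. - 2 * \<eta> n * (x \<bullet> h) / (1 + \<eta> n * (x \<bullet> x))\<^sup>2)) (at x)" for n x
    unfolding m_def[abs_def] using pos[of n x]
    by (auto intro!: derivative_eq_intros simp: inner_commute field_simps power2_eq_square)
  have m_diff: "m n differentiable (at x)" for n x
    using m_deriv by (rule differentiableI)
  have dm: "partial j (m n) x = dm n x" for n x
    using partial_eqI[OF m_deriv] by (simp add: dm_def inner_axis)
  \<comment> \<open>The first inequality gives \<open>m n\<close> one order of decay with a constant
    that depends on \<open>n\<close>. The second bounds the derivative of \<open>m n\<close> by
    \<open>4 * decay 1 x\<close> uniformly in \<open>n\<close>, which is what the passage to the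
    limit needs.\<close>
  have key: "\<eta> n * (1 + norm x) \<le> 2 * (1 + \<eta> n * (x \<bullet> x))"
            "\<eta> n * norm x * (1 + norm x) \<le> 2 * (1 + \<eta> n * (x \<bullet> x))" for n and x :: "real^'n"
  proof -
    have "2 * norm x \<le> 1 + (norm x)\<^sup>2" "0 \<le> norm x"
      using sum_squares_bound[of 1 "norm x"] by (simp_all add: power2_eq_square)
    then have "norm x \<le> 1 + (norm x)\<^sup>2" by linarith
    then have *: "\<eta> n * norm x \<le> \<eta> n + \<eta> n * (x \<bullet> x)"
      using mult_left_mono[of "norm x" "1 + (norm x)\<^sup>2" "\<eta> n"] \<eta>[of n]
      by (simp add: power2_norm_eq_inner distrib_left)
    have **: "0 \<le> \<eta> n * (x \<bullet> x)" using \<eta>[of n] by auto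
    show "\<eta> n * (1 + norm x) \<le> 2 * (1 + \<eta> n * (x \<bullet> x))"
      unfolding distrib_left using * ** \<eta>[of n] by linarith
    have "\<eta> n * norm x * norm x = \<eta> n * (x \<bullet> x)"
      by (simp add: power2_norm_eq_inner[symmetric] power2_eq_square)
    then show "\<eta> n * norm x * (1 + norm x) \<le> 2 * (1 + \<eta> n * (x \<bullet> x))"
      unfolding distrib_left using * ** \<eta>[of n] by linarith
  qed
  have m0: "0 \<le> m n x" "m n x \<le> 1" for n x
    using pos[of n x] \<eta>[of n] by (auto simp: m_def divide_le_eq)
  have mb: "m n x \<le> 2 / \<eta> n * decay 1 x" for n x
  proof -
    have "1 + norm x > 0" by (simp add: add_pos_nonneg)
    then have le: "2 / (2 * (1 + \<eta> n * (x \<bullet> x))) \<le> 2 / (\<eta> n * (1 + norm x))"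
      using pos[of n x] \<eta>[of n] by (intro divide_left_mono key) auto
    have "2 / (2 * D) = 1 / D" for D :: real by simp
    then have l: "2 / (2 * (1 + \<eta> n * (x \<bullet> x))) = m n x"
      unfolding m_def .
    have r: "2 / (\<eta> n * (1 + norm x)) = 2 / \<eta> n * decay 1 x"
      using \<open>1 + norm x > 0\<close> by (simp add: powr_minus divide_inverse mult_ac)
    show ?thesis using le unfolding l r .
  qed
  have dmb: "\<bar>dm n x\<bar> \<le> 4 * decay 1 x" for n x
  proof -
    have n: "1 + norm x > 0" by (simp add: add_pos_nonneg)
    let ?D = "1 + \<eta> n * (x \<bullet> x)"
    have D1: "?D \<ge> 1" using \<eta>[of n] by auto
    have "\<bar>dm n x\<bar> = 2 * \<eta> n * \<bar>x $ j\<bar> / ?D\<^sup>2" using \<eta>[of n] by (simp add: dm_def abs_mult)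
    also have "\<dots> \<le> 2 * \<eta> n * norm x / ?D\<^sup>2"
      using \<eta>[of n] component_le_norm_cart[of x j] by (intro divide_right_mono mult_left_mono) auto
    also have "\<dots> \<le> 2 * \<eta> n * norm x / ?D"
      using \<eta>[of n] norm_ge_zero[of x] pos[of n x] self_le_power[OF D1, of 2]
      by (intro divide_left_mono mult_pos_pos zero_less_power mult_nonneg_nonneg) simp_all
    also have "\<dots> \<le> 4 / (1 + norm x)"
      using key(2)[of n x] pos[of n x] n
      by (intro mult_imp_div_pos_le[OF pos]) (simp add: le_divide_eq algebra_simps)
    finally show ?thesis using n by (simp add: powr_minus divide_inverse)
  qed
  have pf: "partial j (\<lambda>x. f x * m n x) x = partial j f x * m n x + f x * dm n x" for n x
    using partial_mult[OF diff m_diff] by (simp add: dm)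
  have w2: "decay p x * decay 1 x = decay (p+1) x" for x :: "real^'n"
    by (subst powr_add[symmetric]) simp
  have fdm: "\<bar>f x * dm n x\<bar> \<le> 4 * C * decay (p+1) x" for n x
  proof -
    have "\<bar>f x\<bar> * \<bar>dm n x\<bar> \<le> (C * decay p x) * (4 * decay 1 x)"
      by (intro mult_mono f dmb) (use C in auto)
    also have "\<dots> = 4 * C * (decay p x * decay 1 x)" by (simp only: mult_ac)
    finally show ?thesis by (simp only: w2 abs_mult)
  qed
  have dfm: "\<bar>partial j f x * m n x\<bar> \<le> C * decay q x" for n x
  proof -
    have "\<bar>partial j f x\<bar> * \<bar>m n x\<bar> \<le> (C * decay q x) * 1"
      by (intro mult_mono df) (use C m0[of n x] in auto)
    then show ?thesis by (simp add: abs_mult)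
  qed
  have zero: "(LINT x|lborel. partial j (\<lambda>x. f x * m n x) x) = 0" for n
  \<comment> \<open>The integrable version asks for a single exponent, and both \<open>p+1\<close>
    and \<open>q\<close> exceed the dimension. The constant may blow up with \<open>n\<close>,
    because each of these integrals is evaluated on its own.\<close>
  proof (rule integral_partial_eq_0_integrable[where C="C * (2 / \<eta> n) + 5 * C" and p="min (p+1) q"])
    show "(\<lambda>x. f x * m n x) differentiable (at x)" for x
      using diff m_diff by (rule differentiable_mult)
    have w: "decay (p+1) x \<le> decay (min (p+1) q) x"
            "decay q x \<le> decay (min (p+1) q) x" for x :: "real^'n"
      by (intro powr_mono; simp)+
    show "\<bar>f x * m n x\<bar> \<le> (C * (2 / \<eta> n) + 5 * C) * decay (min (p+1) q) x" for x
    proof -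
      have "\<bar>f x\<bar> * \<bar>m n x\<bar> \<le> (C * decay p x) * (2 / \<eta> n * decay 1 x)"
        by (intro mult_mono f) (use C m0[of n x] mb[of n x] in auto)
      also have "\<dots> = C * (2 / \<eta> n) * decay (p+1) x"
        by (simp only: w2[symmetric] mult_ac)
      also have "\<dots> \<le> (C * (2 / \<eta> n) + 5 * C) * decay (min (p+1) q) x"
        using C \<eta>[of n] w(1) by (intro mult_mono) auto
      finally show ?thesis by (simp add: abs_mult)
    qed
    show "\<bar>partial j (\<lambda>x. f x * m n x) x\<bar> \<le> (C * (2 / \<eta> n) + 5 * C) * decay (min (p+1) q) x" for x
    proof -
      have "\<bar>partial j (\<lambda>x. f x * m n x) x\<bar> \<le> \<bar>partial j f x * m n x\<bar> + \<bar>f x * dm n x\<bar>"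
        unfolding pf by (rule abs_triangle_ineq)
      also have "\<dots> \<le> C * decay q x + 4 * C * decay (p+1) x"
        by (intro add_mono dfm fdm)
      also have "\<dots> \<le> C * decay (min (p+1) q) x + 4 * C * decay (min (p+1) q) x"
        using C by (intro add_mono mult_left_mono w) auto
      also have "\<dots> = (5 * C) * decay (min (p+1) q) x" by simp
      also have "\<dots> \<le> (C * (2 / \<eta> n) + 5 * C) * decay (min (p+1) q) x"
        using C \<eta>[of n] by (intro mult_right_mono) auto
      finally show ?thesis .
    qed
  qed (use p q in auto)
  have \<eta>0: "\<eta> \<longlonglongrightarrow> 0"
    unfolding \<eta>_def using LIMSEQ_inverse_real_of_nat by (simp add: inverse_eq_divide)
  have "(\<lambda>n. LINT x|lborel. partial j (\<lambda>x. f x * m n x) x) \<longlonglongrightarrow> (LINT x|lborel. partial j f x)"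
  proof (rule integral_dominated_convergence[where
        w="\<lambda>x. C * decay q x + 4 * C * decay (p+1) x"])
    show "AE x in lborel. (\<lambda>n. partial j (\<lambda>x. f x * m n x) x) \<longlonglongrightarrow> partial j f x"
    proof (rule AE_I2)
      fix x
      have "(\<lambda>n. partial j f x * (1 / (1 + \<eta> n * (x \<bullet> x))) + f x * (- 2 * \<eta> n * x $ j / (1 + \<eta> n * (x \<bullet> x))\<^sup>2))
         \<longlonglongrightarrow> partial j f x * (1 / (1 + 0 * (x \<bullet> x))) + f x * (- 2 * 0 * x $ j / (1 + 0 * (x \<bullet> x))\<^sup>2)"
        by (intro tendsto_intros \<eta>0) auto
      then show "(\<lambda>n. partial j (\<lambda>x. f x * m n x) x) \<longlonglongrightarrow> partial j f x"
        unfolding pf by (simp add: m_def dm_def)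
    qed
    show "integrable lborel (\<lambda>x::real^'n. C * decay q x + 4 * C * decay (p+1) x)"
      using integrable_weight[of q, where 'a="real^'n"] integrable_weight[of "p+1", where 'a="real^'n"] p q by simp
    show "AE x in lborel. norm (partial j (\<lambda>x. f x * m n x) x)
        \<le> C * decay q x + 4 * C * decay (p+1) x" for n
      unfolding pf using dfm fdm
      by (intro AE_I2) (auto intro!: order_trans[OF abs_triangle_ineq] add_mono)
    show "(\<lambda>x. partial j (\<lambda>x. f x * m n x) x) \<in> borel_measurable lborel" for n
      by (simp, rule partial_measurable) (intro differentiable_mult diff m_diff)
  qed (use mpd in simp)
  then show "(LINT x|lborel. partial j f x) = 0"
    unfolding zero by (simp add: LIMSEQ_const_iff)
qed

section \<open>The Riesz potential as a principal value\<close>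

lemma riesz_kernel_eq:
  "\<exists>k. \<forall>h::real^'n. riesz_kernel s h = k * norm h powr (-(real CARD('n) - 1 + s))"
  unfolding powr_minus inverse_eq_divide by (rule exI, rule allI, rule riesz_kernel_def)

lemma riesz_kernel_powr:
  obtains k where "k \<ge> 0" "\<And>h::real^'n. \<bar>riesz_kernel s h\<bar> = k * norm h powr (-(real CARD('n) - 1 + s))"
proof -
  obtain k where "\<And>h::real^'n. riesz_kernel s h = k * norm h powr (-(real CARD('n) - 1 + s))"
    using riesz_kernel_eq[of s, where 'n='n] by blast
  then show thesis using that[of "\<bar>k\<bar>"] by (simp add: abs_mult)
qed

lemma riesz_kernel_measurable [measurable]: "riesz_kernel s \<in> borel_measurable (borel :: (real^'n) measure)"
proof -
  obtain k where "\<And>h::real^'n. riesz_kernel s h = k * norm h powr (-(real CARD('n) - 1 + s))"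
    using riesz_kernel_eq[of s, where 'n='n] by blast
  then have "riesz_kernel s = (\<lambda>h::real^'n. k * norm h powr (-(real CARD('n) - 1 + s)))" by auto
  then show ?thesis by simp
qed

lemma riesz_kernel_scale:
  assumes "r > 0"
  shows "riesz_kernel s (r *\<^sub>R h) = r powr (-(real CARD('n) - 1 + s)) * riesz_kernel s (h :: real^'n)"
proof -
  obtain k where "\<And>h::real^'n. riesz_kernel s h = k * norm h powr (-(real CARD('n) - 1 + s))"
    using riesz_kernel_eq[of s, where 'n='n] by blast
  then show ?thesis using assms by (simp add: powr_mult)
qed

lemma riesz_kernel_cong_norm: "norm (h::real^'n) = norm (h'::real^'n) \<Longrightarrow> riesz_kernel s h = riesz_kernel s h'"
  by (simp only: riesz_kernel_def)

lemma annulus_measurable [measurable]: "annulus r \<in> sets borel"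
proof -
  have "annulus r = {h. r \<le> norm h} \<inter> {h. norm h \<le> 1 / r}" by (auto simp: annulus_def)
  also have "\<dots> \<in> sets borel" by measurable
  finally show ?thesis .
qed

text \<open>Minus the reflection in the hyperplane orthogonal to \<open>e\<close>. It supplies the
  symmetry that isolates the component along \<open>e\<close> in
  \<open>symmetrised_unit\<close>.\<close>

lemma orthogonal_transformation_axial:
  assumes e: "norm (e::real^'n) = 1"
  shows "orthogonal_transformation (\<lambda>y. (2 * (e \<bullet> y)) *\<^sub>R e - y)"
proof -
  have "e \<bullet> e = 1" using e by (simp add: dot_square_norm)
  then show ?thesis
    unfolding orthogonal_transformation_def
    by (auto intro!: linearI simp: algebra_simps inner_commute inner_add_right)
qed

text \<open>The principal value of the Riesz potential of \<open>\<Sum>\<^sub>j b\<^sub>j u\<^sub>j\<close>, averaged over \<open>h\<close> and \<open>-h\<close>; unlike the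
  original integral, this one converges absolutely.\<close>

definition symmetrised :: "real \<Rightarrow> real \<Rightarrow> real^'n \<Rightarrow> real^'n \<Rightarrow> real" where
  "symmetrised s \<delta> b x = 1/2 * (LINT h|lborel. riesz_kernel s h *
     ((\<Sum>j\<in>UNIV. b $ j * u_fun j s \<delta> (x - h)) + (\<Sum>j\<in>UNIV. b $ j * u_fun j s \<delta> (x + h))))"

section \<open>Absolute convergence and symmetries of the averaged potential\<close>

context
  fixes s \<delta> :: real and i :: "'n::finite"
  assumes s: "0 < s" "s < 1" and \<delta>: "0 < \<delta>" "\<delta> < real CARD('n)"
begin

private abbreviation (input) "u_dir k \<equiv> (u_fun k s \<delta> :: real^'n \<Rightarrow> real)"
private abbreviation (input) "V \<equiv> (symmetrised s \<delta> :: real^'n \<Rightarrow> real^'n \<Rightarrow> real)"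
private abbreviation (input) "K \<equiv> (riesz_kernel s :: real^'n \<Rightarrow> real)"

text \<open>For small \<open>h\<close> the kernel has order d - 1 + s < d. For medium
  \<open>h\<close> it is bounded, and any singularities of \<open>u\<close>, at \<open>h = e\<close>
  and \<open>h = - e\<close>, have order \<delta> - s < d. For large \<open>h\<close> the separate
  products have size |h|^(1-d-\<delta>), which is not enough when \<delta> \<le> 1. Oddness of
  \<open>u\<close> turns the sum into a difference of values at distance 2, and this gains one
  order.\<close>

lemma symmetrised_integrable_unit:
  fixes e :: "real^'n"
  assumes e: "norm e = 1"
  shows "integrable lborel (\<lambda>h. K h * (u_dir j (e - h) + u_dir j (e + h)))"
proof -
  define d where "d = real CARD('n)"
  have d1: "d \<ge> 1" by (simp add: d_def)
  define p where "p = d - 1 + s"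
  define a where "a = s - \<delta>"
  define N where "N = 2 * d + \<bar>p\<bar> + \<bar>a\<bar> + 1"
  obtain k where k: "k \<ge> 0" "\<And>h. \<bar>K h\<bar> = k * norm h powr (-p)"
    using riesz_kernel_powr[of s, where 'n='n] unfolding p_def d_def by blast
  obtain L where L: "L \<ge> 0" "\<And>x y. 1/2 \<le> norm x \<and> norm x \<le> 2 \<and> 1/2 \<le> norm y \<and> norm y \<le> 2
     \<Longrightarrow> \<bar>u_dir j x - u_dir j y\<bar> \<le> L * norm (x - y)"
    using u_fun_lipschitz[of j s \<delta>] by blast
  define W1 :: "real^'n \<Rightarrow> real" where "W1 = (\<lambda>h. norm h powr (-p) * decay N h)"
  define W2 :: "real^'n \<Rightarrow> real" where "W2 = (\<lambda>h. norm h powr (-(-a)) * decay N h)"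
  define W3 :: "real^'n \<Rightarrow> real" where "W3 = (\<lambda>h. decay (d+\<delta>) h)"
  have W1: "integrable lborel W1"
  proof -
    have "p < d" "d < p + N" using s d1 by (auto simp: p_def N_def)
    then show ?thesis
      unfolding W1_def by (intro integrable_norm_powr_weight) (simp_all add: d_def)
  qed
  have A: "- a < d" "d < - a + N"
    using s \<delta> d1 by (auto simp: a_def N_def d_def)
  have W2: "integrable lborel W2"
    unfolding W2_def by (rule integrable_norm_powr_weight) (use A in \<open>simp_all add: d_def\<close>)
  have W3: "integrable lborel W3"
    unfolding W3_def using \<delta> by (intro integrable_weight) (auto simp: d_def)
  have W0: "W1 h \<ge> 0" "W2 h \<ge> 0" "W3 h \<ge> 0" for h by (auto simp: W1_def W2_def W3_def)
  have N0: "N > 0" using d1 by (simp add: N_def)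
  have pow4: "1 \<le> 4 powr N * decay N y" if "norm y \<le> 3" for y :: "real^'n"
    using N0 powr_mono2'[of "-N" "1 + norm y" 4] that
    by (simp add: powr_minus field_simps add_pos_nonneg)
  define M where "M = max ((1/2) powr a) (2 powr a)"
  have M0: "M \<ge> 0" by (simp add: M_def le_max_iff_disj)
  define C where "C = 2 * M * k * 4 powr N + k * 2 powr p * 4 powr N + 2 * L * k * 2 powr (d + \<delta>)"
  have C: "C \<ge> 2 * M * k * 4 powr N" "C \<ge> k * 2 powr p * 4 powr N" "C \<ge> 2 * L * k * 2 powr (d + \<delta>)" "C \<ge> 0"
    using M0 k L by (auto simp: C_def)
  have bound: "\<bar>K h * (u_dir j (e - h) + u_dir j (e + h))\<bar> \<le> C * (W1 h + W2 (e - h) + W2 (e + h) + W3 h)" for h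
  proof -
    have nn: "norm (e - h) \<le> 1 + norm h" "norm (e + h) \<le> 1 + norm h"
      "norm (e - h) \<ge> 1 - norm h" "norm (e + h) \<ge> 1 - norm h"
      using norm_triangle_ineq4[of e h] norm_triangle_ineq[of e h] norm_triangle_ineq2[of e h]
        norm_triangle_ineq2[of e "-h"] e by auto
    consider "norm h \<le> 1/2" | "1/2 \<le> norm h" "norm h \<le> 2" | "2 \<le> norm h" by linarith
    then show ?thesis
    proof cases
      case 1
      have uM: "\<bar>u_dir j y\<bar> \<le> M" if "1/2 \<le> norm y" "norm y \<le> 2" for y
        using that abs_u_fun_le[of j s \<delta> y] powr_mono2'[of a "1/2" "norm y"] powr_mono2[of a "norm y" 2]
        unfolding a_def[symmetric] M_def by (cases "a \<ge> 0") auto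
      have "\<bar>u_dir j (e - h) + u_dir j (e + h)\<bar> \<le> 2 * M"
        using uM[of "e - h"] uM[of "e + h"] 1 nn by (auto simp: abs_le_iff)
      then have "\<bar>K h * (u_dir j (e - h) + u_dir j (e + h))\<bar> \<le> (k * norm h powr (-p)) * (2 * M)"
        unfolding abs_mult k using k by (intro mult_left_mono) auto
      also have "\<dots> \<le> (k * norm h powr (-p)) * (2 * M) * (4 powr N * decay N h)"
        using mult_left_mono[OF pow4[of h], of "(k * norm h powr (-p)) * (2 * M)"] 1 k M0 by simp
      also have "\<dots> = (2 * M * k * 4 powr N) * W1 h" by (simp add: W1_def)
      also have "\<dots> \<le> C * W1 h" using C W0 by (intro mult_right_mono) auto
      also have "\<dots> \<le> C * (W1 h + W2 (e - h) + W2 (e + h) + W3 h)"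
        using C W0 by (intro mult_left_mono) auto
      finally show ?thesis .
    next
      case 2
      have "norm h powr (-p) \<le> (1/2) powr (-p)"
        using 2 d1 s by (intro powr_mono2') (auto simp: p_def)
      also have "\<dots> = 2 powr p" by (simp add: powr_divide powr_minus)
      finally have K: "\<bar>K h\<bar> \<le> k * 2 powr p" unfolding k using k by (intro mult_left_mono) auto
      have uW: "\<bar>u_dir j y\<bar> \<le> 4 powr N * W2 y" if "norm y \<le> 3" for y
      proof -
        have "\<bar>u_dir j y\<bar> \<le> norm y powr a * 1" using abs_u_fun_le[of j s \<delta> y] by (simp add: a_def)
        also have "\<dots> \<le> norm y powr a * (4 powr N * decay N y)"
          by (intro mult_left_mono pow4 that) simp
        finally show ?thesis by (simp add: W2_def mult_ac)
      qed
      have "\<bar>u_dir j (e - h) + u_dir j (e + h)\<bar> \<le> 4 powr N * (W2 (e - h) + W2 (e + h))"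
        unfolding distrib_left
        by (rule order_trans[OF abs_triangle_ineq]) (intro add_mono uW; use nn 2 in linarith)
      then have "\<bar>K h * (u_dir j (e - h) + u_dir j (e + h))\<bar> \<le> (k * 2 powr p) * (4 powr N * (W2 (e - h) + W2 (e + h)))"
        unfolding abs_mult using K k by (intro mult_mono) auto
      also have "\<dots> = (k * 2 powr p * 4 powr N) * (W2 (e - h) + W2 (e + h))" by simp
      also have "\<dots> \<le> C * (W2 (e - h) + W2 (e + h))" using C W0 by (intro mult_right_mono) auto
      also have "\<dots> \<le> C * (W1 h + W2 (e - h) + W2 (e + h) + W3 h)"
        using C W0 by (intro mult_left_mono) auto
      finally show ?thesis .
    next
      case 3
      \<comment> \<open>Rescaling by |h| puts \<open>g + f\<close> and \<open>g - f\<close> into the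
        annulus of the Lipschitz bound, at distance \<open>2 / r\<close>.\<close>
      define r where "r = norm h"
      have r: "r \<ge> 2" "r > 0" using 3 by (auto simp: r_def)
      define g where "g = h /\<^sub>R r"
      define f where "f = e /\<^sub>R r"
      have g: "norm g = 1" and f: "norm f \<le> 1/2" "norm f = 1 / r"
        using r e by (auto simp: g_def f_def r_def[symmetric] divide_simps)
      have eh: "e + h = r *\<^sub>R (g + f)" "e - h = - (r *\<^sub>R (g - f))"
        using r by (auto simp: g_def f_def algebra_simps)
      have "u_dir j (e - h) + u_dir j (e + h) = r powr a * (u_dir j (g + f) - u_dir j (g - f))"
        unfolding eh u_fun_minus u_fun_scale[OF r(2)] by (simp add: a_def algebra_simps)
      moreover have Lf: "\<bar>u_dir j (g + f) - u_dir j (g - f)\<bar> \<le> L * norm (g + f - (g - f))"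
        using norm_triangle_ineq4[of g f] norm_triangle_ineq[of g f] norm_triangle_ineq2[of g f]
          norm_triangle_ineq2[of g "-f"] g f by (intro L) auto
      moreover have "g + f - (g - f) = 2 *\<^sub>R f" by (simp add: scaleR_2)
      then have "norm (g + f - (g - f)) = 2 / r"
        using f(2) by simp
      with Lf have "r powr a * \<bar>u_dir j (g + f) - u_dir j (g - f)\<bar> \<le> r powr a * (L * (2 / r))"
        by (intro mult_left_mono) auto
      ultimately have *: "\<bar>u_dir j (e - h) + u_dir j (e + h)\<bar> \<le> r powr a * (L * (2 / r))"
        by (simp only: abs_mult abs_of_nonneg[OF powr_ge_zero])
      have "\<bar>K h * (u_dir j (e - h) + u_dir j (e + h))\<bar> \<le> (k * r powr (-p)) * (r powr a * (L * (2 / r)))"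
        unfolding abs_mult k r_def[symmetric] using * k by (intro mult_left_mono) auto
      also have "\<dots> = 2 * L * k * (r powr (-p) * r powr a * r powr (-1))"
        using r by (simp add: powr_minus divide_inverse)
      also have "r powr (-p) * r powr a * r powr (-1) = r powr (-(d + \<delta>))"
        by (simp only: powr_add[symmetric]) (simp add: p_def a_def)
      also have "\<dots> \<le> ((1 + r) / 2) powr (-(d + \<delta>))"
        using r d1 \<delta> by (intro powr_mono2') auto
      also have "\<dots> = 2 powr (d + \<delta>) * W3 h"
      proof -
        have "((1 + r) / 2) powr (-(d + \<delta>)) = (1 + r) powr (-(d + \<delta>)) / 2 powr (-(d + \<delta>))"
          by (rule powr_divide)
        also have "2 powr (-(d + \<delta>)) = 1 / 2 powr (d + \<delta>)" by (rule powr_minus_divide)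
        finally show ?thesis by (simp add: W3_def r_def mult.commute del: minus_add_distrib)
      qed
      finally have "\<bar>K h * (u_dir j (e - h) + u_dir j (e + h))\<bar> \<le> (2 * L * k * 2 powr (d + \<delta>)) * W3 h"
        using L k by (simp add: mult_left_mono mult.assoc)
      also have "\<dots> \<le> C * W3 h" using C W0 by (intro mult_right_mono) auto
      also have "\<dots> \<le> C * (W1 h + W2 (e - h) + W2 (e + h) + W3 h)"
        using C W0 by (intro mult_left_mono) auto
      finally show ?thesis .
    qed
  qed
  show ?thesis
  proof (rule Bochner_Integration.integrable_bound)
    have "integrable lborel (\<lambda>h. W2 (e - h))" "integrable lborel (\<lambda>h. W2 (e + h))"
      using integrable_lborel_affine[OF W2, of "-1" e] integrable_lborel_affine[OF W2, of 1 e] by auto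
    then show "integrable lborel (\<lambda>h. C * (W1 h + W2 (e - h) + W2 (e + h) + W3 h))"
      using W1 W3 by simp
    show "AE h in lborel. norm (K h * (u_dir j (e - h) + u_dir j (e + h)))
        \<le> norm (C * (W1 h + W2 (e - h) + W2 (e + h) + W3 h))"
      using bound C W0 by (intro AE_I2) (simp add: abs_of_nonneg)
  qed measurable
qed

lemma symmetrised_scale:
  assumes "r > 0"
  shows "K (r *\<^sub>R h) * (u_dir j (r *\<^sub>R x - r *\<^sub>R h) + u_dir j (r *\<^sub>R x + r *\<^sub>R h))
    = r powr (1 - real CARD('n) - \<delta>) * (K h * (u_dir j (x - h) + u_dir j (x + h)))"
proof -
  have "u_dir j (r *\<^sub>R x - r *\<^sub>R h) + u_dir j (r *\<^sub>R x + r *\<^sub>R h) = r powr (s - \<delta>) * (u_dir j (x - h) + u_dir j (x + h))"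
    by (simp only: scaleR_diff_right[symmetric] scaleR_add_right[symmetric] u_fun_scale[OF assms] distrib_left)
  moreover have e: "r powr (-(real CARD('n) - 1 + s)) * r powr (s - \<delta>) = r powr (1 - real CARD('n) - \<delta>)"
    by (simp add: powr_add[symmetric] algebra_simps)
  ultimately show ?thesis
    unfolding riesz_kernel_scale[OF assms] e[symmetric] by (simp only: mult_ac)
qed

lemma symmetrised_integrable: "integrable lborel (\<lambda>h. K h * (u_dir j (x - h) + u_dir j (x + h)))"
proof (cases "x = 0")
  case True
  then show ?thesis by (simp add: u_fun_minus)
next
  case False
  define r where "r = norm x"
  have r: "r > 0" using False by (simp add: r_def)
  let ?e = "x /\<^sub>R r"
  have "norm ?e = 1" using r by (simp add: r_def)
  from integrable_lborel_affine[OF symmetrised_integrable_unit[OF this, of j], of "1 / r" 0] r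
  have "integrable lborel (\<lambda>h. K (h /\<^sub>R r) * (u_dir j (?e - h /\<^sub>R r) + u_dir j (?e + h /\<^sub>R r)))"
    by (simp add: inverse_eq_divide)
  then have "integrable lborel (\<lambda>h. r powr (1 - real CARD('n) - \<delta>) * (K (h /\<^sub>R r) * (u_dir j (?e - h /\<^sub>R r) + u_dir j (?e + h /\<^sub>R r))))"
    by (rule integrable_mult_right)
  then show ?thesis
    using r by (simp only: symmetrised_scale[OF r, symmetric]) simp
qed

text \<open>This is why all coordinates are carried along: a single \<open>u_fun j\<close> singles
  out an axis, whereas the combination involves only \<open>norm x\<close> and
  \<open>b \<bullet> x\<close>, on which orthogonal maps act transparently.\<close>

lemma sum_u_fun: "(\<Sum>j\<in>UNIV. b $ j * u_dir j x) = norm x powr (s - \<delta> - 1) * (b \<bullet> x)"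
  by (simp add: u_fun_eq inner_vec_def sum_distrib_left mult_ac)

lemma symmetrised_eq:
  "V b x = 1/2 * (LINT h|lborel. K h *
     (norm (x - h) powr (s - \<delta> - 1) * (b \<bullet> (x - h)) + norm (x + h) powr (s - \<delta> - 1) * (b \<bullet> (x + h))))"
  by (simp only: symmetrised_def sum_u_fun)

lemma symmetrised_sum:
  "V b x = (\<Sum>j\<in>UNIV. b $ j * (1/2 * (LINT h|lborel. K h * (u_dir j (x - h) + u_dir j (x + h)))))"
proof -
  have "(LINT h|lborel. K h * ((\<Sum>j\<in>UNIV. b $ j * u_dir j (x - h)) + (\<Sum>j\<in>UNIV. b $ j * u_dir j (x + h))))
    = (LINT h|lborel. (\<Sum>j\<in>UNIV. b $ j * (K h * (u_dir j (x - h) + u_dir j (x + h)))))"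
    by (intro Bochner_Integration.integral_cong)
       (simp_all add: sum_distrib_left sum.distrib[symmetric] algebra_simps)
  also have "\<dots> = (\<Sum>j\<in>UNIV. b $ j * (LINT h|lborel. K h * (u_dir j (x - h) + u_dir j (x + h))))"
    by (subst Bochner_Integration.integral_sum) (auto intro!: symmetrised_integrable)
  finally show ?thesis by (simp add: symmetrised_def sum_distrib_left mult_ac)
qed

lemma symmetrised_axis:
  "V (axis j 1) x = 1/2 * (LINT h|lborel. K h * (u_dir j (x - h) + u_dir j (x + h)))"
  by (simp add: symmetrised_def axis_def if_distrib[of "\<lambda>c. c * _"] cong: if_cong)

lemma symmetrised_linear: "linear (\<lambda>b. V b x)"
  by (rule linearI) (simp_all add: symmetrised_sum distrib_right add_divide_distrib mult.assoc sum.distrib sum_distrib_left)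

text \<open>The degrees add up: -(d - 1 + s) from the kernel, s - \<delta> from \<open>u\<close> and
  d from the measure.\<close>

lemma symmetrised_scaleR:
  assumes r: "r > 0"
  shows "V b (r *\<^sub>R x) = r powr (1 - \<delta>) * V b x"
proof -
  have "(LINT h|lborel. K h * (u_dir j (r *\<^sub>R x - h) + u_dir j (r *\<^sub>R x + h)))
      = r powr (1 - \<delta>) * (LINT h|lborel. K h * (u_dir j (x - h) + u_dir j (x + h)))" for j
  proof -
    have "(LINT h|lborel. K h * (u_dir j (r *\<^sub>R x - h) + u_dir j (r *\<^sub>R x + h)))
      = \<bar>r\<bar>^CARD('n) * (LINT h|lborel. K (0 + r *\<^sub>R h) * (u_dir j (r *\<^sub>R x - (0 + r *\<^sub>R h)) + u_dir j (r *\<^sub>R x + (0 + r *\<^sub>R h))))"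
      using r by (subst integral_lborel_affine[where c=r and t=0]) simp_all
    also have "\<dots> = r^CARD('n) * (r powr (1 - real CARD('n) - \<delta>) * (LINT h|lborel. K h * (u_dir j (x - h) + u_dir j (x + h))))"
      using r by (simp add: symmetrised_scale)
    also have "\<dots> = (r powr real CARD('n) * r powr (1 - real CARD('n) - \<delta>)) * (LINT h|lborel. K h * (u_dir j (x - h) + u_dir j (x + h)))"
      using r by (simp add: powr_realpow)
    also have "r powr real CARD('n) * r powr (1 - real CARD('n) - \<delta>) = r powr (1 - \<delta>)"
      by (simp add: powr_add[symmetric])
    finally show ?thesis .
  qed
  then show ?thesis by (simp add: symmetrised_sum sum_distrib_left mult_ac)
qed

lemma symmetrised_orthogonal:
  assumes Q: "orthogonal_transformation Q"
  shows "V (Q b) (Q x) = V b x"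
proof -
  note lin = orthogonal_transformation_linear[OF Q]
  have ip: "Q v \<bullet> Q w = v \<bullet> w" for v w
    using Q by (simp add: orthogonal_transformation_def)
  let ?f = "\<lambda>h. K h * (norm (Q x - h) powr (s - \<delta> - 1) * (Q b \<bullet> (Q x - h))
      + norm (Q x + h) powr (s - \<delta> - 1) * (Q b \<bullet> (Q x + h)))"
  have "(LINT h|lborel. ?f (Q h)) = (LINT h|lborel. ?f h)"
    by (rule integral_lborel_orthogonal[OF Q]) measurable
  moreover have "?f (Q h) = K h * (norm (x - h) powr (s - \<delta> - 1) * (b \<bullet> (x - h))
      + norm (x + h) powr (s - \<delta> - 1) * (b \<bullet> (x + h)))" for h
    by (simp only: linear_diff[OF lin, symmetric] linear_add[OF lin, symmetric] ip
        orthogonal_transformation_norm[OF Q] riesz_kernel_cong_norm[OF orthogonal_transformation_norm[OF Q]])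
  ultimately show ?thesis by (simp add: symmetrised_eq)
qed

text \<open>The half turn about the axis \<open>e\<close> fixes \<open>e\<close> and reverses every vector orthogonal to it,
  so only the component of \<open>b\<close> along \<open>e\<close> contributes.\<close>

lemma symmetrised_unit:
  assumes e: "norm e = 1"
  shows "V b e = (b \<bullet> e) * V e e"
proof -
  define Q where "Q y = (2 * (e \<bullet> y)) *\<^sub>R e - y" for y
  have Q: "orthogonal_transformation Q"
    unfolding Q_def[abs_def] by (rule orthogonal_transformation_axial[OF e])
  have ee: "e \<bullet> e = 1" using e by (simp add: dot_square_norm)
  define b' where "b' = b - (b \<bullet> e) *\<^sub>R e"
  have "e \<bullet> b' = 0" by (simp add: b'_def inner_diff_right inner_commute ee)
  then have "Q b' = - b'" by (simp add: Q_def)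
  moreover have "Q e = e" unfolding Q_def ee by (simp add: scaleR_2)
  ultimately have "V (- b') e = V b' e"
    using symmetrised_orthogonal[OF Q, of b' e] by simp
  then have "V b' e = 0"
    using linear_neg[OF symmetrised_linear[of e], of b'] by simp
  moreover have "V b e = V (b' + (b \<bullet> e) *\<^sub>R e) e" by (simp add: b'_def)
  ultimately show ?thesis
    by (simp add: linear_add[OF symmetrised_linear] linear_cmul[OF symmetrised_linear])
qed

lemma symmetrised_closed_form:
  "\<exists>c. \<forall>b x. V b x = c * norm x powr (-\<delta>) * (b \<bullet> x)"
proof (intro exI allI)
  let ?a = "axis i 1 :: real^'n"
  fix b x
  show "V b x = V ?a ?a * norm x powr (-\<delta>) * (b \<bullet> x)"
  proof (cases "x = 0")
    case True
    have "V b 0 = 0" by (simp add: symmetrised_sum u_fun_minus)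
    with True show ?thesis by simp
  next
    case False
    define r where "r = norm x"
    have r: "r > 0" using False by (simp add: r_def)
    define e where "e = x /\<^sub>R r"
    have e: "norm e = 1" "x = r *\<^sub>R e" using r by (auto simp: e_def r_def)
    \<comment> \<open>An orthogonal map carrying \<open>?a\<close> to \<open>e\<close> shows that
      the constant is the same in every direction.\<close>
    obtain Q where Q: "orthogonal_transformation Q" "Q ?a = e"
      using orthogonal_transformation_exists_1[of ?a e] e by auto
    have ee: "V e e = V ?a ?a"
      using symmetrised_orthogonal[OF Q(1), of ?a ?a] Q(2) by simp
    have "V b x = r powr (1 - \<delta>) * ((b \<bullet> e) * V e e)"
      using symmetrised_scaleR[OF r, of b e] symmetrised_unit[OF e(1), of b] e(2) by simp
    also have "\<dots> = V ?a ?a * r powr (-\<delta>) * (b \<bullet> x)"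
      using r by (simp add: ee e(2) powr_diff powr_minus divide_inverse)
    finally show ?thesis by (simp add: r_def)
  qed
qed

section \<open>From truncated integrals to the principal value\<close>

lemma riesz_kernel_annulus_integrable:
  assumes r: "r > 0"
  shows "integrable lborel (\<lambda>h. indicator (annulus r) h * (K h * u_dir j (x - h)))"
proof -
  define d where "d = real CARD('n)"
  have d1: "d \<ge> 1" by (simp add: d_def)
  define p where "p = d - 1 + s"
  define a where "a = s - \<delta>"
  define N where "N = 2 * d + \<bar>p\<bar> + \<bar>a\<bar> + 1"
  obtain k where k: "k \<ge> 0" "\<And>h. \<bar>K h\<bar> = k * norm h powr (-p)"
    using riesz_kernel_powr[of s, where 'n='n] unfolding p_def d_def by blast
  define W2 :: "real^'n \<Rightarrow> real" where "W2 = (\<lambda>h. norm h powr (-(-a)) * decay N h)"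
  have A: "- a < d" "d < - a + N"
    using s \<delta> d1 by (auto simp: a_def N_def d_def)
  have W2: "integrable lborel W2"
    unfolding W2_def by (rule integrable_norm_powr_weight) (use A in \<open>simp_all add: d_def\<close>)
  have W0: "W2 h \<ge> 0" for h by (auto simp: W2_def)
  have N0: "N > 0" using d1 by (simp add: N_def)
  define R where "R = 1 + norm x + 1 / r"
  have R: "R > 0" using r by (simp add: R_def add_pos_nonneg)
  define C where "C = k * r powr (-p) * R powr N"
  have bound: "\<bar>indicator (annulus r) h * (K h * u_dir j (x - h))\<bar> \<le> C * W2 (x - h)" for h
  proof (cases "h \<in> annulus r")
    case True
    then have h: "r \<le> norm h" "norm h \<le> 1 / r" by (auto simp: annulus_def)
    have "norm h powr (-p) \<le> r powr (-p)"
      using h r d1 s by (intro powr_mono2') (auto simp: p_def)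
    then have 1: "\<bar>K h\<bar> \<le> k * r powr (-p)" unfolding k using k by (intro mult_left_mono) auto
    have le: "1 + norm (x - h) \<le> R" using norm_triangle_ineq4[of x h] h by (simp add: R_def)
    have "R powr (-N) \<le> decay N (x - h)"
      using le N0 by (intro powr_mono2') (auto simp: add_pos_nonneg)
    then have 2: "1 \<le> R powr N * decay N (x - h)"
      using R by (simp add: powr_minus field_simps)
    have "\<bar>u_dir j (x - h)\<bar> \<le> norm (x - h) powr a * 1" using abs_u_fun_le[of j s \<delta> "x - h"] by (simp add: a_def)
    also have "\<dots> \<le> norm (x - h) powr a * (R powr N * decay N (x - h))"
      by (intro mult_left_mono 2) simp
    finally have "\<bar>u_dir j (x - h)\<bar> \<le> R powr N * W2 (x - h)" by (simp add: W2_def mult_ac)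
    then have "\<bar>K h * u_dir j (x - h)\<bar> \<le> (k * r powr (-p)) * (R powr N * W2 (x - h))"
      unfolding abs_mult using 1 k by (intro mult_mono) auto
    then show ?thesis using True by (simp add: C_def mult_ac)
  next
    case False
    then show ?thesis using W0[of "x - h"] k by (simp add: C_def)
  qed
  show ?thesis
  proof (rule Bochner_Integration.integrable_bound)
    show "integrable lborel (\<lambda>h. C * W2 (x - h))"
      using integrable_lborel_affine[OF W2, of "-1" x] by auto
    show "AE h in lborel. norm (indicator (annulus r) h * (K h * u_dir j (x - h))) \<le> norm (C * W2 (x - h))"
      using bound by (intro AE_I2) (metis abs_ge_self order_trans real_norm_def)
  qed measurable
qed

lemma riesz_trunc_symmetrised:
  assumes r: "r > 0"
  shows "riesz_trunc s r (u_dir j) x = 1/2 * (LINT h|lborel. indicator (annulus r) h * (K h * (u_dir j (x - h) + u_dir j (x + h))))"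
proof -
  let ?f = "\<lambda>h. indicator (annulus r) h * (K h * u_dir j (x - h))"
  have int: "integrable lborel ?f" by (rule riesz_kernel_annulus_integrable[OF r])
  have sym: "?f (0 + (-1) *\<^sub>R h) = indicator (annulus r) h * (K h * u_dir j (x + h))" for h
    by (simp add: annulus_def indicator_def riesz_kernel_cong_norm[of "-h" h])
  have int': "integrable lborel (\<lambda>h. indicator (annulus r) h * (K h * u_dir j (x + h)))"
    using integrable_lborel_affine[OF int, of "-1" 0] unfolding sym by simp
  have eq: "(LINT h|lborel. ?f h) = (LINT h|lborel. indicator (annulus r) h * (K h * u_dir j (x + h)))"
    using integral_lborel_affine[of ?f "-1" 0] unfolding sym by simp
  have "riesz_trunc s r (u_dir j) x = (LINT h|lborel. ?f h)"
    unfolding riesz_trunc_def set_lebesgue_integral_def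
    by (subst integral_completion) auto
  also have "\<dots> = 1/2 * ((LINT h|lborel. ?f h) + (LINT h|lborel. indicator (annulus r) h * (K h * u_dir j (x + h))))"
    using eq by simp
  also have "\<dots> = 1/2 * (LINT h|lborel. ?f h + indicator (annulus r) h * (K h * u_dir j (x + h)))"
    using int int' by simp
  finally show ?thesis by (simp add: distrib_left)
qed

lemma riesz_trunc_tendsto:
  "((\<lambda>r. riesz_trunc s r (u_dir j) x) \<longlongrightarrow> V (axis j 1) x) (at_right 0)"
\<comment> \<open>Dominated convergence concerns sequences, so the radii are sampled along one. The
  majorant is the absolute value of the averaged integrand itself.\<close>
proof (rule tendsto_at_right_sequentially[of 0 1])
  fix S :: "nat \<Rightarrow> real"
  assume S: "\<And>n. 0 < S n" "S \<longlonglongrightarrow> 0"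
  let ?F = "\<lambda>h. K h * (u_dir j (x - h) + u_dir j (x + h))"
  have "(\<lambda>n. LINT h|lborel. indicator (annulus (S n)) h * ?F h) \<longlonglongrightarrow> (LINT h|lborel. ?F h)"
  proof (rule integral_dominated_convergence[where w="\<lambda>h. norm (?F h)"])
    show "AE h in lborel. (\<lambda>n. indicator (annulus (S n)) h * ?F h) \<longlonglongrightarrow> ?F h"
      using AE_lborel_singleton[of "0::real^'n"]
    proof eventually_elim
      case (elim h)
      then have "0 < min (norm h) (1 / norm h)" by simp
      then have "eventually (\<lambda>n. S n < min (norm h) (1 / norm h)) sequentially"
        using order_tendstoD(2)[OF S(2)] by blast
      then have "eventually (\<lambda>n. indicator (annulus (S n)) h * ?F h = ?F h) sequentially"
      proof eventually_elim
        case (elim n)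
        then have "h \<in> annulus (S n)"
          using \<open>h \<noteq> 0\<close> S(1)[of n] by (auto simp: annulus_def field_simps)
        then show ?case by simp
      qed
      then show ?case by (rule tendsto_eventually)
    qed
    show "AE h in lborel. norm (indicator (annulus (S n)) h * ?F h) \<le> norm (?F h)" for n
      by (intro AE_I2) (simp add: indicator_def)
  qed (use symmetrised_integrable[of j x] in auto)
  then show "(\<lambda>n. riesz_trunc s (S n) (u_dir j) x) \<longlonglongrightarrow> V (axis j 1) x"
    unfolding symmetrised_axis riesz_trunc_symmetrised[OF S(1)] by (rule tendsto_mult_left)
qed simp

lemma riesz_pv_exists_u_fun: "riesz_pv_exists s (u_dir j) x"
  unfolding riesz_pv_exists_def
proof (intro conjI allI impI)
  fix r :: real assume "r > 0"
  then show "set_integrable lebesgue (annulus r) (\<lambda>h. K h * u_dir j (x - h))"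
    unfolding set_integrable_def
    by (subst integrable_completion) (use riesz_kernel_annulus_integrable in auto)
qed (use riesz_trunc_tendsto in blast)

lemma riesz_pv_u_fun:
  "\<exists>c. \<forall>j x. riesz_pv s (u_dir j) x = c * (norm x powr (-\<delta>) * x $ j)"
proof -
  obtain c where c: "\<And>b x. V b x = c * norm x powr (-\<delta>) * (b \<bullet> x)"
    using symmetrised_closed_form by blast
  have "riesz_pv s (u_dir j) x = c * (norm x powr (-\<delta>) * x $ j)" for j x
    unfolding riesz_pv_def using tendsto_Lim[OF _ riesz_trunc_tendsto[of j x]]
    by (simp add: c inner_axis' )
  then show ?thesis by blast
qed

end

section \<open>Integration by parts with singular fields\<close>

text \<open>The square of the regularised radius rather than the radius, hence a positive polynomial
  whose real powers are differentiable everywhere. A power b of the radius becomes the power b/2 of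
  \<open>reg\<close>.\<close>

definition reg :: "nat \<Rightarrow> real^'n \<Rightarrow> real" where
  "reg n x = x \<bullet> x + 1 / real (Suc n)"

lemma reg_pos: "0 < reg n x"
  by (simp add: reg_def add_nonneg_pos)

lemma reg_tendsto: "(\<lambda>n. reg n x) \<longlonglongrightarrow> x \<bullet> x"
proof -
  have "(\<lambda>n. x \<bullet> x + inverse (real (Suc n))) \<longlonglongrightarrow> x \<bullet> x + 0"
    by (intro tendsto_intros LIMSEQ_inverse_real_of_nat)
  then show ?thesis by (simp add: reg_def inverse_eq_divide)
qed

lemma reg_powr_tendsto: "x \<noteq> 0 \<Longrightarrow> (\<lambda>n. reg n x powr b) \<longlonglongrightarrow> (x \<bullet> x) powr b"
  by (intro tendsto_powr reg_tendsto tendsto_const) simp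

text \<open>The first two bounds are uniform in \<open>n\<close> and give the domination as
  \<open>n\<close> grows. The third degenerates with \<open>n\<close> and gives decay at infinity
  for fixed \<open>n\<close>.\<close>

lemma reg_bounds: "(norm x)\<^sup>2 \<le> reg n x" "reg n x \<le> (1 + norm x)\<^sup>2"
  "1 / real (Suc n) / 2 * (1 + norm x)\<^sup>2 \<le> reg n x"
proof -
  define \<eta> where "\<eta> = 1 / real (Suc n)"
  have \<eta>: "0 < \<eta>" "\<eta> \<le> 1" by (auto simp: \<eta>_def)
  have r: "reg n x = (norm x)\<^sup>2 + \<eta>" by (simp add: reg_def \<eta>_def power2_norm_eq_inner)
  have e: "(1 + norm x)\<^sup>2 = 1 + 2 * norm x + (norm x)\<^sup>2" by (simp add: power2_eq_square algebra_simps)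
  show "(norm x)\<^sup>2 \<le> reg n x" using r \<eta> by simp
  show "reg n x \<le> (1 + norm x)\<^sup>2" unfolding r e using \<eta> norm_ge_zero[of x] by linarith
  have "2 * norm x \<le> 1 + (norm x)\<^sup>2"
    using sum_squares_bound[of 1 "norm x"] by simp
  then have "(1 + norm x)\<^sup>2 \<le> 2 * (1 + (norm x)\<^sup>2)" unfolding e by (simp add: distrib_left)
  then have "\<eta> / 2 * (1 + norm x)\<^sup>2 \<le> \<eta> / 2 * (2 * (1 + (norm x)\<^sup>2))"
    using \<eta> by (intro mult_left_mono) auto
  also have "\<dots> = \<eta> + \<eta> * (norm x)\<^sup>2" by (simp add: algebra_simps)
  also have "\<eta> * (norm x)\<^sup>2 \<le> 1 * (norm x)\<^sup>2" using \<eta> by (intro mult_right_mono) auto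
  finally show "1 / real (Suc n) / 2 * (1 + norm x)\<^sup>2 \<le> reg n x"
    unfolding r \<eta>_def[symmetric] by simp
qed

lemma power2_powr_half:
  fixes y :: real
  assumes "y > 0"
  shows "(y\<^sup>2) powr (b/2) = y powr b"
  using assms by (simp add: powr_powr flip: powr_numeral)

text \<open>The exponent can have either sign, since \<open>v_fun\<close> has degree 1 - \<delta>.
  Negative powers are controlled by the lower bound |x| for the regularised radius, positive ones by
  the upper bound 1 + |x|; the sum covers both without a case distinction in the
  applications.\<close>

lemma reg_powr_le:
  assumes "x \<noteq> 0"
  shows "reg n x powr (-\<tau>/2) \<le> norm x powr (-\<tau>) + decay \<tau> x"
proof -
  have p: "norm x > 0" "1 + norm x > 0" using assms by (auto simp: add_pos_nonneg)
  show ?thesis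
  proof (cases "\<tau> \<ge> 0")
    case True
    then have "reg n x powr (-\<tau>/2) \<le> ((norm x)\<^sup>2) powr (-\<tau>/2)"
      using p by (intro powr_mono2' reg_bounds) auto
    also have "\<dots> = norm x powr (-\<tau>)" by (rule power2_powr_half[OF p(1)])
    finally show ?thesis by (simp add: add_increasing2)
  next
    case False
    then have "reg n x powr (-\<tau>/2) \<le> ((1 + norm x)\<^sup>2) powr (-\<tau>/2)"
      using reg_pos[of n x] by (intro powr_mono2 reg_bounds) auto
    also have "\<dots> = decay \<tau> x" by (rule power2_powr_half[OF p(2)])
    finally show ?thesis by (simp add: add_increasing)
  qed
qed

lemma reg_powr_le_weight:
  "\<exists>B\<ge>0. \<forall>x::real^'n. reg n x powr (-\<tau>/2) \<le> B * decay \<tau> x"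
proof -
  let ?B = "max 1 ((1 / real (Suc n) / 2) powr (-\<tau>/2))"
  have "reg n x powr (-\<tau>/2) \<le> ?B * decay \<tau> x" for x :: "real^'n"
  proof -
    have p: "1 + norm x > 0" by (simp add: add_pos_nonneg)
    show ?thesis
    proof (cases "\<tau> \<ge> 0")
      case True
      then have "reg n x powr (-\<tau>/2) \<le> (1 / real (Suc n) / 2 * (1 + norm x)\<^sup>2) powr (-\<tau>/2)"
        using p by (intro powr_mono2' reg_bounds) (auto intro!: mult_pos_pos)
      also have "\<dots> = (1 / real (Suc n) / 2) powr (-\<tau>/2) * decay \<tau> x"
        by (simp only: powr_mult power2_powr_half[OF p])
      also have "\<dots> \<le> ?B * decay \<tau> x" by (intro mult_right_mono) auto
      finally show ?thesis .
    next
      case False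
      then have "reg n x powr (-\<tau>/2) \<le> ((1 + norm x)\<^sup>2) powr (-\<tau>/2)"
        using reg_pos[of n x] by (intro powr_mono2 reg_bounds) auto
      also have "\<dots> = 1 * decay \<tau> x" by (simp only: power2_powr_half[OF p] mult_1)
      also have "\<dots> \<le> ?B * decay \<tau> x" by (intro mult_right_mono) auto
      finally show ?thesis .
    qed
  qed
  then show ?thesis by (intro exI[of _ ?B]) auto
qed

lemma integrable_two_weights:
  assumes "\<tau> < real CARD('n)" "real CARD('n) < \<tau> + p"
  shows "integrable lborel (\<lambda>x::real^'n. (norm x powr (-\<tau>) + decay \<tau> x) * decay p x)"
proof -
  have "integrable lborel (\<lambda>x::real^'n. norm x powr (-\<tau>) * decay p x)"
    by (rule integrable_norm_powr_weight) (use assms in auto)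
  moreover have "integrable lborel (\<lambda>x::real^'n. decay (\<tau>+p) x)"
    by (rule integrable_weight) (use assms in auto)
  moreover have "decay (\<tau>+p) x = decay \<tau> x * decay p x" for x :: "real^'n"
    by (subst powr_add[symmetric]) simp
  ultimately show ?thesis by (simp add: distrib_right)
qed

text \<open>\<open>F n\<close> has the size of a homogeneous function of degree \<open>-\<sigma>\<close> in the regularised radius
  \<open>sqrt (|x|\<^sup>2 + 1/n)\<close>, so that the bounds are uniform in \<open>n\<close>.\<close>

lemma integral_by_parts_singular:
  fixes f g \<psi> :: "real^'n \<Rightarrow> real" and F :: "nat \<Rightarrow> real^'n \<Rightarrow> real"
  assumes F_diff: "\<And>n x. F n differentiable (at x)"
    and F_le: "\<And>n x. \<bar>F n x\<bar> \<le> A * reg n x powr (-\<sigma>/2)"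
    and dF_le: "\<And>n x. \<bar>partial j (F n) x\<bar> \<le> A * reg n x powr (-(\<sigma>+1)/2)"
    and F_lim: "\<And>x. x \<noteq> 0 \<Longrightarrow> (\<lambda>n. F n x) \<longlonglongrightarrow> f x"
    and dF_lim: "\<And>x. x \<noteq> 0 \<Longrightarrow> (\<lambda>n. partial j (F n) x) \<longlonglongrightarrow> g x"
    and [measurable]: "f \<in> borel_measurable borel" "g \<in> borel_measurable borel"
    and \<psi>_diff: "\<And>x. \<psi> differentiable (at x)"
    and \<psi>_le: "\<And>x. \<bar>\<psi> x\<bar> \<le> C * decay p x"
    and d\<psi>_le: "\<And>x. \<bar>partial j \<psi> x\<bar> \<le> C * decay q x"
    and \<sigma>: "\<sigma> + 1 < real CARD('n)" "real CARD('n) < \<sigma> + 1 + p" "real CARD('n) < \<sigma> + q"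
  shows "integrable lborel (\<lambda>x. f x * partial j \<psi> x)" "integrable lborel (\<lambda>x. g x * \<psi> x)"
    "(LINT x|lborel. f x * partial j \<psi> x) = - (LINT x|lborel. g x * \<psi> x)"
proof -
  have C: "C \<ge> 0" using \<psi>_le[of 0] by simp
  have A: "A \<ge> 0"
  proof -
    have "0 \<le> A * reg 0 (0::real^'n) powr (-\<sigma>/2)" using F_le[of 0 0] by linarith
    then show ?thesis using reg_pos[of 0 "0::real^'n"] by (simp add: zero_le_mult_iff)
  qed
  have [measurable]: "\<psi> \<in> borel_measurable borel" "partial j \<psi> \<in> borel_measurable borel"
    using differentiable_continuous(2)[OF \<psi>_diff] partial_measurable[OF \<psi>_diff] by auto
  have [measurable]: "F n \<in> borel_measurable borel" "partial j (F n) \<in> borel_measurable borel" for n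
    using differentiable_continuous(2)[OF F_diff] partial_measurable[OF F_diff] by auto
  define W :: "real \<Rightarrow> real^'n \<Rightarrow> real" where "W \<tau> x = norm x powr (-\<tau>) + decay \<tau> x" for \<tau> x
  have W0: "W \<tau> x \<ge> 0" for \<tau> x by (simp add: W_def)
  have FW: "\<bar>F n x\<bar> \<le> A * W \<sigma> x" "\<bar>partial j (F n) x\<bar> \<le> A * W (\<sigma>+1) x" if "x \<noteq> 0" for n x
    using order_trans[OF F_le mult_left_mono[OF reg_powr_le[OF that] A]]
      order_trans[OF dF_le mult_left_mono[OF reg_powr_le[OF that] A]]
    unfolding W_def by blast+
  have fW: "\<bar>f x\<bar> \<le> A * W \<sigma> x" if "x \<noteq> 0" for x
    by (rule LIMSEQ_le_const2[OF tendsto_rabs[OF F_lim[OF that]]]) (use FW[OF that] in blast)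
  have gW: "\<bar>g x\<bar> \<le> A * W (\<sigma>+1) x" if "x \<noteq> 0" for x
    by (rule LIMSEQ_le_const2[OF tendsto_rabs[OF dF_lim[OF that]]]) (use FW[OF that] in blast)
  have prod: "\<bar>a * \<psi> x\<bar> \<le> A * C * (W (\<sigma>+1) x * decay p x)" if "\<bar>a\<bar> \<le> A * W (\<sigma>+1) x" for a x
  proof -
    have "\<bar>a\<bar> * \<bar>\<psi> x\<bar> \<le> (A * W (\<sigma>+1) x) * (C * decay p x)"
      by (intro mult_mono that \<psi>_le) (use A W0 in auto)
    then show ?thesis by (simp only: abs_mult mult_ac)
  qed
  have prod': "\<bar>a * partial j \<psi> x\<bar> \<le> A * C * (W \<sigma> x * decay q x)" if "\<bar>a\<bar> \<le> A * W \<sigma> x" for a x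
  proof -
    have "\<bar>a\<bar> * \<bar>partial j \<psi> x\<bar> \<le> (A * W \<sigma> x) * (C * decay q x)"
      by (intro mult_mono that d\<psi>_le) (use A W0 in auto)
    then show ?thesis by (simp only: abs_mult mult_ac)
  qed
  have I1: "integrable lborel (\<lambda>x::real^'n. A * C * (W (\<sigma>+1) x * decay p x))"
    unfolding W_def using \<sigma> by (intro integrable_mult_right integrable_two_weights) auto
  have I2: "integrable lborel (\<lambda>x::real^'n. A * C * (W \<sigma> x * decay q x))"
    unfolding W_def using \<sigma> by (intro integrable_mult_right integrable_two_weights) auto
  show int_f: "integrable lborel (\<lambda>x. f x * partial j \<psi> x)"
  proof (rule Bochner_Integration.integrable_bound[OF I2])
    show "AE x in lborel. norm (f x * partial j \<psi> x) \<le> norm (A * C * (W \<sigma> x * decay q x))"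
      using AE_lborel_singleton[of "0::real^'n"]
    proof eventually_elim
      case (elim x)
      show ?case using prod'[OF fW[OF elim]] unfolding real_norm_def by (rule order_trans[OF _ abs_ge_self])
    qed
  qed measurable
  show int_g: "integrable lborel (\<lambda>x. g x * \<psi> x)"
  proof (rule Bochner_Integration.integrable_bound[OF I1])
    show "AE x in lborel. norm (g x * \<psi> x) \<le> norm (A * C * (W (\<sigma>+1) x * decay p x))"
      using AE_lborel_singleton[of "0::real^'n"]
    proof eventually_elim
      case (elim x)
      show ?case using prod[OF gW[OF elim]] unfolding real_norm_def by (rule order_trans[OF _ abs_ge_self])
    qed
  qed measurable
  \<comment> \<open>For fixed \<open>n\<close> the product \<open>F n x * \<psi> x\<close> is
    differentiable everywhere. It decays with order \<sigma> + p > d - 1, which need not make it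
    integrable; this is the situation for which \<open>integral_partial_eq_0\<close> has its
    cutoff.\<close>
  have zero: "(LINT x|lborel. partial j (F n) x * \<psi> x + F n x * partial j \<psi> x) = 0" for n
  proof -
    obtain B1 where B1: "B1 \<ge> 0" "\<And>x::real^'n. reg n x powr (-\<sigma>/2) \<le> B1 * decay \<sigma> x"
      using reg_powr_le_weight[of n \<sigma>, where 'n='n] by blast
    obtain B2 where B2: "B2 \<ge> 0" "\<And>x::real^'n. reg n x powr (-(\<sigma>+1)/2) \<le> B2 * decay (\<sigma>+1) x"
      using reg_powr_le_weight[of n "\<sigma>+1", where 'n='n] by blast
    define q' where "q' = min (\<sigma> + 1 + p) (\<sigma> + q)"
    define D where "D = A * B1 * C + A * B2 * C"
    have D: "A * B1 * C \<le> D" "0 \<le> A * B1 * C" "0 \<le> A * B2 * C"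
      using A B1 B2 C by (auto simp: D_def)
    have F1: "\<bar>F n x\<bar> \<le> A * B1 * decay \<sigma> x" for x
      using order_trans[OF F_le mult_left_mono[OF B1(2) A]] by (simp add: mult.assoc)
    have F2: "\<bar>partial j (F n) x\<bar> \<le> A * B2 * decay (\<sigma>+1) x" for x
      using order_trans[OF dF_le mult_left_mono[OF B2(2) A]] by (simp add: mult.assoc)
    have w: "decay a x * decay b x = decay (a+b) x" for a b and x :: "real^'n"
      by (subst powr_add[symmetric]) simp
    have P: "partial j (\<lambda>x. F n x * \<psi> x) x = partial j (F n) x * \<psi> x + F n x * partial j \<psi> x" for x
      by (rule partial_mult[OF F_diff \<psi>_diff])
    have "(LINT x|lborel. partial j (\<lambda>x. F n x * \<psi> x) x) = 0"
    proof (rule integral_partial_eq_0(2)[where C=D and p="\<sigma>+p" and q=q'])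
      show "(\<lambda>x. F n x * \<psi> x) differentiable (at x)" for x
        by (intro differentiable_mult F_diff \<psi>_diff)
      show "\<bar>F n x * \<psi> x\<bar> \<le> D * decay (\<sigma>+p) x" for x
      proof -
        have "\<bar>F n x\<bar> * \<bar>\<psi> x\<bar> \<le> (A * B1 * decay \<sigma> x) * (C * decay p x)"
          by (intro mult_mono F1 \<psi>_le) (use A B1 in auto)
        also have "\<dots> = (A * B1 * C) * decay (\<sigma>+p) x"
          by (simp only: w[symmetric] mult_ac)
        also have "\<dots> \<le> D * decay (\<sigma>+p) x" using D by (intro mult_right_mono) auto
        finally show ?thesis by (simp only: abs_mult)
      qed
      show "\<bar>partial j (\<lambda>x. F n x * \<psi> x) x\<bar> \<le> D * decay q' x" for x
      proof -
        have "\<bar>partial j (F n) x\<bar> * \<bar>\<psi> x\<bar> \<le> (A * B2 * decay (\<sigma>+1) x) * (C * decay p x)"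
          by (intro mult_mono F2 \<psi>_le) (use A B2 in auto)
        also have "\<dots> = (A * B2 * C) * decay (\<sigma>+1+p) x"
          by (simp only: w[symmetric] mult_ac)
        also have "\<dots> \<le> (A * B2 * C) * decay q' x"
          using D by (intro mult_left_mono powr_mono) (auto simp: q'_def)
        finally have 1: "\<bar>partial j (F n) x * \<psi> x\<bar> \<le> (A * B2 * C) * decay q' x" by (simp only: abs_mult)
        have "\<bar>F n x\<bar> * \<bar>partial j \<psi> x\<bar> \<le> (A * B1 * decay \<sigma> x) * (C * decay q x)"
          by (intro mult_mono F1 d\<psi>_le) (use A B1 in auto)
        also have "\<dots> = (A * B1 * C) * decay (\<sigma>+q) x"
          by (simp only: w[symmetric] mult_ac)
        also have "\<dots> \<le> (A * B1 * C) * decay q' x"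
          using D by (intro mult_left_mono powr_mono) (auto simp: q'_def)
        finally have 2: "\<bar>F n x * partial j \<psi> x\<bar> \<le> (A * B1 * C) * decay q' x" by (simp only: abs_mult)
        show ?thesis unfolding P D_def distrib_right using 1 2 abs_triangle_ineq[of "partial j (F n) x * \<psi> x" "F n x * partial j \<psi> x"]
          by linarith
      qed
    qed (use \<sigma> in \<open>auto simp: q'_def\<close>)
    then show ?thesis by (simp only: P)
  qed
  have "(\<lambda>n. LINT x|lborel. partial j (F n) x * \<psi> x + F n x * partial j \<psi> x)
     \<longlonglongrightarrow> (LINT x|lborel. g x * \<psi> x + f x * partial j \<psi> x)"
  proof (rule integral_dominated_convergence[where w="\<lambda>x. A * C * (W (\<sigma>+1) x * decay p x)
        + A * C * (W \<sigma> x * decay q x)"])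
    show "AE x in lborel. (\<lambda>n. partial j (F n) x * \<psi> x + F n x * partial j \<psi> x) \<longlonglongrightarrow> g x * \<psi> x + f x * partial j \<psi> x"
      using AE_lborel_singleton[of "0::real^'n"]
      by eventually_elim (intro tendsto_intros F_lim dF_lim)
    show "AE x in lborel. norm (partial j (F n) x * \<psi> x + F n x * partial j \<psi> x)
        \<le> A * C * (W (\<sigma>+1) x * decay p x) + A * C * (W \<sigma> x * decay q x)" for n
      using AE_lborel_singleton[of "0::real^'n"]
    proof eventually_elim
      case (elim x)
      show ?case
        using prod[OF FW(2)[OF elim], of n] prod'[OF FW(1)[OF elim], of n]
          abs_triangle_ineq[of "partial j (F n) x * \<psi> x" "F n x * partial j \<psi> x"]
        unfolding real_norm_def by linarith
    qed
    show "integrable lborel (\<lambda>x. A * C * (W (\<sigma>+1) x * decay p x)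
        + A * C * (W \<sigma> x * decay q x))"
      by (rule Bochner_Integration.integrable_add[OF I1 I2])
  qed measurable
  then have "(LINT x|lborel. g x * \<psi> x + f x * partial j \<psi> x) = 0"
    unfolding zero by (simp add: LIMSEQ_const_iff)
  then show "(LINT x|lborel. f x * partial j \<psi> x) = - (LINT x|lborel. g x * \<psi> x)"
    using int_f int_g by simp
qed

section \<open>Regularised monomials and the explicit fields\<close>

lemma reg_powr_has_derivative:
  "((\<lambda>x. reg n x powr b) has_derivative (\<lambda>h. 2 * (x \<bullet> h) * (b * reg n x powr (b - 1)))) (at x)"
proof (rule DERIV_compose_FDERIV[where f="\<lambda>z. z powr b" and g="reg n"])
  show "((\<lambda>z. z powr b) has_real_derivative b * reg n x powr (b - 1)) (at (reg n x))"
    by (rule has_real_derivative_powr[OF reg_pos])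
  show "(reg n has_derivative (\<lambda>h. 2 * (x \<bullet> h))) (at x)"
    unfolding reg_def[abs_def] by (auto intro!: derivative_eq_intros simp: inner_commute)
qed

lemma vec_nth_has_derivative: "((\<lambda>x::real^'n. x $ i) has_derivative (\<lambda>h. h $ i)) (at x)"
  by (rule bounded_linear_imp_has_derivative[OF bounded_linear_vec_nth])

lemma axis_component: "axis j 1 $ i = (if i = j then 1 else 0)"
  by (simp add: axis_def)

lemma component_le_reg: "\<bar>x $ i\<bar> \<le> reg n x powr (1/2)"
proof -
  have "\<bar>x $ i\<bar>\<^sup>2 \<le> (norm x)\<^sup>2"
    by (intro power_mono component_le_norm_cart) simp
  also have "\<dots> \<le> reg n x" by (rule reg_bounds)
  finally have "\<bar>x $ i\<bar> \<le> sqrt (reg n x)" by (rule real_le_rsqrt)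
  then show ?thesis using reg_pos[of n x] by (simp add: powr_half_sqrt)
qed

lemma reg_monomial1: "\<bar>reg n x powr b * x $ i\<bar> \<le> reg n x powr (b + 1/2)"
proof -
  have "reg n x powr b * \<bar>x $ i\<bar> \<le> reg n x powr b * reg n x powr (1/2)"
    by (intro mult_left_mono component_le_reg) simp
  then show ?thesis by (simp add: abs_mult powr_add)
qed

lemma reg_monomial2: "\<bar>reg n x powr b * x $ i * x $ j\<bar> \<le> reg n x powr (b + 1)"
proof -
  have "\<bar>reg n x powr b * x $ i\<bar> * \<bar>x $ j\<bar> \<le> reg n x powr (b + 1/2) * reg n x powr (1/2)"
    by (intro mult_mono reg_monomial1 component_le_reg) auto
  then show ?thesis by (simp add: abs_mult powr_add[symmetric] add.commute)
qed

lemma reg_monomial3: "\<bar>reg n x powr b * x $ i * x $ j * x $ k\<bar> \<le> reg n x powr (b + 3/2)"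
proof -
  have "\<bar>reg n x powr b * x $ i * x $ j\<bar> * \<bar>x $ k\<bar> \<le> reg n x powr (b + 1) * reg n x powr (1/2)"
    by (intro mult_mono reg_monomial2 component_le_reg) auto
  then show ?thesis by (simp add: abs_mult powr_add[symmetric] add.commute)
qed

lemma powr_inner_self: "x \<noteq> 0 \<Longrightarrow> (x \<bullet> x) powr (b/2) = norm x powr b"
  by (simp add: power2_powr_half flip: power2_norm_eq_inner)

text \<open>Up to one common constant factor, \<open>v_fun\<close> is the Riesz potential of \<open>u\<close>, \<open>v_grad\<close> its gradient and
  \<open>w_field\<close> the flux; \<open>w_deriv j\<close> is the \<open>j\<close>-th partial derivative of the \<open>j\<close>-th component of \<open>w_field\<close>.
  Powers of \<open>x \<bullet> x\<close> are used instead of powers of the norm because their regularisation is smooth.\<close>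

definition v_fun :: "'n \<Rightarrow> real \<Rightarrow> real^'n \<Rightarrow> real" where
  "v_fun i \<delta> x = (x \<bullet> x) powr (-\<delta>/2) * x $ i"

definition v_grad :: "'n \<Rightarrow> real \<Rightarrow> 'n \<Rightarrow> real^'n \<Rightarrow> real" where
  "v_grad i \<delta> j x = (if i = j then 1 else 0) * (x \<bullet> x) powr (-\<delta>/2) - \<delta> * ((x \<bullet> x) powr (-\<delta>/2-1) * x $ i * x $ j)"

definition w_field :: "'n \<Rightarrow> real \<Rightarrow> real \<Rightarrow> 'n \<Rightarrow> real^'n \<Rightarrow> real" where
  "w_field i \<delta> \<epsilon> j x = (1-\<epsilon>) * (if i = j then 1 else 0) * (x \<bullet> x) powr (-\<delta>/2)
     + (\<epsilon>-\<delta>) * ((x \<bullet> x) powr (-\<delta>/2-1) * x $ i * x $ j)"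

definition w_deriv :: "'n \<Rightarrow> real \<Rightarrow> real \<Rightarrow> 'n \<Rightarrow> real^'n \<Rightarrow> real" where
  "w_deriv i \<delta> \<epsilon> j x = - (1-\<epsilon>) * (if i = j then 1 else 0) * \<delta> * ((x \<bullet> x) powr (-\<delta>/2-1) * x $ j)
     + (\<epsilon>-\<delta>) * ((if i = j then 1 else 0) * ((x \<bullet> x) powr (-\<delta>/2-1) * x $ j) + (x \<bullet> x) powr (-\<delta>/2-1) * x $ i)
     - (\<epsilon>-\<delta>) * (\<delta>+2) * ((x \<bullet> x) powr (-\<delta>/2-2) * x $ i * x $ j * x $ j)"

lemma fields_measurable [measurable]:
  "v_fun i \<delta> \<in> borel_measurable borel" "v_grad i \<delta> j \<in> borel_measurable borel"
  "w_field i \<delta> \<epsilon> j \<in> borel_measurable borel" "w_deriv i \<delta> \<epsilon> j \<in> borel_measurable borel"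
  unfolding v_fun_def[abs_def] v_grad_def[abs_def] w_field_def[abs_def] w_deriv_def[abs_def] by measurable

context
  fixes i :: "'n::finite" and \<delta> \<epsilon> :: real
  assumes \<delta>: "0 < \<delta>"
begin

lemma v_fun_integral_by_parts:
  assumes \<psi>_diff: "\<And>x. \<psi> differentiable (at x)"
    and \<psi>_le: "\<And>x. \<bar>\<psi> x\<bar> \<le> C * decay p x"
    and d\<psi>_le: "\<And>x. \<bar>partial j \<psi> x\<bar> \<le> C * decay q x"
    and \<sigma>: "\<delta> < real CARD('n)" "real CARD('n) < \<delta> + p" "real CARD('n) < \<delta> - 1 + q"
  shows "(LINT x|lborel. v_fun i \<delta> x * partial j \<psi> x) = - (LINT x|lborel. v_grad i \<delta> j x * \<psi> x)"
\<comment> \<open>\<open>\<sigma> = \<delta> - 1\<close> because \<open>v_fun\<close> has degree 1 -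
  \<delta>, and \<open>A\<close> adds the coefficients 1 and \<delta> of the two terms of its
  gradient.\<close>
proof (rule integral_by_parts_singular(3)[where \<sigma>="\<delta>-1" and A="1+\<delta>" and F="\<lambda>n x. reg n x powr (-\<delta>/2) * x $ i"])
  fix n and x :: "real^'n"
  have D: "((\<lambda>x. reg n x powr (-\<delta>/2) * x $ i) has_derivative
    (\<lambda>h. reg n x powr (-\<delta>/2) * h $ i + 2 * (x \<bullet> h) * (-\<delta>/2 * reg n x powr (-\<delta>/2-1)) * x $ i)) (at x)"
    by (rule has_derivative_mult[OF reg_powr_has_derivative vec_nth_has_derivative])
  then show "(\<lambda>x. reg n x powr (-\<delta>/2) * x $ i) differentiable (at x)" by (rule differentiableI)
  show "\<bar>reg n x powr (-\<delta>/2) * x $ i\<bar> \<le> (1+\<delta>) * reg n x powr (-(\<delta>-1)/2)"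
  proof -
    have e: "-(\<delta>-1)/2 = -\<delta>/2 + 1/2" by (simp add: field_simps)
    have "1 * reg n x powr (-\<delta>/2 + 1/2) \<le> (1+\<delta>) * reg n x powr (-\<delta>/2 + 1/2)"
      using \<delta> by (intro mult_right_mono) auto
    then show ?thesis unfolding e using reg_monomial1[of n x "-\<delta>/2" i] by linarith
  qed
next
  have P: "partial j (\<lambda>x. reg n x powr (-\<delta>/2) * x $ i) x
    = (if i = j then 1 else 0) * reg n x powr (-\<delta>/2) - \<delta> * (reg n x powr (-\<delta>/2-1) * x $ i * x $ j)" for n and x :: "real^'n"
    by (subst partial_eqI[OF has_derivative_mult[OF reg_powr_has_derivative vec_nth_has_derivative]])
       (simp add: axis_component inner_axis)
  show "\<bar>partial j (\<lambda>x. reg n x powr (-\<delta>/2) * x $ i) x\<bar> \<le> (1+\<delta>) * reg n x powr (-(\<delta>-1+1)/2)" for n and x :: "real^'n"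
  proof -
    have 1: "\<bar>(if i = j then 1 else 0) * reg n x powr (-\<delta>/2)\<bar> \<le> reg n x powr (-\<delta>/2)" by simp
    have 2: "\<bar>\<delta> * (reg n x powr (-\<delta>/2-1) * x $ i * x $ j)\<bar> \<le> \<delta> * reg n x powr (-\<delta>/2)"
      using reg_monomial2[of n x "-\<delta>/2-1" i j] \<delta> by (simp add: abs_mult)
    have e: "-(\<delta>-1+1)/2 = -\<delta>/2" by simp
    show ?thesis unfolding P e distrib_right mult_1
      by (rule order_trans[OF abs_triangle_ineq4 add_mono[OF 1 2]])
  qed
  show "(\<lambda>n. partial j (\<lambda>x. reg n x powr (-\<delta>/2) * x $ i) x) \<longlonglongrightarrow> v_grad i \<delta> j x" if "x \<noteq> 0" for x
    unfolding P v_grad_def by (intro tendsto_intros reg_powr_tendsto that)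
  show "(\<lambda>n. reg n x powr (-\<delta>/2) * x $ i) \<longlonglongrightarrow> v_fun i \<delta> x" if "x \<noteq> 0" for x
    unfolding v_fun_def by (intro tendsto_intros reg_powr_tendsto that)
qed (use assms in auto)

lemma w_field_integral_by_parts:
  assumes \<psi>_diff: "\<And>x. \<psi> differentiable (at x)"
    and \<psi>_le: "\<And>x. \<bar>\<psi> x\<bar> \<le> C * decay p x"
    and d\<psi>_le: "\<And>x. \<bar>partial j \<psi> x\<bar> \<le> C * decay q x"
    and \<sigma>: "\<delta> + 1 < real CARD('n)" "real CARD('n) < \<delta> + 1 + p" "real CARD('n) < \<delta> + q"
  shows "integrable lborel (\<lambda>x. w_field i \<delta> \<epsilon> j x * partial j \<psi> x)" "integrable lborel (\<lambda>x. w_deriv i \<delta> \<epsilon> j x * \<psi> x)"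
    "(LINT x|lborel. w_field i \<delta> \<epsilon> j x * partial j \<psi> x) = - (LINT x|lborel. w_deriv i \<delta> \<epsilon> j x * \<psi> x)"
proof -
  define F where "F n x = (1-\<epsilon>) * (if i = j then 1 else 0) * reg n x powr (-\<delta>/2)
     + (\<epsilon>-\<delta>) * (reg n x powr (-\<delta>/2-1) * x $ i * x $ j)" for n and x :: "real^'n"
  define D where "D n x = - (1-\<epsilon>) * (if i = j then 1 else 0) * \<delta> * (reg n x powr (-\<delta>/2-1) * x $ j)
     + (\<epsilon>-\<delta>) * ((if i = j then 1 else 0) * (reg n x powr (-\<delta>/2-1) * x $ j) + reg n x powr (-\<delta>/2-1) * x $ i)
     - (\<epsilon>-\<delta>) * (\<delta>+2) * (reg n x powr (-\<delta>/2-2) * x $ i * x $ j * x $ j)" for n and x :: "real^'n"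
  \<comment> \<open>The derivative needs \<open>\<bar>1-\<epsilon>\<bar> * \<delta>\<close> and
    \<open>\<bar>\<epsilon>-\<delta>\<bar> * (\<delta>+4)\<close>, where \<delta> + 4 collects the
    two monomials of degree one and the factor \<delta> + 2 of the cubic one. The extra
    \<open>\<bar>1-\<epsilon>\<bar>\<close> lets the same constant serve \<open>F n\<close>
    itself.\<close>
  define A where "A = \<bar>1-\<epsilon>\<bar> * (1+\<delta>) + \<bar>\<epsilon>-\<delta>\<bar> * (\<delta>+4)"
  have F': "(F n has_derivative (\<lambda>h. (1-\<epsilon>) * (if i = j then 1 else 0) * (2 * (x \<bullet> h) * (-\<delta>/2 * reg n x powr (-\<delta>/2-1)))
     + (\<epsilon>-\<delta>) * (reg n x powr (-\<delta>/2-1) * x $ i * h $ j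
       + (reg n x powr (-\<delta>/2-1) * h $ i + 2 * (x \<bullet> h) * ((-\<delta>/2-1) * reg n x powr (-\<delta>/2-1-1)) * x $ i) * x $ j))) (at x)" for n x
    unfolding F_def[abs_def]
    by (intro has_derivative_add has_derivative_mult_right has_derivative_mult reg_powr_has_derivative vec_nth_has_derivative)
  have e2: "-\<delta>/2-1-1 = -\<delta>/2-2" by simp
  have P: "partial j (F n) x = D n x" for n x
    unfolding partial_eqI[OF F'] D_def e2
    by (cases "i = j") (simp_all add: axis_component inner_axis algebra_simps)
  have Fd: "F n differentiable (at x)" for n x using F' by (rule differentiableI)
  have F_le: "\<bar>F n x\<bar> \<le> A * reg n x powr (-\<delta>/2)" for n x
  proof -
    have 1: "\<bar>(1-\<epsilon>) * (if i = j then 1 else 0) * reg n x powr (-\<delta>/2)\<bar> \<le> \<bar>1-\<epsilon>\<bar> * reg n x powr (-\<delta>/2)"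
      by (simp add: abs_mult)
    have 2: "\<bar>(\<epsilon>-\<delta>) * (reg n x powr (-\<delta>/2-1) * x $ i * x $ j)\<bar> \<le> \<bar>\<epsilon>-\<delta>\<bar> * reg n x powr (-\<delta>/2)"
      using mult_left_mono[OF reg_monomial2[of n x "-\<delta>/2-1" i j], of "\<bar>\<epsilon>-\<delta>\<bar>"] by (simp add: abs_mult)
    have "\<bar>F n x\<bar> \<le> (\<bar>1-\<epsilon>\<bar> + \<bar>\<epsilon>-\<delta>\<bar>) * reg n x powr (-\<delta>/2)"
      unfolding F_def distrib_right using 1 2 abs_triangle_ineq order_trans add_mono by meson
    also have "\<dots> \<le> A * reg n x powr (-\<delta>/2)"
    proof (intro mult_right_mono)
      have "\<bar>1-\<epsilon>\<bar> * 1 \<le> \<bar>1-\<epsilon>\<bar> * (1+\<delta>)" "\<bar>\<epsilon>-\<delta>\<bar> * 1 \<le> \<bar>\<epsilon>-\<delta>\<bar> * (\<delta>+4)"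
        using \<delta> by (intro mult_left_mono; simp)+
      then show "\<bar>1-\<epsilon>\<bar> + \<bar>\<epsilon>-\<delta>\<bar> \<le> A" by (simp add: A_def)
    qed simp
    finally show ?thesis .
  qed
  have D_le: "\<bar>D n x\<bar> \<le> A * reg n x powr (-(\<delta>+1)/2)" for n x
  proof -
    let ?r = "reg n x powr (-(\<delta>+1)/2)"
    have e: "-\<delta>/2-1+1/2 = -(\<delta>+1)/2" "-\<delta>/2-2+3/2 = -(\<delta>+1)/2" by (simp_all add: field_simps)
    have m: "\<bar>reg n x powr (-\<delta>/2-1) * x $ j\<bar> \<le> ?r" "\<bar>reg n x powr (-\<delta>/2-1) * x $ i\<bar> \<le> ?r"
      "\<bar>reg n x powr (-\<delta>/2-2) * x $ i * x $ j * x $ j\<bar> \<le> ?r"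
      using reg_monomial1[of n x "-\<delta>/2-1"] reg_monomial3[of n x "-\<delta>/2-2"] unfolding e by blast+
    have c: "\<bar>a * b\<bar> \<le> \<bar>a\<bar> * ?r" if "\<bar>b\<bar> \<le> ?r" for a b
      using mult_left_mono[OF that, of "\<bar>a\<bar>"] by (simp add: abs_mult)
    have 1: "\<bar>- (1-\<epsilon>) * (if i = j then 1 else 0) * \<delta> * (reg n x powr (-\<delta>/2-1) * x $ j)\<bar> \<le> \<bar>1-\<epsilon>\<bar> * \<delta> * ?r"
    proof -
      have "\<bar>- (1-\<epsilon>) * (if i = j then 1 else 0) * \<delta>\<bar> \<le> \<bar>1-\<epsilon>\<bar> * \<delta>"
        unfolding abs_mult abs_minus_cancel using \<delta> by simp
      then show ?thesis by (intro order_trans[OF c[OF m(1)]] mult_right_mono) auto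
    qed
    have 2: "\<bar>(if i = j then 1 else 0) * (reg n x powr (-\<delta>/2-1) * x $ j) + reg n x powr (-\<delta>/2-1) * x $ i\<bar> \<le> 2 * ?r"
      using m(1,2) by (cases "i = j") (auto simp: abs_le_iff mult.commute)
    have 2: "\<bar>(\<epsilon>-\<delta>) * ((if i = j then 1 else 0) * (reg n x powr (-\<delta>/2-1) * x $ j) + reg n x powr (-\<delta>/2-1) * x $ i)\<bar>
        \<le> \<bar>\<epsilon>-\<delta>\<bar> * (2 * ?r)"
      using mult_left_mono[OF 2, of "\<bar>\<epsilon>-\<delta>\<bar>"] by (simp add: abs_mult)
    have 3: "\<bar>(\<epsilon>-\<delta>) * (\<delta>+2) * (reg n x powr (-\<delta>/2-2) * x $ i * x $ j * x $ j)\<bar> \<le> \<bar>\<epsilon>-\<delta>\<bar> * (\<delta>+2) * ?r"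
      using c[OF m(3), of "(\<epsilon>-\<delta>) * (\<delta>+2)"] \<delta> by (simp add: abs_mult)
    have "\<bar>D n x\<bar> \<le> \<bar>1-\<epsilon>\<bar> * \<delta> * ?r + \<bar>\<epsilon>-\<delta>\<bar> * (2 * ?r) + \<bar>\<epsilon>-\<delta>\<bar> * (\<delta>+2) * ?r"
      unfolding D_def by (rule order_trans[OF abs_triangle_ineq4]
        add_mono[OF order_trans[OF abs_triangle_ineq add_mono[OF 1 2]] 3])+
    also have "\<dots> = (\<bar>1-\<epsilon>\<bar> * \<delta> + \<bar>\<epsilon>-\<delta>\<bar> * (\<delta>+4)) * ?r" by (simp add: algebra_simps)
    also have "\<dots> \<le> A * ?r" unfolding A_def by (intro mult_right_mono add_right_mono mult_left_mono) auto
    finally show ?thesis .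
  qed
  note ibp = integral_by_parts_singular[of F A \<delta> j "w_field i \<delta> \<epsilon> j" "w_deriv i \<delta> \<epsilon> j" \<psi> C p q, OF Fd F_le D_le[folded P]]
  have lim1: "(\<lambda>n. F n x) \<longlonglongrightarrow> w_field i \<delta> \<epsilon> j x" if "x \<noteq> 0" for x
    unfolding w_field_def F_def by (intro tendsto_intros reg_powr_tendsto that)
  have lim2: "(\<lambda>n. partial j (F n) x) \<longlonglongrightarrow> w_deriv i \<delta> \<epsilon> j x" if "x \<noteq> 0" for x
    unfolding P w_deriv_def D_def by (intro tendsto_intros reg_powr_tendsto that)
  show "integrable lborel (\<lambda>x. w_field i \<delta> \<epsilon> j x * partial j \<psi> x)" "integrable lborel (\<lambda>x. w_deriv i \<delta> \<epsilon> j x * \<psi> x)"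
    "(LINT x|lborel. w_field i \<delta> \<epsilon> j x * partial j \<psi> x) = - (LINT x|lborel. w_deriv i \<delta> \<epsilon> j x * \<psi> x)"
    by (rule ibp; use lim1 lim2 assms in \<open>simp\<close>)+
qed

text \<open>Each group of terms sums to a multiple of \<open>R * x $ i\<close>, with coefficients
  -(1 - \<epsilon>) \<delta>, (\<epsilon> - \<delta>) (d + 1) and -(\<epsilon> - \<delta>) (\<delta>
  + 2). Their sum is \<epsilon> (d - 1) - (d - \<delta>) \<delta>, and this is where the value of
  \<epsilon> comes from.\<close>

lemma sum_w_deriv_eq_0:
  assumes \<epsilon>: "\<epsilon> * (real CARD('n) - 1) = (real CARD('n) - \<delta>) * \<delta>"
  shows "(\<Sum>j\<in>UNIV. w_deriv i \<delta> \<epsilon> j x) = 0"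
proof (cases "x = 0")
  case False
  let ?d = "real CARD('n)"
  define R where "R = (x \<bullet> x) powr (-\<delta>/2-1)"
  have R2: "(x \<bullet> x) powr (-\<delta>/2-2) * (x \<bullet> x) = R"
  proof -
    have "(x \<bullet> x) powr (-\<delta>/2-2) * (x \<bullet> x) = (x \<bullet> x) powr (-\<delta>/2-2) * (x \<bullet> x) powr 1" using False by simp
    also have "\<dots> = R"
    proof -
      have "-\<delta>/2-2+1 = -\<delta>/2-1" by simp
      then show ?thesis by (simp only: R_def powr_add[symmetric])
    qed
    finally show ?thesis .
  qed
  have "(\<Sum>j\<in>UNIV. w_deriv i \<delta> \<epsilon> j x) = - (1-\<epsilon>) * \<delta> * (R * x $ i)
     + (\<epsilon>-\<delta>) * (R * x $ i + ?d * (R * x $ i))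
     - (\<epsilon>-\<delta>) * (\<delta>+2) * ((x \<bullet> x) powr (-\<delta>/2-2) * x $ i * (x \<bullet> x))"
    unfolding w_deriv_def R_def[symmetric]
    by (simp add: sum.distrib sum_subtractf sum_distrib_left[symmetric] if_distrib[of "\<lambda>c. c * _"] if_distrib[of "\<lambda>c. _ * c"] inner_vec_def mult.assoc cong: if_cong)
  also have "(x \<bullet> x) powr (-\<delta>/2-2) * x $ i * (x \<bullet> x) = R * x $ i"
    using R2 by (metis mult.commute mult.left_commute)
  also have "- (1-\<epsilon>) * \<delta> * (R * x $ i) + (\<epsilon>-\<delta>) * (R * x $ i + ?d * (R * x $ i)) - (\<epsilon>-\<delta>) * (\<delta>+2) * (R * x $ i)
     = (\<epsilon> * (?d - 1) - (?d - \<delta>) * \<delta>) * (R * x $ i)"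
    by (simp add: algebra_simps)
  finally show ?thesis by (simp add: \<epsilon>)
qed (simp add: w_deriv_def)

text \<open>The cancellation occurs only in the sum over \<open>j\<close>, so each component is
  shown to be integrable before the sum is moved inside the integral.\<close>

lemma w_field_weakly_div_free:
  assumes \<psi>_diff: "\<And>x. \<psi> differentiable (at x)"
    and \<psi>_le: "\<And>x. \<bar>\<psi> x\<bar> \<le> C * decay p x"
    and d\<psi>_le: "\<And>j x. \<bar>partial j \<psi> x\<bar> \<le> C * decay q x"
    and \<sigma>: "\<delta> + 1 < real CARD('n)" "real CARD('n) < \<delta> + 1 + p" "real CARD('n) < \<delta> + q"
    and \<epsilon>: "\<epsilon> * (real CARD('n) - 1) = (real CARD('n) - \<delta>) * \<delta>"
  shows "integrable lborel (\<lambda>x. w_field i \<delta> \<epsilon> j x * partial j \<psi> x)"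
    "(\<Sum>j\<in>UNIV. LINT x|lborel. w_field i \<delta> \<epsilon> j x * partial j \<psi> x) = 0"
proof -
  note ibp = w_field_integral_by_parts[OF \<psi>_diff \<psi>_le d\<psi>_le \<sigma>]
  show "integrable lborel (\<lambda>x. w_field i \<delta> \<epsilon> j x * partial j \<psi> x)" by (rule ibp)
  have "(\<Sum>j\<in>UNIV. LINT x|lborel. w_field i \<delta> \<epsilon> j x * partial j \<psi> x) = - (\<Sum>j\<in>UNIV. LINT x|lborel. w_deriv i \<delta> \<epsilon> j x * \<psi> x)"
    by (simp add: ibp(3) sum_negf)
  also have "(\<Sum>j\<in>UNIV. LINT x|lborel. w_deriv i \<delta> \<epsilon> j x * \<psi> x) = (LINT x|lborel. (\<Sum>j\<in>UNIV. w_deriv i \<delta> \<epsilon> j x * \<psi> x))"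
    by (rule Bochner_Integration.integral_sum[symmetric]) (rule ibp(2))
  also have "\<dots> = 0"
    by (simp add: sum_distrib_right[symmetric] sum_w_deriv_eq_0[OF \<epsilon>])
  finally show "(\<Sum>j\<in>UNIV. LINT x|lborel. w_field i \<delta> \<epsilon> j x * partial j \<psi> x) = 0" by simp
qed

end

section \<open>Convolution of Schwartz functions with the Riesz kernel\<close>

lemma powr_nonpos_le_one: "1 \<le> x \<Longrightarrow> a \<le> 0 \<Longrightarrow> x powr a \<le> (1::real)"
  using powr_mono[of a 0 x] by simp

lemma schwartz_differentiable: "\<phi> \<in> schwartz \<Longrightarrow> \<phi> differentiable (at x)"
  unfolding schwartz_def using partials.simps(1) by (metis (no_types, lifting) mem_Collect_eq)

lemma partials_snoc: "partials (js @ [j]) f = partials js (partial j f)"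
  by (induction js) auto

lemma schwartz_partial: "\<phi> \<in> schwartz \<Longrightarrow> partial j \<phi> \<in> schwartz"
  unfolding schwartz_def by (auto simp: partials_snoc[symmetric])

lemma schwartz_le_SUP:
  assumes "\<phi> \<in> schwartz"
  shows "(1 + norm x) ^ N * \<bar>partials js \<phi> x\<bar> \<le> (SUP x. (1 + norm x) ^ N * \<bar>partials js \<phi> x\<bar>)"
  using assms unfolding schwartz_def by (intro cSUP_upper) auto

lemma schwartz_decay:
  assumes "\<phi> \<in> (schwartz :: (real^'n \<Rightarrow> real) set)"
  obtains C where "C \<ge> 0" "\<And>x. \<bar>\<phi> x\<bar> \<le> C * decay M x"
proof -
  define N where "N = nat \<lceil>M\<rceil>"
  have N: "M \<le> real N" unfolding N_def by linarith
  define C where "C = (SUP x. (1 + norm x) ^ N * \<bar>partials [] \<phi> x\<bar>)"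
  have le: "(1 + norm x) ^ N * \<bar>\<phi> x\<bar> \<le> C" for x
    using schwartz_le_SUP[OF assms, of x N "[]"] by (simp add: C_def)
  have C: "C \<ge> 0" by (rule order_trans[OF _ le[of 0]]) simp
  have "\<bar>\<phi> x\<bar> \<le> C * decay M x" for x
  proof -
    have p: "1 + norm x > 0" by (simp add: add_pos_nonneg)
    have "\<bar>\<phi> x\<bar> = ((1 + norm x) ^ N * \<bar>\<phi> x\<bar>) * decay (real N) x"
      using p by (simp add: powr_minus powr_realpow)
    also have "\<dots> \<le> C * decay (real N) x" by (intro mult_right_mono le) simp
    also have "\<dots> \<le> C * decay M x"
      using N C by (intro mult_left_mono powr_mono) auto
    finally show ?thesis .
  qed
  with C show thesis by (rule that)
qed

lemma schwartz_measurable: "\<phi> \<in> schwartz \<Longrightarrow> \<phi> \<in> borel_measurable borel"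
  by (rule differentiable_continuous) (rule schwartz_differentiable)

lemma frechet_derivative_sum_partial:
  fixes f :: "real^'n \<Rightarrow> real"
  assumes "f differentiable (at x)"
  shows "(f has_derivative (\<lambda>z. \<Sum>j\<in>UNIV. z $ j * partial j f x)) (at x)"
proof -
  let ?D = "frechet_derivative f (at x)"
  have D: "(f has_derivative ?D) (at x)" using assms by (simp add: frechet_derivative_works)
  have lin: "linear ?D" by (rule has_derivative_linear[OF D])
  have "?D z = (\<Sum>j\<in>UNIV. z $ j * partial j f x)" for z
  proof -
    have "z = (\<Sum>j\<in>UNIV. z $ j *\<^sub>R axis j 1)"
      using basis_expansion[of z] by (simp add: scalar_mult_eq_scaleR)
    then have "?D z = ?D (\<Sum>j\<in>UNIV. z $ j *\<^sub>R axis j 1)" by simp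
    also have "\<dots> = (\<Sum>j\<in>UNIV. z $ j * ?D (axis j 1))"
      by (simp add: linear_sum[OF lin] linear_cmul[OF lin])
    finally show ?thesis by (simp add: partial_def)
  qed
  then have "?D = (\<lambda>z. \<Sum>j\<in>UNIV. z $ j * partial j f x)" by blast
  with D show ?thesis by simp
qed

lemma has_real_derivative_along_line:
  fixes f :: "real^'n \<Rightarrow> real"
  assumes "f differentiable (at (y + \<tau> *\<^sub>R z))"
  shows "((\<lambda>\<tau>. f (y + \<tau> *\<^sub>R z)) has_real_derivative (\<Sum>j\<in>UNIV. z $ j * partial j f (y + \<tau> *\<^sub>R z))) (at \<tau>)"
proof -
  have "((\<lambda>\<tau>. f (y + \<tau> *\<^sub>R z)) has_derivative
      (\<lambda>h. \<Sum>j\<in>UNIV. (h *\<^sub>R z) $ j * partial j f (y + \<tau> *\<^sub>R z))) (at \<tau>)"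
    by (rule has_derivative_compose[where f="\<lambda>\<tau>. y + \<tau> *\<^sub>R z" and g=f])
       (auto intro!: derivative_eq_intros frechet_derivative_sum_partial assms)
  then show ?thesis
    unfolding has_field_derivative_def
    by (rule back_subst[where P="\<lambda>D. (_ has_derivative D) _"])
       (auto simp: sum_distrib_left mult_ac)
qed

lemma schwartz_lipschitz:
  assumes \<phi>: "\<phi> \<in> (schwartz :: (real^'n \<Rightarrow> real) set)" and N: "N \<ge> 0"
  obtains C where "C \<ge> 0"
    "\<And>y z. norm z \<le> 1 \<Longrightarrow> \<bar>\<phi> (y + z) - \<phi> y\<bar> \<le> C * norm z * decay N y"
proof -
  have "\<forall>j. \<exists>C. C \<ge> 0 \<and> (\<forall>x. \<bar>partial j \<phi> x\<bar> \<le> C * decay N x)"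
    using schwartz_decay[OF schwartz_partial[OF \<phi>]] by metis
  then obtain C where C: "\<And>j. C j \<ge> 0" "\<And>j x. \<bar>partial j \<phi> x\<bar> \<le> C j * decay N x"
    by metis
  have "\<bar>\<phi> (y + z) - \<phi> y\<bar> \<le> ((\<Sum>j\<in>UNIV. C j) * 2 powr N) * norm z * decay N y"
    if z: "norm z \<le> 1" for y z
  proof -
    obtain \<theta> where \<theta>: "0 < \<theta>" "\<theta> < 1"
      "\<phi> (y + 1 *\<^sub>R z) - \<phi> (y + 0 *\<^sub>R z) = (1 - 0) * (\<Sum>j\<in>UNIV. z $ j * partial j \<phi> (y + \<theta> *\<^sub>R z))"
      using MVT2[of 0 1 "\<lambda>\<tau>. \<phi> (y + \<tau> *\<^sub>R z)" "\<lambda>\<tau>. \<Sum>j\<in>UNIV. z $ j * partial j \<phi> (y + \<tau> *\<^sub>R z)"]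
        has_real_derivative_along_line[OF schwartz_differentiable[OF \<phi>]] by auto
    have "norm (\<theta> *\<^sub>R z) \<le> 1" using \<theta> z by (simp add: mult_le_one)
    then have w: "decay N (y + \<theta> *\<^sub>R z) \<le> 2 powr N * decay N y"
      by (intro order_trans[OF weight_shift_le[OF N]] mult_right_mono powr_mono2 N) auto
    have "\<bar>\<phi> (y + z) - \<phi> y\<bar> = \<bar>\<Sum>j\<in>UNIV. z $ j * partial j \<phi> (y + \<theta> *\<^sub>R z)\<bar>"
      using \<theta>(3) by simp
    also have "\<dots> \<le> (\<Sum>j\<in>UNIV. \<bar>z $ j * partial j \<phi> (y + \<theta> *\<^sub>R z)\<bar>)" by (rule sum_abs)
    also have "\<dots> \<le> (\<Sum>j\<in>UNIV. norm z * (C j * (2 powr N * decay N y)))"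
      unfolding abs_mult
      by (intro sum_mono mult_mono component_le_norm_cart order_trans[OF C(2)] mult_left_mono w C) auto
    also have "\<dots> = ((\<Sum>j\<in>UNIV. C j) * 2 powr N) * norm z * decay N y"
      by (simp only: sum_distrib_left sum_distrib_right mult_ac)
    finally show ?thesis .
  qed
  moreover have "(\<Sum>j\<in>UNIV. C j) * 2 powr N \<ge> 0" using C by (simp add: sum_nonneg)
  ultimately show thesis by (rule that[rotated])
qed

text \<open>Subtracting the linear part before applying the mean value theorem leaves increments of
  first partial derivatives, to which \<open>schwartz_lipschitz\<close> applies. The weight stays
  centred at y, so the remainder can be integrated against a kernel.\<close>

lemma schwartz_taylor:
  assumes \<phi>: "\<phi> \<in> (schwartz :: (real^'n \<Rightarrow> real) set)" and N: "N \<ge> 0"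
  obtains C where "C \<ge> 0"
    "\<And>y z. norm z \<le> 1 \<Longrightarrow> \<bar>\<phi> (y + z) - \<phi> y - (\<Sum>j\<in>UNIV. z $ j * partial j \<phi> y)\<bar>
        \<le> C * (norm z)\<^sup>2 * decay N y"
proof -
  have "\<forall>j. \<exists>C. C \<ge> 0 \<and> (\<forall>y z. norm z \<le> 1 \<longrightarrow> \<bar>partial j \<phi> (y + z) - partial j \<phi> y\<bar> \<le> C * norm z * decay N y)"
    using schwartz_lipschitz[OF schwartz_partial[OF \<phi>] N] by metis
  then obtain C where C: "\<And>j. C j \<ge> 0"
    "\<And>j y z. norm z \<le> 1 \<Longrightarrow> \<bar>partial j \<phi> (y + z) - partial j \<phi> y\<bar> \<le> C j * norm z * decay N y"
    by metis
  have "\<bar>\<phi> (y + z) - \<phi> y - (\<Sum>j\<in>UNIV. z $ j * partial j \<phi> y)\<bar> \<le> (\<Sum>j\<in>UNIV. C j) * (norm z)\<^sup>2 * decay N y"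
    if z: "norm z \<le> 1" for y z
  proof -
    let ?L = "\<Sum>j\<in>UNIV. z $ j * partial j \<phi> y"
    have der: "((\<lambda>\<tau>. \<phi> (y + \<tau> *\<^sub>R z) - \<tau> * ?L) has_real_derivative
        (\<Sum>j\<in>UNIV. z $ j * partial j \<phi> (y + \<tau> *\<^sub>R z)) - ?L) (at \<tau>)" for \<tau>
      using has_real_derivative_along_line[OF schwartz_differentiable[OF \<phi>]]
      by (auto intro!: derivative_eq_intros)
    obtain \<theta> where \<theta>: "0 < \<theta>" "\<theta> < 1"
      "(\<phi> (y + 1 *\<^sub>R z) - 1 * ?L) - (\<phi> (y + 0 *\<^sub>R z) - 0 * ?L)
        = (1 - 0) * ((\<Sum>j\<in>UNIV. z $ j * partial j \<phi> (y + \<theta> *\<^sub>R z)) - ?L)"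
      using MVT2[OF _ der, of 0 1] by auto
    have \<theta>z: "norm (\<theta> *\<^sub>R z) \<le> 1" "norm (\<theta> *\<^sub>R z) \<le> norm z"
      using \<theta> z by (auto simp: mult_le_one mult_left_le_one_le)
    have "\<phi> (y + z) - \<phi> y - ?L = (\<Sum>j\<in>UNIV. z $ j * (partial j \<phi> (y + \<theta> *\<^sub>R z) - partial j \<phi> y))"
      using \<theta>(3) by (simp add: right_diff_distrib sum_subtractf)
    also have "\<bar>\<dots>\<bar> \<le> (\<Sum>j\<in>UNIV. \<bar>z $ j * (partial j \<phi> (y + \<theta> *\<^sub>R z) - partial j \<phi> y)\<bar>)"
      by (rule sum_abs)
    also have "\<dots> \<le> (\<Sum>j\<in>UNIV. norm z * (C j * norm z * decay N y))"
      unfolding abs_mult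
      by (intro sum_mono mult_mono component_le_norm_cart order_trans[OF C(2)[OF \<theta>z(1)]]
           mult_right_mono mult_left_mono \<theta>z C) (auto simp: C)
    also have "\<dots> = (\<Sum>j\<in>UNIV. C j) * (norm z)\<^sup>2 * decay N y"
      by (simp only: sum_distrib_left sum_distrib_right mult_ac power2_eq_square)
    finally show ?thesis .
  qed
  moreover have "(\<Sum>j\<in>UNIV. C j) \<ge> 0" using C by (simp add: sum_nonneg)
  ultimately show thesis by (rule that[rotated])
qed

section \<open>Convolution with kernels of size |h|^(-p)\<close>

definition kernel_weight :: "real \<Rightarrow> real \<Rightarrow> real^'n \<Rightarrow> real^'n \<Rightarrow> real" where
  "kernel_weight p N x h = (1 + norm h powr (-p)) * decay N (x - h)"

definition conv :: "(real^'n \<Rightarrow> real) \<Rightarrow> (real^'n \<Rightarrow> real) \<Rightarrow> real^'n \<Rightarrow> real" where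
  "conv k \<phi> x = (LINT h|lborel. k h * \<phi> (x - h))"

context
  fixes p N :: real
  assumes p: "0 \<le> p" "p < real CARD('n::finite)" and N: "real CARD('n) < N"
begin

private abbreviation (input) "W \<equiv> (kernel_weight p N :: real^'n \<Rightarrow> real^'n \<Rightarrow> real)"

lemma kernel_weight_nonneg: "0 \<le> W x h"
  by (simp add: kernel_weight_def)

text \<open>\<open>W x\<close> is the common majorant of the convolution integrals below, and the
  bound on its integral is uniform in \<open>x\<close>. The summand \<open>1\<close> in it
  accommodates estimates that trade the kernel for a bounded factor.\<close>

lemma kernel_weight_integral:
  "integrable lborel (W x)"
  "\<exists>B\<ge>0. \<forall>x. (LINT h|lborel. W x h) \<le> B"
proof -
  define W1 :: "real^'n \<Rightarrow> real" where "W1 = (\<lambda>h. norm h powr (-p) * decay N h)"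
  define W2 :: "real^'n \<Rightarrow> real" where "W2 = (\<lambda>h. decay N h)"
  have W1: "integrable lborel W1"
    unfolding W1_def using p N by (intro integrable_norm_powr_weight) auto
  have W2: "integrable lborel W2"
    unfolding W2_def using N by (intro integrable_weight) auto
  have W2x: "integrable lborel (\<lambda>h. W2 (x - h))" "(LINT h|lborel. W2 (x - h)) = integral\<^sup>L lborel W2" for x
    using integrable_lborel_affine[OF W2, of "-1" x] integral_lborel_affine[of W2 "-1" x] W2 by auto
  have N0: "N \<ge> 0" using N by linarith
  have le: "W x h \<le> 2 powr N * W1 h + 2 * W2 (x - h)" for x h
  proof (cases "norm h \<le> 1")
    case True
    have "2 powr (-N) \<le> decay N h" using True N0 by (intro powr_mono2') (auto simp: add_pos_nonneg)
    then have "1 \<le> 2 powr N * decay N h" by (simp add: powr_minus field_simps)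
    then have "norm h powr (-p) * 1 \<le> norm h powr (-p) * (2 powr N * decay N h)"
      by (rule mult_left_mono) simp
    then have 1: "norm h powr (-p) \<le> 2 powr N * W1 h" by (simp add: W1_def mult_ac)
    have "decay N (x - h) \<le> 1" using N0 by (intro powr_nonpos_le_one) auto
    then have "norm h powr (-p) * decay N (x - h) \<le> norm h powr (-p) * 1"
      by (rule mult_left_mono) simp
    with 1 have 2: "norm h powr (-p) * decay N (x - h) \<le> 2 powr N * W1 h" by simp
    have "0 \<le> W2 (x - h)" by (simp add: W2_def)
    with 2 show ?thesis
      unfolding kernel_weight_def distrib_right mult_1 W2_def by linarith
  next
    case False
    then have "norm h powr (-p) \<le> 1" using p by (intro powr_nonpos_le_one) auto
    then have "(1 + norm h powr (-p)) * decay N (x - h) \<le> 2 * decay N (x - h)"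
      by (intro mult_right_mono) auto
    moreover have "0 \<le> 2 powr N * W1 h" by (simp add: W1_def)
    ultimately show ?thesis by (simp add: kernel_weight_def W2_def)
  qed
  have int: "integrable lborel (\<lambda>h. 2 powr N * W1 h + 2 * W2 (x - h))" for x
    using W1 W2x by simp
  show I: "integrable lborel (W x)" for x
  proof (rule Bochner_Integration.integrable_bound[OF int])
    show "W x \<in> borel_measurable lborel" unfolding kernel_weight_def[abs_def] by measurable
    show "AE h in lborel. norm (W x h) \<le> norm (2 powr N * W1 h + 2 * W2 (x - h))"
      using le[of x] kernel_weight_nonneg[of x] by (intro AE_I2) (simp add: abs_of_nonneg order_trans[OF _ le])
  qed
  have "(LINT h|lborel. W x h) \<le> 2 powr N * integral\<^sup>L lborel W1 + 2 * integral\<^sup>L lborel W2" for x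
  proof -
    have "(LINT h|lborel. W x h) \<le> (LINT h|lborel. 2 powr N * W1 h + 2 * W2 (x - h))"
      by (rule integral_mono[OF I int le])
    also have "\<dots> = 2 powr N * integral\<^sup>L lborel W1 + 2 * integral\<^sup>L lborel W2"
      using W1 W2x by simp
    finally show ?thesis .
  qed
  moreover have "0 \<le> 2 powr N * integral\<^sup>L lborel W1 + 2 * integral\<^sup>L lborel W2"
    by (simp add: W1_def W2_def)
  ultimately show "\<exists>B\<ge>0. \<forall>x. (LINT h|lborel. W x h) \<le> B" by blast
qed

lemma integral_le_kernel_weight:
  assumes B: "\<And>x. (LINT h|lborel. W x h) \<le> B"
    and f: "\<And>h. \<bar>f h\<bar> \<le> a * W x h" and a: "a \<ge> 0"
  shows "\<bar>LINT h|lborel. f h\<bar> \<le> a * B"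
proof -
  have I: "integrable lborel (\<lambda>h. a * W x h)"
    using kernel_weight_integral(1) by simp
  \<comment> \<open>A non-integrable \<open>f\<close> has integral \<open>0\<close> by convention,
    so that case only asks for a nonnegative right-hand side.\<close>
  have "\<bar>LINT h|lborel. f h\<bar> \<le> (LINT h|lborel. a * W x h)"
    using integral_abs_bound_integral[OF _ I] f
    by (cases "integrable lborel f") (auto simp: not_integrable_integral_eq a kernel_weight_nonneg
      intro!: mult_nonneg_nonneg Bochner_Integration.integral_nonneg)
  also have "\<dots> = a * (LINT h|lborel. W x h)" by simp
  also have "\<dots> \<le> a * B" by (intro mult_left_mono B a)
  finally show ?thesis .
qed

text \<open>If |h| \<ge> |x|/2, the mean value theorem on [|x|/2, \<infinity>) gains the factor
  |x|^(-p-1) at the price of |x - h|. Otherwise |x - h| \<ge> |x|/2, and the power of 1 + |x - h|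
  pays for everything; in the application it is absorbed by the decay of a Schwartz function. The
  base 4 comes from 1 + |x| \<le> 2 |x| = 4 l in the first case, and p + 1 covers both the factor p
  of the derivative and the factor 1 of the second case.\<close>

lemma kernel_difference_le:
  assumes x: "norm x \<ge> 1" and h: "h \<noteq> 0"
  shows "(1 + norm x) powr (p + 1) * \<bar>norm h powr (-p) - norm x powr (-p)\<bar>
    \<le> ((p + 1) * 4 powr (p + 1)) * (1 + norm (x - h)) powr (p + 1) * (1 + norm h powr (-p))"
proof (cases "norm h \<ge> norm x / 2")
  case True
  define l where "l = norm x / 2"
  have l: "l > 0" "l \<le> norm h" "l \<le> norm x" using x True by (auto simp: l_def)
  let ?S = "{l..}"
  have "norm (norm h powr (-p) - norm x powr (-p)) \<le> (p * l powr (-p-1)) * norm (norm h - norm x)"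
  proof (rule field_differentiable_bound[where S="?S" and f'="\<lambda>z. (-p) * z powr (-p-1)"])
    fix z assume z: "z \<in> ?S"
    then show "((\<lambda>a. a powr (-p)) has_field_derivative (-p) * z powr (-p-1)) (at z within ?S)"
      using l by (intro has_real_derivative_powr[THEN has_field_derivative_at_within]) auto
    have "z powr (-p-1) \<le> l powr (-p-1)" using z l p by (intro powr_mono2') auto
    then show "norm ((-p) * z powr (-p-1)) \<le> p * l powr (-p-1)"
      using p by (simp add: abs_mult mult_left_mono)
  qed (use l in auto)
  also have "\<dots> \<le> (p * l powr (-p-1)) * (1 + norm (x - h))"
    using p norm_triangle_ineq3[of h x] by (intro mult_left_mono) (auto simp: norm_minus_commute)
  finally have 1: "\<bar>norm h powr (-p) - norm x powr (-p)\<bar> \<le> p * l powr (-p-1) * (1 + norm (x - h))" by simp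
  have "(1 + norm x) powr (p + 1) \<le> (4 * l) powr (p + 1)"
    using x p by (intro powr_mono2) (auto simp: l_def)
  then have 2: "(1 + norm x) powr (p + 1) \<le> 4 powr (p + 1) * l powr (p + 1)"
    by (simp add: powr_mult)
  have ll: "l powr (p + 1) * l powr (-p-1) = 1" using l by (simp add: powr_add[symmetric])
  have "(1 + norm x) powr (p + 1) * \<bar>norm h powr (-p) - norm x powr (-p)\<bar>
     \<le> (4 powr (p + 1) * l powr (p + 1)) * (p * l powr (-p-1) * (1 + norm (x - h)))"
    using p by (intro mult_mono 1 2) auto
  also have "\<dots> = (l powr (p + 1) * l powr (-p-1)) * (p * 4 powr (p + 1) * (1 + norm (x - h)) powr 1)"
    by (simp add: mult_ac add_nonneg_nonneg)
  also have "\<dots> \<le> 1 * (((p + 1) * 4 powr (p + 1)) * (1 + norm (x - h)) powr (p + 1))"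
    unfolding ll using p by (intro mult_mono powr_mono) auto
  also have "\<dots> \<le> (((p + 1) * 4 powr (p + 1)) * (1 + norm (x - h)) powr (p + 1)) * (1 + norm h powr (-p))"
    using mult_left_mono[of 1 "1 + norm h powr (-p)" "((p + 1) * 4 powr (p + 1)) * (1 + norm (x - h)) powr (p + 1)"] p
    by simp
  finally show ?thesis .
next
  case False
  then have hx: "norm h < norm x / 2" "norm h \<le> norm x" using norm_ge_zero[of x] by linarith+
  have "norm x / 2 \<le> norm (x - h)" using norm_triangle_ineq2[of x h] hx by linarith
  then have "1 + norm x \<le> 4 * (1 + norm (x - h))" using norm_ge_zero[of "x - h"] unfolding distrib_left by linarith
  then have 1: "(1 + norm x) powr (p + 1) \<le> (4 * (1 + norm (x - h))) powr (p + 1)"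
    using p by (intro powr_mono2) auto
  have "norm x powr (-p) \<le> norm h powr (-p)" using hx h p by (intro powr_mono2') auto
  then have 2: "\<bar>norm h powr (-p) - norm x powr (-p)\<bar> \<le> 1 + norm h powr (-p)"
    by (simp add: abs_le_iff add_increasing)
  have "(1 + norm x) powr (p + 1) * \<bar>norm h powr (-p) - norm x powr (-p)\<bar>
    \<le> (4 powr (p + 1) * (1 + norm (x - h)) powr (p + 1)) * (1 + norm h powr (-p))"
    using 1[unfolded powr_mult] 2 by (intro mult_mono) simp_all
  also have "\<dots> \<le> (((p + 1) * 4 powr (p + 1)) * (1 + norm (x - h)) powr (p + 1)) * (1 + norm h powr (-p))"
    using p mult_right_mono[of 1 "p + 1" "4 powr (p + 1)"] by (intro mult_right_mono) auto
  finally show ?thesis .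
qed

context
  fixes k :: "real^'n \<Rightarrow> real" and \<kappa> :: real
  assumes k_meas: "k \<in> borel_measurable borel"
    and k_le: "\<And>h. \<bar>k h\<bar> \<le> \<kappa> * norm h powr (-p)" and \<kappa>: "\<kappa> \<ge> 0"
begin

lemma conv_bound_weight:
  assumes "\<bar>b\<bar> \<le> C * decay N (x - h)" "C \<ge> 0"
  shows "\<bar>k h * b\<bar> \<le> (\<kappa> * C) * W x h"
proof -
  have "\<bar>k h\<bar> * \<bar>b\<bar> \<le> (\<kappa> * (1 + norm h powr (-p))) * (C * decay N (x - h))"
    using assms \<kappa> by (intro mult_mono order_trans[OF k_le] mult_left_mono) auto
  then show ?thesis by (simp only: abs_mult kernel_weight_def mult_ac)
qed

lemma conv_integrable:
  assumes \<phi>: "\<phi> \<in> schwartz"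
  shows "integrable lborel (\<lambda>h. k h * \<phi> (x - h))"
proof -
  obtain C where C: "C \<ge> 0" "\<And>x. \<bar>\<phi> x\<bar> \<le> C * decay N x"
    using schwartz_decay[OF \<phi>, where M="N"] by blast
  have [measurable]: "\<phi> \<in> borel_measurable borel" "k \<in> borel_measurable borel"
    by (rule schwartz_measurable[OF \<phi>], rule k_meas)
  show ?thesis
  proof (rule Bochner_Integration.integrable_bound)
    show "integrable lborel (\<lambda>h. (\<kappa> * C) * W x h)"
      using kernel_weight_integral(1) by simp
    show "AE h in lborel. norm (k h * \<phi> (x - h)) \<le> norm ((\<kappa> * C) * W x h)"
      using conv_bound_weight[OF C(2) C(1)] \<kappa> C kernel_weight_nonneg
      by (intro AE_I2) (simp add: abs_of_nonneg)
  qed measurable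
qed

text \<open>All differentiation falls on \<phi>: its quadratic Taylor remainder, integrated against
  the kernel, is of order |z|^2. The kernel may therefore jump, as the truncated one does.\<close>

lemma conv_has_derivative:
  assumes \<phi>: "\<phi> \<in> schwartz"
  shows "(conv k \<phi> has_derivative (\<lambda>z. \<Sum>j\<in>UNIV. z $ j * conv k (partial j \<phi>) x)) (at x)"
  unfolding has_derivative_at_alt
proof (intro conjI allI impI)
  show "bounded_linear (\<lambda>z. \<Sum>j\<in>UNIV. z $ j * conv k (partial j \<phi>) x)"
    by (intro bounded_linear_sum bounded_linear_mult_const bounded_linear_vec_nth)
next
  fix e :: real assume e: "e > 0"
  have N0: "N \<ge> 0" using N by linarith
  obtain C where C: "C \<ge> 0"
    "\<And>y z. norm z \<le> 1 \<Longrightarrow> \<bar>\<phi> (y + z) - \<phi> y - (\<Sum>j\<in>UNIV. z $ j * partial j \<phi> y)\<bar>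
        \<le> C * (norm z)\<^sup>2 * decay N y"
    using schwartz_taylor[OF \<phi> N0] by blast
  obtain B where B: "B \<ge> 0" "\<And>x. (LINT h|lborel. W x h) \<le> B"
    using kernel_weight_integral(2) by blast
  define D where "D = \<kappa> * C * B"
  have D: "D \<ge> 0" using \<kappa> C B by (simp add: D_def)
  have est: "\<bar>conv k \<phi> (x + z) - conv k \<phi> x - (\<Sum>j\<in>UNIV. z $ j * conv k (partial j \<phi>) x)\<bar> \<le> D * (norm z)\<^sup>2"
    if z: "norm z \<le> 1" for z
  proof -
    have i: "integrable lborel (\<lambda>h. k h * partial j \<phi> (x - h))" for j
      by (rule conv_integrable[OF schwartz_partial[OF \<phi>]])
    have "conv k \<phi> (x + z) - conv k \<phi> x - (\<Sum>j\<in>UNIV. z $ j * conv k (partial j \<phi>) x)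
      = (LINT h|lborel. k h * \<phi> (x + z - h) - k h * \<phi> (x - h) - (\<Sum>j\<in>UNIV. z $ j * (k h * partial j \<phi> (x - h))))"
      unfolding conv_def using conv_integrable[OF \<phi>] i
      by (simp add: Bochner_Integration.integral_sum)
    also have "\<dots> = (LINT h|lborel. k h * (\<phi> ((x - h) + z) - \<phi> (x - h) - (\<Sum>j\<in>UNIV. z $ j * partial j \<phi> (x - h))))"
      by (intro Bochner_Integration.integral_cong refl) (simp add: algebra_simps sum_distrib_left)
    also have "\<bar>\<dots>\<bar> \<le> (\<kappa> * (C * (norm z)\<^sup>2)) * B"
      by (rule integral_le_kernel_weight[OF B(2) conv_bound_weight]) (use C z \<kappa> in auto)
    finally show ?thesis by (simp only: D_def mult_ac)
  qed
  show "\<exists>d>0. \<forall>y. norm (y - x) < d \<longrightarrow> norm (conv k \<phi> y - conv k \<phi> x - (\<Sum>j\<in>UNIV. (y - x) $ j * conv k (partial j \<phi>) x)) \<le> e * norm (y - x)"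
  proof (intro exI conjI allI impI)
    show "min 1 (e / (D + 1)) > 0" using e D by simp
    fix y assume y: "norm (y - x) < min 1 (e / (D + 1))"
    have "D * norm (y - x) \<le> (D + 1) * norm (y - x)" by (intro mult_right_mono) auto
    also have "\<dots> \<le> e" using y D by (simp add: field_simps)
    finally have "D * norm (y - x) * norm (y - x) \<le> e * norm (y - x)" by (intro mult_right_mono) auto
    with est[of "y - x"] y show "norm (conv k \<phi> y - conv k \<phi> x - (\<Sum>j\<in>UNIV. (y - x) $ j * conv k (partial j \<phi>) x)) \<le> e * norm (y - x)"
      by (simp add: power2_eq_square mult.assoc)
  qed
qed

lemma conv_differentiable: "\<phi> \<in> schwartz \<Longrightarrow> conv k \<phi> differentiable (at x)"
  by (rule differentiableI[OF conv_has_derivative])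

lemma partial_conv: "\<phi> \<in> schwartz \<Longrightarrow> partial j (conv k \<phi>) x = conv k (partial j \<phi>) x"
  using partial_eqI[OF conv_has_derivative] by (simp add: axis_component if_distrib[of "\<lambda>c. c * _"] cong: if_cong)

text \<open>Shifting the weight from x - h to x costs (1 + |h|)^p, and the kernel compensates
  exactly this growth at infinity.\<close>

lemma conv_decay:
  assumes \<phi>: "\<phi> \<in> schwartz"
  shows "\<exists>C\<ge>0. \<forall>x. \<bar>conv k \<phi> x\<bar> \<le> C * decay p x"
proof -
  obtain C where C: "C \<ge> 0" "\<And>x. \<bar>\<phi> x\<bar> \<le> C * decay (N+p) x"
    using schwartz_decay[OF \<phi>, where M="(N+p)"] by blast
  obtain B where B: "B \<ge> 0" "\<And>x. (LINT h|lborel. W x h) \<le> B"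
    using kernel_weight_integral(2) by blast
  have le: "\<bar>k h * \<phi> (x - h)\<bar> \<le> (\<kappa> * C * 2 powr p * decay p x) * W x h" for x h
  proof (cases "h = 0")
    case True
    \<comment> \<open>Since \<open>0 powr (-p) = 0\<close>, the bound on the kernel forces
      \<open>k 0 = 0\<close>.\<close>
    then have "k h = 0" using k_le[of 0] by simp
    then show ?thesis using \<kappa> C by (simp add: kernel_weight_nonneg)
  next
    case False
    have "decay p (x - h) \<le> (1 + norm h) powr p * decay p x"
      using weight_shift_le[OF p(1), of x "-h"] by simp
    also have "(1 + norm h) powr p \<le> (2 * max 1 (norm h)) powr p"
      using p by (intro powr_mono2) auto
    finally have 1: "decay p (x - h) \<le> 2 powr p * max 1 (norm h) powr p * decay p x"
      by (simp add: powr_mult mult_right_mono)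
    have 2: "norm h powr (-p) * max 1 (norm h) powr p \<le> 1 + norm h powr (-p)"
      using False by (auto simp: max_def powr_minus)
    have "\<bar>\<phi> (x - h)\<bar> \<le> C * (decay N (x - h) * decay p (x - h))"
      using C(2)[of "x - h"] by (simp add: powr_add[symmetric])
    also have "\<dots> \<le> C * (decay N (x - h) * (2 powr p * max 1 (norm h) powr p * decay p x))"
      by (intro mult_left_mono 1 C) auto
    finally have "\<bar>k h\<bar> * \<bar>\<phi> (x - h)\<bar> \<le> (\<kappa> * norm h powr (-p)) *
       (C * (decay N (x - h) * (2 powr p * max 1 (norm h) powr p * decay p x)))"
      using \<kappa> by (intro mult_mono k_le) auto
    also have "\<dots> = (\<kappa> * C * 2 powr p * decay p x) *
      ((norm h powr (-p) * max 1 (norm h) powr p) * decay N (x - h))"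
      by (simp only: mult_ac)
    also have "\<dots> \<le> (\<kappa> * C * 2 powr p * decay p x) * ((1 + norm h powr (-p)) * decay N (x - h))"
      using \<kappa> C by (intro mult_left_mono mult_right_mono 2) auto
    finally show ?thesis by (simp only: kernel_weight_def abs_mult)
  qed
  have "\<bar>conv k \<phi> x\<bar> \<le> (\<kappa> * C * 2 powr p * decay p x) * B" for x
    unfolding conv_def by (rule integral_le_kernel_weight[OF B(2) le]) (use \<kappa> C in auto)
  then have "\<bar>conv k \<phi> x\<bar> \<le> (\<kappa> * C * 2 powr p * B) * decay p x" for x
    by (simp only: mult_ac)
  then show ?thesis using \<kappa> C B by (intro exI[of _ "\<kappa> * C * 2 powr p * B"]) auto
qed

text \<open>Meant for the truncated kernels: on a bounded support the shift of the weight costs only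
  a constant, so arbitrary decay of \<phi> survives.\<close>

lemma conv_compact_decay:
  assumes \<phi>: "\<phi> \<in> schwartz" and supp: "\<And>h. k h \<noteq> 0 \<Longrightarrow> norm h \<le> R" and q: "q \<ge> 0"
  shows "\<exists>C\<ge>0. \<forall>x. \<bar>conv k \<phi> x\<bar> \<le> C * decay q x"
proof -
  obtain C where C: "C \<ge> 0" "\<And>x. \<bar>\<phi> x\<bar> \<le> C * decay (N+q) x"
    using schwartz_decay[OF \<phi>, where M="(N+q)"] by blast
  obtain B where B: "B \<ge> 0" "\<And>x. (LINT h|lborel. W x h) \<le> B"
    using kernel_weight_integral(2) by blast
  have le: "\<bar>k h * \<phi> (x - h)\<bar> \<le> (\<kappa> * (C * (1 + \<bar>R\<bar>) powr q * decay q x)) * W x h" for x h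
  proof (cases "k h = 0")
    case True
    then show ?thesis using \<kappa> C by (simp add: kernel_weight_nonneg)
  next
    case False
    have "decay q (x - h) \<le> (1 + norm h) powr q * decay q x"
      using weight_shift_le[OF q, of x "-h"] by simp
    also have "\<dots> \<le> (1 + \<bar>R\<bar>) powr q * decay q x"
      using q supp[OF False] by (intro mult_right_mono powr_mono2) auto
    finally have 1: "decay q (x - h) \<le> (1 + \<bar>R\<bar>) powr q * decay q x" .
    have "\<bar>\<phi> (x - h)\<bar> \<le> C * (decay q (x - h) * decay N (x - h))"
      using C(2)[of "x - h"] by (simp add: powr_add[symmetric] add.commute)
    also have "\<dots> \<le> C * (((1 + \<bar>R\<bar>) powr q * decay q x) * decay N (x - h))"
      by (intro mult_left_mono mult_right_mono 1 C) auto
    finally show ?thesis using C by (intro conv_bound_weight) (simp_all only: mult_ac, auto)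
  qed
  have "\<bar>conv k \<phi> x\<bar> \<le> (\<kappa> * (C * (1 + \<bar>R\<bar>) powr q * decay q x)) * B" for x
    unfolding conv_def by (rule integral_le_kernel_weight[OF B(2) le]) (use \<kappa> C in auto)
  then have "\<bar>conv k \<phi> x\<bar> \<le> (\<kappa> * C * (1 + \<bar>R\<bar>) powr q * B) * decay q x" for x
    by (simp only: mult_ac)
  then show ?thesis using \<kappa> C B by (intro exI[of _ "\<kappa> * C * (1 + \<bar>R\<bar>) powr q * B"]) auto
qed

text \<open>The gain of one order over \<open>conv_decay\<close> comes from subtracting the constant \<open>k x\<close> from the
  kernel, which is free because \<open>f\<close> has mean zero.\<close>

lemma conv_mean_zero_decay:
  assumes f: "f \<in> schwartz" and mean: "(LINT y|lborel. f y) = 0"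
    and k: "\<And>h. k h = c * norm h powr (-p)"
  shows "\<exists>C\<ge>0. \<forall>x. \<bar>conv k f x\<bar> \<le> C * decay (p+1) x"
proof -
  obtain C where C: "C \<ge> 0" "\<And>x. \<bar>f x\<bar> \<le> C * decay (N+p+1) x"
    using schwartz_decay[OF f, where M="(N+p+1)"] by blast
  obtain C0 where C0: "C0 \<ge> 0" "\<And>x. \<bar>conv k f x\<bar> \<le> C0 * decay p x"
    using conv_decay[OF f] by blast
  obtain B where B: "B \<ge> 0" "\<And>x. (LINT h|lborel. W x h) \<le> B"
    using kernel_weight_integral(2) by blast
  define M where "M = \<bar>c\<bar> * C * ((p + 1) * 4 powr (p + 1))"
  have M: "M \<ge> 0" using C p by (simp add: M_def)
  have fint: "integrable lborel f"
  proof (rule Bochner_Integration.integrable_bound)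
    show "integrable lborel (\<lambda>x::real^'n. C * decay (N+p+1) x)"
      using integrable_weight[of "N+p+1", where 'a="real^'n"] p N by simp
  qed (use C schwartz_measurable[OF f] in auto)
  have fx: "integrable lborel (\<lambda>h. f (x - h))" "(LINT h|lborel. f (x - h)) = 0" for x
    using integrable_lborel_affine[OF fint, of "-1" x] integral_lborel_affine[of f "-1" x]
      schwartz_measurable[OF f] mean by auto
  have big: "\<bar>conv k f x\<bar> \<le> M * B * decay (p+1) x" if x: "norm x \<ge> 1" for x
  proof -
    have "conv k f x = (LINT h|lborel. k h * f (x - h) - k x * f (x - h))"
      unfolding conv_def using conv_integrable[OF f, of x] fx[of x] by simp
    \<comment> \<open>The indicator discards the null set {0}, so that the pointwise bound can be
      proved for every \<open>h\<close>, while \<open>kernel_difference_le\<close> is applied only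
      where \<open>h \<noteq> 0\<close>.\<close>
    also have "\<dots> = (LINT h|lborel. (k h - k x) * f (x - h) * indicator (- {0}) h)"
    proof (rule integral_cong_AE)
      show "AE h in lborel. k h * f (x - h) - k x * f (x - h) = (k h - k x) * f (x - h) * indicator (- {0}) h"
        using AE_lborel_singleton[of "0::real^'n"] by eventually_elim (simp add: left_diff_distrib)
    qed (use k_meas schwartz_measurable[OF f] in measurable)
    also have "\<bar>\<dots>\<bar> \<le> (M * decay (p+1) x) * B"
    proof (rule integral_le_kernel_weight[OF B(2)])
      show "0 \<le> M * decay (p+1) x" using M by simp
      fix h
      show "\<bar>(k h - k x) * f (x - h) * indicator (- {0}) h\<bar> \<le> (M * decay (p+1) x) * W x h"
      proof (cases "h = 0")
        case True
        then show ?thesis using M by (simp add: kernel_weight_nonneg)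
      next
        case False
        let ?a = "decay (p+1) x" and ?b = "decay N (x - h)"
        have pp: "1 + norm x > 0" "1 + norm (x - h) > 0" by (simp_all add: add_pos_nonneg)
        have a: "?a * (1 + norm x) powr (p+1) = 1" using pp by (simp add: powr_add[symmetric])
        have "\<bar>k h - k x\<bar> = \<bar>c\<bar> * (?a * ((1 + norm x) powr (p+1) * \<bar>norm h powr (-p) - norm x powr (-p)\<bar>))"
          unfolding k mult.assoc[symmetric] a by (simp add: abs_mult flip: right_diff_distrib)
        also have "\<dots> \<le> \<bar>c\<bar> * (?a * (((p + 1) * 4 powr (p + 1)) * (1 + norm (x - h)) powr (p + 1) * (1 + norm h powr (-p))))"
          by (intro mult_left_mono kernel_difference_le x False) auto
        finally have "\<bar>k h - k x\<bar> * \<bar>f (x - h)\<bar>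
           \<le> (\<bar>c\<bar> * (?a * (((p + 1) * 4 powr (p + 1)) * (1 + norm (x - h)) powr (p + 1) * (1 + norm h powr (-p)))))
             * (C * decay (N+p+1) (x - h))"
          using p by (intro mult_mono C) auto
        also have "\<dots> = (M * ?a) * ((1 + norm h powr (-p)) * ((1 + norm (x - h)) powr (p + 1) * decay (N+p+1) (x - h)))"
          by (simp only: M_def mult_ac)
        also have "(1 + norm (x - h)) powr (p + 1) * decay (N+p+1) (x - h) = ?b"
          by (subst powr_add[symmetric]) simp
        finally show ?thesis using False by (simp add: kernel_weight_def abs_mult)
      qed
    qed
    finally show ?thesis by (simp only: mult_ac)
  qed
  \<comment> \<open>On the unit ball the weights of order p and p + 1 are comparable, so
    \<open>conv_decay\<close> suffices.\<close>
  have small: "\<bar>conv k f x\<bar> \<le> 2 * C0 * decay (p+1) x" if x: "norm x < 1" for x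
  proof -
    have "decay p x = decay (p+1) x * (1 + norm x) powr 1"
      by (subst powr_add[symmetric]) simp
    also have "\<dots> \<le> decay (p+1) x * 2" using x by (intro mult_left_mono) auto
    finally have "C0 * decay p x \<le> C0 * (decay (p+1) x * 2)"
      by (intro mult_left_mono C0)
    with C0(2)[of x] show ?thesis by (simp add: mult_ac)
  qed
  have "\<bar>conv k f x\<bar> \<le> (M * B + 2 * C0) * decay (p+1) x" for x
  proof (cases "norm x \<ge> 1")
    case True
    show ?thesis by (rule order_trans[OF big[OF True]]) (use C0 in \<open>intro mult_right_mono; simp\<close>)
  next
    case False
    then show ?thesis using M B by (intro order_trans[OF small] mult_right_mono) auto
  qed
  then show ?thesis using M B C0 by (intro exI[of _ "M * B + 2 * C0"]) auto
qed

end

end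

lemma integral_partial_schwartz:
  assumes \<phi>: "\<phi> \<in> (schwartz :: (real^'n \<Rightarrow> real) set)"
  shows "(LINT x|lborel. partial j \<phi> x) = 0"
proof -
  let ?q = "real CARD('n) + 1"
  obtain C1 where C1: "C1 \<ge> 0" "\<And>x. \<bar>\<phi> x\<bar> \<le> C1 * decay ?q x"
    using schwartz_decay[OF \<phi>, where M="?q"] by blast
  obtain C2 where C2: "C2 \<ge> 0" "\<And>x. \<bar>partial j \<phi> x\<bar> \<le> C2 * decay ?q x"
    using schwartz_decay[OF schwartz_partial[OF \<phi>], where M="?q"] by blast
  show ?thesis
  proof (rule integral_partial_eq_0_integrable[where C="C1 + C2" and p="?q"])
    show "\<bar>\<phi> x\<bar> \<le> (C1 + C2) * decay ?q x" for x
      by (rule order_trans[OF C1(2)], rule mult_right_mono) (use C2 in auto)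
    show "\<bar>partial j \<phi> x\<bar> \<le> (C1 + C2) * decay ?q x" for x
      by (rule order_trans[OF C2(2)], rule mult_right_mono) (use C1 in auto)
  qed (auto simp: schwartz_differentiable[OF \<phi>])
qed

section \<open>The fractional equation\<close>

text \<open>At the origin the potential need not be differentiable, and
  \<open>frechet_derivative\<close> is then an unspecified choice. The fields are therefore
  identified with the explicit ones elsewhere, and one value cannot spoil measurability.\<close>

lemma measurable_except_0:
  fixes f g :: "real^'n \<Rightarrow> real"
  assumes [measurable]: "g \<in> borel_measurable borel" and "\<And>x. x \<noteq> 0 \<Longrightarrow> f x = g x"
  shows "f \<in> borel_measurable borel"
proof -
  have "f = (\<lambda>x. if x = 0 then f 0 else g x)" using assms(2) by auto
  also have "\<dots> \<in> borel_measurable borel" by measurable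
  finally show ?thesis .
qed

lemma dist_of_fun_lborel:
  assumes "f \<in> borel_measurable borel" "\<phi> \<in> borel_measurable borel"
  shows "dist_of_fun f \<phi> = (LINT x|lborel. f x * \<phi> x)"
  unfolding dist_of_fun_def using assms by (subst integral_completion) auto

lemma dist_of_fun_cong:
  assumes "g \<in> borel_measurable borel" "\<phi> \<in> borel_measurable borel"
    and eq: "\<And>x. x \<noteq> 0 \<Longrightarrow> f x = c * g x"
  shows "dist_of_fun f \<phi> = c * (LINT x|lborel. g x * \<phi> x)"
proof -
  have f: "f \<in> borel_measurable borel"
    by (rule measurable_except_0[OF _ eq]) (use assms(1) in measurable)
  have "dist_of_fun f \<phi> = (LINT x|lborel. f x * \<phi> x)"
    by (rule dist_of_fun_lborel[OF f assms(2)])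
  also have "\<dots> = (LINT x|lborel. c * (g x * \<phi> x))"
  proof (rule integral_cong_AE)
    show "AE x in lborel. f x * \<phi> x = c * (g x * \<phi> x)"
      using AE_lborel_singleton[of "0::real^'a"] by eventually_elim (simp add: eq)
  qed (use f assms in measurable)
  finally show ?thesis by simp
qed

section \<open>Tempered functions with a singularity at the origin\<close>

lemma finite_index_lists: "finite {js :: 'n::finite list. length js \<le> N}"
  using finite_lists_length_le[of "UNIV :: 'n set" N] by simp

text \<open>A weight of order \<open>N\<close> has to outweigh |x|^(-\<sigma>) at infinity, which
  determines \<open>N\<close>; \<sigma> may be negative, as it is for \<open>v_fun\<close> when
  \<delta> < 1. Continuity then follows from the single seminorm \<open>S \<phi> []\<close>, one of
  the summands in the required bound.\<close>

lemma tempered_funI: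
  fixes f :: "real^'n \<Rightarrow> real"
  assumes f: "f \<in> borel_measurable borel"
    and le: "\<And>x. x \<noteq> 0 \<Longrightarrow> \<bar>f x\<bar> \<le> A * norm x powr (-\<sigma>)" and A: "A \<ge> 0"
    and \<sigma>: "\<sigma> < real CARD('n)"
  shows "tempered_fun f"
proof -
  define N where "N = nat \<lceil>real CARD('n) - \<sigma>\<rceil> + 1"
  have "real CARD('n) < \<sigma> + real N" unfolding N_def by linarith
  then have W: "integrable lborel (\<lambda>x::real^'n. norm x powr (-\<sigma>) * decay (real N) x)"
    using \<sigma> by (intro integrable_norm_powr_weight) auto
  define B where "B = (LINT x::real^'n|lborel. norm x powr (-\<sigma>) * decay (real N) x)"
  define S where "S \<phi> js = (SUP x. (1 + norm x) ^ N * \<bar>partials js \<phi> x\<bar>)" for \<phi> :: "real^'n \<Rightarrow> real" and js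
  have S0: "0 \<le> S \<phi> js" if "\<phi> \<in> schwartz" for \<phi> js
    by (rule order_trans[OF _ schwartz_le_SUP[OF that, of 0 N js, folded S_def]]) simp
  have ptw: "AE x in lborel. norm (f x * \<phi> x) \<le> A * S \<phi> [] * (norm x powr (-\<sigma>) * decay (real N) x)"
    if \<phi>: "\<phi> \<in> schwartz" for \<phi>
    using AE_lborel_singleton[of "0::real^'n"]
  proof eventually_elim
    case (elim x)
    have p: "1 + norm x > 0" by (simp add: add_pos_nonneg)
    have "\<bar>\<phi> x\<bar> = ((1 + norm x) ^ N * \<bar>\<phi> x\<bar>) * decay (real N) x"
      using p by (simp add: powr_minus powr_realpow)
    also have "\<dots> \<le> S \<phi> [] * decay (real N) x"
      using schwartz_le_SUP[OF \<phi>, of x N "[]"] by (intro mult_right_mono) (simp_all add: S_def)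
    finally have "\<bar>f x\<bar> * \<bar>\<phi> x\<bar> \<le> (A * norm x powr (-\<sigma>)) * (S \<phi> [] * decay (real N) x)"
      using A by (intro mult_mono le elim) auto
    then show ?case by (simp only: real_norm_def abs_mult mult_ac)
  qed
  have meas: "(\<lambda>x. f x * \<phi> x) \<in> borel_measurable borel" if "\<phi> \<in> schwartz" for \<phi>
    using f schwartz_measurable[OF that] by measurable
  have W': "integrable lborel (\<lambda>x::real^'n. A * S \<phi> [] * (norm x powr (-\<sigma>) * decay (real N) x))" for \<phi>
    using W by (rule integrable_mult_right)
  have int: "integrable lborel (\<lambda>x. f x * \<phi> x)" if \<phi>: "\<phi> \<in> schwartz" for \<phi>
    by (rule Bochner_Integration.integrable_bound[OF W'[of \<phi>]])
       (use meas[OF \<phi>] ptw[OF \<phi>] A S0[OF \<phi>, of "[]"] in \<open>simp_all add: abs_of_nonneg mult_nonneg_nonneg\<close>)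
  have int': "integrable lebesgue (\<lambda>x. f x * \<phi> x)" if \<phi>: "\<phi> \<in> schwartz" for \<phi>
    using int[OF \<phi>] meas[OF \<phi>] by (subst integrable_completion) auto
  have "\<bar>dist_of_fun f \<phi>\<bar> \<le> (A * B) * (\<Sum>js | length js \<le> N. S \<phi> js)" if \<phi>: "\<phi> \<in> schwartz" for \<phi>
  proof -
    have "\<bar>dist_of_fun f \<phi>\<bar> = norm (LINT x|lborel. f x * \<phi> x)"
      by (simp add: dist_of_fun_lborel f schwartz_measurable[OF \<phi>])
    also have "\<dots> \<le> (LINT x|lborel. norm (f x * \<phi> x))" by (rule integral_norm_bound)
    also have "\<dots> \<le> (LINT x::real^'n|lborel. A * S \<phi> [] * (norm x powr (-\<sigma>) * decay (real N) x))"
      by (rule integral_mono_AE[OF integrable_norm[OF int[OF \<phi>]] W' ptw[OF \<phi>]])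
    also have "\<dots> = (A * B) * S \<phi> []" by (simp add: B_def)
    also have "\<dots> \<le> (A * B) * (\<Sum>js | length js \<le> N. S \<phi> js)"
      by (intro mult_left_mono member_le_sum) (auto simp: S0[OF \<phi>] finite_index_lists A B_def)
    finally show ?thesis .
  qed
  moreover have "dist_of_fun f (\<lambda>x. \<phi> x + \<psi> x) = dist_of_fun f \<phi> + dist_of_fun f \<psi>"
    if "\<phi> \<in> schwartz" "\<psi> \<in> schwartz" for \<phi> \<psi>
    using int'[OF that(1)] int'[OF that(2)] by (simp add: dist_of_fun_def distrib_left)
  moreover have "dist_of_fun f (\<lambda>x. c * \<phi> x) = c * dist_of_fun f \<phi>" for c \<phi>
    by (simp add: dist_of_fun_def mult.left_commute[of _ c])
  ultimately have "tempered_distribution (dist_of_fun f)"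
    unfolding tempered_distribution_def S_def by blast
  with int' show ?thesis by (simp add: tempered_fun_def)
qed

lemma tempered_fun_cmult:
  fixes f g :: "real^'n \<Rightarrow> real"
  assumes g: "g \<in> borel_measurable borel" and eq: "\<And>x. x \<noteq> 0 \<Longrightarrow> f x = c * g x"
    and le: "\<And>x. x \<noteq> 0 \<Longrightarrow> \<bar>g x\<bar> \<le> A * norm x powr (-\<sigma>)" and A: "A \<ge> 0"
    and \<sigma>: "\<sigma> < real CARD('n)"
  shows "tempered_fun f"
proof (rule tempered_funI[where A="\<bar>c\<bar> * A" and \<sigma>=\<sigma>])
  show "f \<in> borel_measurable borel"
    by (rule measurable_except_0[OF _ eq]) (use g in measurable)
  show "\<bar>f x\<bar> \<le> \<bar>c\<bar> * A * norm x powr (-\<sigma>)" if "x \<noteq> 0" for x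
    using mult_left_mono[OF le[OF that], of "\<bar>c\<bar>"] by (simp add: eq[OF that] abs_mult mult.assoc)
qed (use A \<sigma> in auto)

text \<open>Enough decay to be paired with a field of size \<open>|x|\<close> to the power \<open>-\<delta>\<close>. Riesz potentials of
  Schwartz functions are not Schwartz, but they do decay at this rate.\<close>

definition admissible :: "(real^'n \<Rightarrow> real) \<Rightarrow> bool" where
  "admissible \<psi> \<longleftrightarrow> (\<forall>x. \<psi> differentiable (at x)) \<and>
     (\<exists>C. (\<forall>x. \<bar>\<psi> x\<bar> \<le> C * decay (real CARD('n) - 1) x) \<and>
          (\<forall>j x. \<bar>partial j \<psi> x\<bar> \<le> C * decay (real CARD('n)) x))"

lemma admissibleI:
  fixes \<psi> :: "real^'n \<Rightarrow> real"
  assumes "\<And>x. \<psi> differentiable (at x)"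
    and "\<exists>C\<ge>0. \<forall>x. \<bar>\<psi> x\<bar> \<le> C * decay p x" "real CARD('n) - 1 \<le> p"
    and "\<And>j. \<exists>C\<ge>0. \<forall>x. \<bar>partial j \<psi> x\<bar> \<le> C * decay q x" "real CARD('n) \<le> q"
  shows "admissible \<psi>"
proof -
  obtain C where C: "C \<ge> 0" "\<And>x. \<bar>\<psi> x\<bar> \<le> C * decay p x" using assms(2) by blast
  obtain C' where C': "\<And>j. C' j \<ge> 0" "\<And>j x. \<bar>partial j \<psi> x\<bar> \<le> C' j * decay q x"
    using assms(4) by metis
  define D where "D = C + (\<Sum>j\<in>UNIV. C' j)"
  have D: "C \<le> D" "C' j \<le> D" for j
    using C C' member_le_sum[of j UNIV C'] by (auto simp: D_def sum_nonneg intro: add_increasing)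
  have "\<bar>\<psi> x\<bar> \<le> D * decay (real CARD('n) - 1) x" for x
    by (rule order_trans[OF C(2)]) (intro mult_mono powr_mono; use D C assms(3) in auto)
  moreover have "\<bar>partial j \<psi> x\<bar> \<le> D * decay (real CARD('n)) x" for j x
    by (rule order_trans[OF C'(2)])
       (intro mult_mono powr_mono; use D(2)[of j] C'(1)[of j] assms(5) in auto)
  ultimately show ?thesis using assms(1) unfolding admissible_def by blast
qed

lemma admissible_measurable:
  "admissible \<psi> \<Longrightarrow> \<psi> \<in> borel_measurable borel" "admissible \<psi> \<Longrightarrow> partial j \<psi> \<in> borel_measurable borel"
  unfolding admissible_def by (auto intro: differentiable_continuous(2) partial_measurable)

lemma admissible_schwartz:
  fixes \<phi> :: "real^'n \<Rightarrow> real"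
  assumes "\<phi> \<in> schwartz"
  shows "admissible \<phi>"
proof -
  have "\<exists>C\<ge>0. \<forall>x. \<bar>\<psi> x\<bar> \<le> C * decay (real CARD('n)) x"
    if "\<psi> \<in> schwartz" for \<psi> :: "real^'n \<Rightarrow> real"
    using schwartz_decay[OF that, where M="real CARD('n)"] by blast
  then show ?thesis
    using assms by (intro admissibleI[where p="real CARD('n)" and q="real CARD('n)"])
      (auto intro: schwartz_differentiable schwartz_partial)
qed

lemma admissible_riesz_pot:
  fixes \<phi> :: "real^'n \<Rightarrow> real"
  assumes s: "0 < s" "s < 1" and d: "CARD('n) \<ge> 1" and \<phi>: "\<phi> \<in> schwartz"
  shows "admissible (riesz_pot s \<phi>)"
proof -
  let ?d = "real CARD('n)" and ?K = "riesz_kernel s :: real^'n \<Rightarrow> real"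
  define p where "p = ?d - 1 + s"
  have p: "0 \<le> p" "p < ?d" "?d < ?d + 1" using s d by (auto simp: p_def)
  obtain c where c: "\<And>h. ?K h = c * norm h powr (-p)"
    using riesz_kernel_eq[of s, where 'n='n] unfolding p_def by blast
  then have c': "\<bar>?K h\<bar> \<le> \<bar>c\<bar> * norm h powr (-p)" for h by (simp add: abs_mult)
  have [measurable]: "\<phi> \<in> borel_measurable borel" by (rule schwartz_measurable[OF \<phi>])
  note K = p riesz_kernel_measurable c' abs_ge_zero
  have eq: "riesz_pot s \<phi> = conv ?K \<phi>"
    unfolding riesz_pot_def[abs_def] conv_def[abs_def]
    by (intro ext integral_completion) measurable
  show ?thesis unfolding eq
  proof (rule admissibleI[where p=p and q="p+1"])
    show "conv ?K \<phi> differentiable (at x)" for x by (rule conv_differentiable[OF K \<phi>])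
    show "\<exists>C\<ge>0. \<forall>x. \<bar>conv ?K \<phi> x\<bar> \<le> C * decay p x" by (rule conv_decay[OF K \<phi>])
    \<comment> \<open>\<open>conv_decay\<close> alone would give the order d - 1 + s, which is below
      d. Because the partial derivatives of \<phi> have mean zero, the order rises to d + s.\<close>
    show "\<exists>C\<ge>0. \<forall>x. \<bar>partial j (conv ?K \<phi>) x\<bar> \<le> C * decay (p+1) x" for j
      unfolding partial_conv[OF K \<phi>]
      by (rule conv_mean_zero_decay[OF K schwartz_partial[OF \<phi>] integral_partial_schwartz[OF \<phi>] c])
  qed (use s in \<open>auto simp: p_def\<close>)
qed

text \<open>\<open>has_riesz_dist\<close> evaluates a distribution at truncated potentials.
  Admissibility is what the vanishing of the divergence asks of them, so the estimates stop at first
  derivatives.\<close>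

lemma admissible_riesz_trunc:
  fixes \<phi> :: "real^'n \<Rightarrow> real"
  assumes s: "0 < s" "s < 1" and d: "CARD('n) \<ge> 1" and \<phi>: "\<phi> \<in> schwartz"
  shows "admissible (riesz_trunc s r \<phi>)"
proof -
  let ?d = "real CARD('n)" and ?K = "\<lambda>h::real^'n. indicator (annulus r) h * riesz_kernel s h :: real"
  define p where "p = ?d - 1 + s"
  have p: "0 \<le> p" "p < ?d" "?d < ?d + 1" using s d by (auto simp: p_def)
  obtain c where "\<And>h. riesz_kernel s h = c * norm (h::real^'n) powr (-p)"
    using riesz_kernel_eq[of s, where 'n='n] unfolding p_def by blast
  then have c': "\<bar>?K h\<bar> \<le> \<bar>c\<bar> * norm h powr (-p)" for h by (simp add: abs_mult indicator_def)
  have meas: "?K \<in> borel_measurable borel" by measurable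
  have [measurable]: "\<phi> \<in> borel_measurable borel" by (rule schwartz_measurable[OF \<phi>])
  note K = p meas c' abs_ge_zero
  have supp: "norm h \<le> 1 / r" if "?K h \<noteq> 0" for h
    using that by (auto simp: annulus_def indicator_def split: if_splits)
  have eq: "riesz_trunc s r \<phi> = conv ?K \<phi>"
    unfolding riesz_trunc_def[abs_def] conv_def[abs_def] set_lebesgue_integral_def real_scaleR_def mult.assoc
    by (intro ext integral_completion) measurable
  show ?thesis unfolding eq
  proof (rule admissibleI[where p="?d" and q="?d"])
    show "conv ?K \<phi> differentiable (at x)" for x by (rule conv_differentiable[OF K \<phi>])
    show "\<exists>C\<ge>0. \<forall>x. \<bar>conv ?K \<phi> x\<bar> \<le> C * decay ?d x"
      by (rule conv_compact_decay[OF K \<phi> supp]) simp_all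
    show "\<exists>C\<ge>0. \<forall>x. \<bar>partial j (conv ?K \<phi>) x\<bar> \<le> C * decay ?d x" for j
      unfolding partial_conv[OF K \<phi>]
      by (rule conv_compact_decay[OF K schwartz_partial[OF \<phi>] supp]) simp_all
  qed auto
qed

section \<open>The flux and the two forms of the equation\<close>

lemma inner_self_powr: "x \<noteq> 0 \<Longrightarrow> (x \<bullet> x) powr (b - 1) * (x \<bullet> x) = (x \<bullet> x) powr b"
  by (simp add: powr_diff)

lemma inner_powr_monomial2:
  assumes "x \<noteq> 0"
  shows "\<bar>(x \<bullet> x) powr (b - 1) * x $ i * x $ j\<bar> \<le> norm x powr (2 * b)"
proof -
  have "\<bar>x $ i\<bar> * \<bar>x $ j\<bar> \<le> norm x * norm x" by (intro mult_mono component_le_norm_cart) auto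
  also have "\<dots> = x \<bullet> x" by (simp add: power2_norm_eq_inner[symmetric] power2_eq_square)
  finally have "(x \<bullet> x) powr (b - 1) * (\<bar>x $ i\<bar> * \<bar>x $ j\<bar>) \<le> (x \<bullet> x) powr (b - 1) * (x \<bullet> x)"
    by (rule mult_left_mono) simp
  also have "\<dots> = (x \<bullet> x) powr ((2 * b) / 2)" using inner_self_powr[OF assms] by simp
  also have "\<dots> = norm x powr (2 * b)" by (rule powr_inner_self[OF assms])
  finally show ?thesis by (simp add: abs_mult mult.assoc)
qed

context
  fixes i :: "'n::finite" and s \<delta> \<epsilon> :: real
  assumes n: "CARD('n) \<ge> 2" and s: "0 < s" "s < 1" and \<delta>: "0 < \<delta>" "\<delta> < real CARD('n) / 2"
begin

private abbreviation (input) "u\<^sub>i \<equiv> (u_fun i s \<delta> :: real^'n \<Rightarrow> real)"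
private abbreviation (input) "w x \<equiv> A_mat \<epsilon> x *v frac_grad_pv s (u_fun i s \<delta> :: real^'n \<Rightarrow> real) x"

lemma \<delta>_bounds: "\<delta> < real CARD('n)" "\<delta> + 1 < real CARD('n)"
  using n \<delta> by (auto simp: field_simps)

lemma riesz_pv_eq_v_fun: "\<exists>c. riesz_pv s u\<^sub>i = (\<lambda>x. c * v_fun i \<delta> x)"
proof -
  obtain c where c: "\<And>j x. riesz_pv s (u_fun j s \<delta> :: real^'n \<Rightarrow> real) x = c * (norm x powr (-\<delta>) * x $ j)"
    using riesz_pv_u_fun[OF s \<delta>(1) \<delta>_bounds(1)] by blast
  have "norm x powr (-\<delta>) * x $ i = v_fun i \<delta> x" for x
    using powr_inner_self[of x "-\<delta>"] by (cases "x = 0") (auto simp: v_fun_def)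
  then show ?thesis by (intro exI[of _ c] ext) (simp add: c)
qed

lemma v_fun_has_derivative:
  fixes x :: "real^'n"
  assumes "x \<noteq> 0"
  shows "(v_fun i \<delta> has_derivative
    (\<lambda>h. (x \<bullet> x) powr (-\<delta>/2) * h $ i + 2 * (x \<bullet> h) * (-\<delta>/2 * (x \<bullet> x) powr (-\<delta>/2-1)) * x $ i)) (at x)"
proof -
  have "((\<lambda>x. (x \<bullet> x) powr (-\<delta>/2)) has_derivative (\<lambda>h. 2 * (x \<bullet> h) * (-\<delta>/2 * (x \<bullet> x) powr (-\<delta>/2-1)))) (at x)"
  proof (rule DERIV_compose_FDERIV[where f="\<lambda>z. z powr (-\<delta>/2)" and g="\<lambda>x. x \<bullet> x"])
    show "((\<lambda>z. z powr (-\<delta>/2)) has_real_derivative -\<delta>/2 * (x \<bullet> x) powr (-\<delta>/2-1)) (at (x \<bullet> x))"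
      using assms by (intro has_real_derivative_powr) simp
    show "((\<lambda>x. x \<bullet> x) has_derivative (\<lambda>h. 2 * (x \<bullet> h))) (at x)"
      by (auto intro!: derivative_eq_intros simp: inner_commute)
  qed
  from has_derivative_mult[OF this vec_nth_has_derivative] show ?thesis
    unfolding v_fun_def[abs_def] .
qed

lemma partial_cmult_v_fun:
  fixes x :: "real^'n"
  assumes "x \<noteq> 0"
  shows "partial j (\<lambda>x. c * v_fun i \<delta> x) x = c * v_grad i \<delta> j x"
    "(\<lambda>x. c * v_fun i \<delta> x) differentiable (at x)"
proof -
  note D = has_derivative_mult_right[OF v_fun_has_derivative[OF assms], of c]
  show "partial j (\<lambda>x. c * v_fun i \<delta> x) x = c * v_grad i \<delta> j x"
    by (subst partial_eqI[OF D]) (simp add: v_grad_def axis_component inner_axis)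
  show "(\<lambda>x. c * v_fun i \<delta> x) differentiable (at x)" by (rule differentiableI[OF D])
qed

text \<open>The matrix keeps the radial part of a vector and multiplies the rest by 1 - \<epsilon>.
  Euler's identity for a function of degree 1 - \<delta> gives the radial sum
  \<open>(1 - \<delta>) * R * x $ i\<close>, so the second term receives the coefficient -(1 -
  \<epsilon>) \<delta> + \<epsilon> (1 - \<delta>) = \<epsilon> - \<delta>.\<close>

lemma A_mat_v_grad:
  fixes x g :: "real^'n"
  assumes x: "x \<noteq> 0" and g: "\<And>k. g $ k = c * v_grad i \<delta> k x"
  shows "(A_mat \<epsilon> x *v g) $ j = c * w_field i \<delta> \<epsilon> j x"
proof -
  define R where "R = (x \<bullet> x) powr (-\<delta>/2)"
  define R1 where "R1 = (x \<bullet> x) powr (-\<delta>/2-1)"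
  have R: "R1 * (x \<bullet> x) = R" unfolding R_def R1_def by (rule inner_self_powr[OF x])
  have xx: "x \<bullet> x \<noteq> 0" "norm x * norm x = x \<bullet> x"
    using x by (auto simp: power2_norm_eq_inner[symmetric] power2_eq_square)
  have vg: "v_grad i \<delta> k x = (if i = k then 1 else 0) * R - \<delta> * (R1 * x $ i * x $ k)" for k
    by (simp add: v_grad_def R_def R1_def)
  have "(\<Sum>k\<in>UNIV. x $ k * v_grad i \<delta> k x) = R * x $ i - \<delta> * (R1 * x $ i * (x \<bullet> x))"
    unfolding vg
    by (simp add: right_diff_distrib sum_subtractf inner_vec_def sum_distrib_left mult_ac
        if_distrib[of "\<lambda>c. _ * c"] cong: if_cong)
  also have "R1 * x $ i * (x \<bullet> x) = R * x $ i" using R by (metis mult.commute mult.left_commute)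
  finally have sum: "(\<Sum>k\<in>UNIV. x $ k * v_grad i \<delta> k x) = (1 - \<delta>) * R * x $ i" by (simp add: algebra_simps)
  have "(A_mat \<epsilon> x *v g) $ j = (\<Sum>k\<in>UNIV. ((1 - \<epsilon>) * (if j = k then 1 else 0) + \<epsilon> * (x $ j / norm x * (x $ k / norm x))) * (c * v_grad i \<delta> k x))"
    by (simp add: matrix_vector_mult_def A_mat_def mat_def g)
  also have "\<dots> = (\<Sum>k\<in>UNIV. (if j = k then (1 - \<epsilon>) * (c * v_grad i \<delta> k x) else 0) + \<epsilon> * c * x $ j / (x \<bullet> x) * (x $ k * v_grad i \<delta> k x))"
  proof (intro sum.cong refl)
    fix k
    have "x $ j / norm x * (x $ k / norm x) = x $ j * x $ k / (x \<bullet> x)" by (simp add: xx(2)[symmetric])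
    note e = this
    show "((1 - \<epsilon>) * (if j = k then 1 else 0) + \<epsilon> * (x $ j / norm x * (x $ k / norm x))) * (c * v_grad i \<delta> k x)
      = (if j = k then (1 - \<epsilon>) * (c * v_grad i \<delta> k x) else 0) + \<epsilon> * c * x $ j / (x \<bullet> x) * (x $ k * v_grad i \<delta> k x)"
      unfolding e by (simp add: algebra_simps)
  qed
  also have "\<dots> = (1 - \<epsilon>) * (c * v_grad i \<delta> j x) + \<epsilon> * c * x $ j / (x \<bullet> x) * ((1 - \<delta>) * R * x $ i)"
    by (simp add: sum.distrib sum_distrib_left[symmetric] sum_divide_distrib[symmetric] sum)
  also have "\<epsilon> * c * x $ j / (x \<bullet> x) * ((1 - \<delta>) * R * x $ i) = c * (\<epsilon> * (1 - \<delta>) * (R1 * x $ i * x $ j))"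
    using xx(1) by (simp add: R[symmetric] mult_ac)
  also have "(1 - \<epsilon>) * (c * v_grad i \<delta> j x) + c * (\<epsilon> * (1 - \<delta>) * (R1 * x $ i * x $ j)) = c * w_field i \<delta> \<epsilon> j x"
    unfolding vg w_field_def R_def[symmetric] R1_def[symmetric] by (simp add: algebra_simps)
  finally show ?thesis .
qed

lemma frac_grad_pv_eq:
  assumes V: "riesz_pv s u\<^sub>i = (\<lambda>x. c * v_fun i \<delta> x)" and x: "x \<noteq> 0"
  shows "frac_grad_pv s u\<^sub>i x $ j = c * v_grad i \<delta> j x" "w x $ j = c * w_field i \<delta> \<epsilon> j x"
proof -
  show g: "frac_grad_pv s u\<^sub>i x $ j = c * v_grad i \<delta> j x" for j
    by (simp add: frac_grad_pv_def grad_def V partial_cmult_v_fun[OF x])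
  show "w x $ j = c * w_field i \<delta> \<epsilon> j x" by (rule A_mat_v_grad[OF x g])
qed

lemma fields_le:
  fixes x :: "real^'n"
  assumes x: "x \<noteq> 0"
  shows "\<bar>v_fun i \<delta> x\<bar> \<le> 1 * norm x powr (-(\<delta>-1))"
    "\<bar>v_grad i \<delta> j x\<bar> \<le> (1 + \<delta>) * norm x powr (-\<delta>)"
    "\<bar>w_field i \<delta> \<epsilon> j x\<bar> \<le> (\<bar>1-\<epsilon>\<bar> + \<bar>\<epsilon>-\<delta>\<bar>) * norm x powr (-\<delta>)"
proof -
  have R: "(x \<bullet> x) powr (-\<delta>/2) = norm x powr (-\<delta>)" by (rule powr_inner_self[OF x])
  have m: "\<bar>(x \<bullet> x) powr (-\<delta>/2-1) * x $ i * x $ j\<bar> \<le> norm x powr (-\<delta>)"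
    using inner_powr_monomial2[OF x, of "-\<delta>/2" i j] by simp
  have "norm x powr (-\<delta>) * \<bar>x $ i\<bar> \<le> norm x powr (-\<delta>) * norm x powr 1"
    using component_le_norm_cart[of x i] by (intro mult_left_mono) auto
  also have "\<dots> = norm x powr (-(\<delta>-1))" by (simp only: powr_add[symmetric]) simp
  finally show "\<bar>v_fun i \<delta> x\<bar> \<le> 1 * norm x powr (-(\<delta>-1))"
    by (simp only: v_fun_def R abs_mult abs_of_nonneg[OF powr_ge_zero] mult_1)
  have if1: "\<bar>a * (if i = j then 1 else 0) * r\<bar> \<le> \<bar>a\<bar> * r" if "r \<ge> 0" for a r :: real
    using that by (simp add: abs_mult)
  have "\<bar>v_grad i \<delta> j x\<bar> \<le> \<bar>1 * (if i = j then 1 else 0) * norm x powr (-\<delta>)\<bar>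
     + \<bar>\<delta> * ((x \<bullet> x) powr (-\<delta>/2-1) * x $ i * x $ j)\<bar>"
    unfolding v_grad_def R mult_1 by (rule abs_triangle_ineq4)
  also have "\<dots> \<le> \<bar>1\<bar> * norm x powr (-\<delta>) + \<delta> * norm x powr (-\<delta>)"
    by (intro add_mono if1) (use \<delta> m in \<open>simp_all add: abs_mult\<close>)
  finally show "\<bar>v_grad i \<delta> j x\<bar> \<le> (1 + \<delta>) * norm x powr (-\<delta>)" by (simp add: distrib_right)
  have "\<bar>w_field i \<delta> \<epsilon> j x\<bar> \<le> \<bar>(1-\<epsilon>) * (if i = j then 1 else 0) * norm x powr (-\<delta>)\<bar>
     + \<bar>(\<epsilon>-\<delta>) * ((x \<bullet> x) powr (-\<delta>/2-1) * x $ i * x $ j)\<bar>"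
    unfolding w_field_def R by (rule abs_triangle_ineq)
  also have "\<dots> \<le> \<bar>1-\<epsilon>\<bar> * norm x powr (-\<delta>) + \<bar>\<epsilon>-\<delta>\<bar> * norm x powr (-\<delta>)"
    by (intro add_mono if1) (use mult_left_mono[OF m, of "\<bar>\<epsilon>-\<delta>\<bar>"] in \<open>simp_all add: abs_mult\<close>)
  finally show "\<bar>w_field i \<delta> \<epsilon> j x\<bar> \<le> (\<bar>1-\<epsilon>\<bar> + \<bar>\<epsilon>-\<delta>\<bar>) * norm x powr (-\<delta>)" by (simp add: distrib_right)
qed

text \<open>\<open>frac_grad_pv\<close> is a pointwise gradient, meaningful off the origin. This
  shows that the distributional gradient has no additional mass at the origin, so the two
  agree.\<close>

lemma u_fun_has_dist_grad: "has_dist_grad (riesz_pv s u\<^sub>i) (frac_grad_pv s u\<^sub>i)"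
proof -
  obtain c where V: "riesz_pv s u\<^sub>i = (\<lambda>x. c * v_fun i \<delta> x)" using riesz_pv_eq_v_fun by blast
  note meas = fields_measurable[where i=i]
  have "tempered_fun (riesz_pv s u\<^sub>i)"
    by (rule tempered_fun_cmult[OF meas(1) _ fields_le(1), where c=c])
       (use \<delta>_bounds in \<open>simp_all add: V\<close>)
  moreover have "tempered_fun (\<lambda>x. frac_grad_pv s u\<^sub>i x $ j)" for j
    by (rule tempered_fun_cmult[OF meas(2) frac_grad_pv_eq(1)[OF V] fields_le(2)])
       (use \<delta>_bounds \<delta> in auto)
  moreover have "dist_of_fun (\<lambda>x. frac_grad_pv s u\<^sub>i x $ j) \<phi> = - dist_of_fun (riesz_pv s u\<^sub>i) (partial j \<phi>)"
    if \<phi>: "\<phi> \<in> schwartz" for \<phi> j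
  proof -
    let ?d = "real CARD('n)"
    obtain C1 where C1: "C1 \<ge> 0" "\<And>x. \<bar>\<phi> x\<bar> \<le> C1 * decay (?d+1) x"
      using schwartz_decay[OF \<phi>, where M="?d+1"] by blast
    obtain C2 where C2: "C2 \<ge> 0" "\<And>x. \<bar>partial j \<phi> x\<bar> \<le> C2 * decay (?d+1) x"
      using schwartz_decay[OF schwartz_partial[OF \<phi>], where M="?d+1"] by blast
    have "(LINT x|lborel. v_fun i \<delta> x * partial j \<phi> x) = - (LINT x|lborel. v_grad i \<delta> j x * \<phi> x)"
    proof (rule v_fun_integral_by_parts[OF \<delta>(1), where C="C1 + C2" and p="?d+1" and q="?d+1"])
      show "\<bar>\<phi> x\<bar> \<le> (C1 + C2) * decay (?d+1) x" for x
        by (rule order_trans[OF C1(2)], rule mult_right_mono) (use C2 in auto)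
      show "\<bar>partial j \<phi> x\<bar> \<le> (C1 + C2) * decay (?d+1) x" for x
        by (rule order_trans[OF C2(2)], rule mult_right_mono) (use C1 in auto)
    qed (use \<delta> \<delta>_bounds schwartz_differentiable[OF \<phi>] in auto)
    moreover have "dist_of_fun (\<lambda>x. frac_grad_pv s u\<^sub>i x $ j) \<phi> = c * (LINT x|lborel. v_grad i \<delta> j x * \<phi> x)"
      by (rule dist_of_fun_cong[OF meas(2) schwartz_measurable[OF \<phi>] frac_grad_pv_eq(1)[OF V]])
    moreover have "dist_of_fun (riesz_pv s u\<^sub>i) (partial j \<phi>) = c * (LINT x|lborel. v_fun i \<delta> x * partial j \<phi> x)"
      by (rule dist_of_fun_cong[OF meas(1) schwartz_measurable[OF schwartz_partial[OF \<phi>]]]) (simp add: V)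
    ultimately show ?thesis by simp
  qed
  ultimately show ?thesis unfolding has_dist_grad_def by blast
qed

lemma tempered_fun_field: "tempered_fun (\<lambda>x. w x $ j)"
proof -
  obtain c where V: "riesz_pv s u\<^sub>i = (\<lambda>x. c * v_fun i \<delta> x)" using riesz_pv_eq_v_fun by blast
  show ?thesis
    by (rule tempered_fun_cmult[OF fields_measurable(3) frac_grad_pv_eq(2)[OF V] fields_le(3)])
       (use \<delta>_bounds in auto)
qed

context
  assumes \<epsilon>: "\<epsilon> = (real CARD('n) - \<delta>) / (real CARD('n) - 1) * \<delta>"
begin

text \<open>The common source of both forms of the equation: truncated potentials as
  \<open>\<psi>\<close> give the distributional one, full potentials the weak one.\<close>

lemma field_orthogonal_grad:
  assumes \<psi>: "admissible \<psi>"
  shows "integrable lborel (\<lambda>x. w x $ j * partial j \<psi> x)"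
    "(\<Sum>j\<in>UNIV. dist_of_fun (\<lambda>x. w x $ j) (partial j \<psi>)) = 0"
proof -
  obtain c where V: "riesz_pv s u\<^sub>i = (\<lambda>x. c * v_fun i \<delta> x)" using riesz_pv_eq_v_fun by blast
  have \<epsilon>': "\<epsilon> * (real CARD('n) - 1) = (real CARD('n) - \<delta>) * \<delta>"
    using n by (simp add: \<epsilon>)
  obtain C where C: "\<And>x. \<psi> differentiable (at x)"
    "\<And>x. \<bar>\<psi> x\<bar> \<le> C * decay (real CARD('n) - 1) x"
    "\<And>j x. \<bar>partial j \<psi> x\<bar> \<le> C * decay (real CARD('n)) x"
    using \<psi> unfolding admissible_def by blast
  note meas = fields_measurable(3)[where i=i and \<epsilon>=\<epsilon>]
  note weq = frac_grad_pv_eq(2)[OF V]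
  \<comment> \<open>With decay of orders d - 1 and d, both conditions at infinity reduce to \<delta>
    > 0.\<close>
  have "real CARD('n) < \<delta> + 1 + (real CARD('n) - 1)" "real CARD('n) < \<delta> + real CARD('n)" using \<delta> by auto
  note free = w_field_weakly_div_free[OF \<delta>(1) C \<delta>_bounds(2) this \<epsilon>']
  have wm: "(\<lambda>x. w x $ j) \<in> borel_measurable borel" for j
    by (rule measurable_except_0[OF _ weq]) (use meas in measurable)
  show "integrable lborel (\<lambda>x. w x $ j * partial j \<psi> x)"
  proof (rule integrable_cong_AE_imp)
    show "integrable lborel (\<lambda>x. c * (w_field i \<delta> \<epsilon> j x * partial j \<psi> x))" using free(1) by simp
    show "(\<lambda>x. w x $ j * partial j \<psi> x) \<in> borel_measurable lborel"
      using wm admissible_measurable(2)[OF \<psi>] by measurable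
    show "AE x in lborel. c * (w_field i \<delta> \<epsilon> j x * partial j \<psi> x) = w x $ j * partial j \<psi> x"
      using AE_lborel_singleton[of "0::real^'n"] by eventually_elim (simp add: weq)
  qed
  have "dist_of_fun (\<lambda>x. w x $ j) (partial j \<psi>) = c * (LINT x|lborel. w_field i \<delta> \<epsilon> j x * partial j \<psi> x)" for j
    by (rule dist_of_fun_cong[OF meas admissible_measurable(2)[OF \<psi>] weq])
  then show "(\<Sum>j\<in>UNIV. dist_of_fun (\<lambda>x. w x $ j) (partial j \<psi>)) = 0"
    using free(2) by (simp add: sum_distrib_left[symmetric])
qed

lemma field_dist_div:
  "admissible \<psi> \<Longrightarrow> dist_div (\<lambda>x. w x) \<psi> = 0"
  unfolding dist_div_def by (simp add: field_orthogonal_grad(2))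

lemma field_dist_div_tempered: "tempered_distribution (dist_div (\<lambda>x. w x))"
proof -
  have T: "tempered_distribution (dist_of_fun (\<lambda>x. w x $ j))" for j
    using tempered_fun_field unfolding tempered_fun_def by blast
  have "dist_div (\<lambda>x. w x) (\<lambda>x. \<phi> x + \<psi> x) = dist_div (\<lambda>x. w x) \<phi> + dist_div (\<lambda>x. w x) \<psi>"
    if "\<phi> \<in> schwartz" "\<psi> \<in> schwartz" for \<phi> \<psi>
  proof -
    have "partial j (\<lambda>x. \<phi> x + \<psi> x) = (\<lambda>x. partial j \<phi> x + partial j \<psi> x)" for j
      using partial_add[OF schwartz_differentiable schwartz_differentiable] that by blast
    moreover have "dist_of_fun (\<lambda>x. w x $ j) (\<lambda>x. partial j \<phi> x + partial j \<psi> x)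
        = dist_of_fun (\<lambda>x. w x $ j) (partial j \<phi>) + dist_of_fun (\<lambda>x. w x $ j) (partial j \<psi>)" for j
      using T schwartz_partial that unfolding tempered_distribution_def by blast
    ultimately show ?thesis by (simp add: dist_div_def sum.distrib)
  qed
  moreover have "dist_div (\<lambda>x. w x) (\<lambda>x. a * \<phi> x) = a * dist_div (\<lambda>x. w x) \<phi>" if "\<phi> \<in> schwartz" for \<phi> a
  proof -
    have "partial j (\<lambda>x. a * \<phi> x) = (\<lambda>x. a * partial j \<phi> x)" for j
      using partial_cmult[OF schwartz_differentiable[OF that]] by blast
    moreover have "dist_of_fun (\<lambda>x. w x $ j) (\<lambda>x. a * partial j \<phi> x)
        = a * dist_of_fun (\<lambda>x. w x $ j) (partial j \<phi>)" for j
      using T schwartz_partial that unfolding tempered_distribution_def by blast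
    ultimately show ?thesis by (simp add: dist_div_def sum_distrib_left)
  qed
  \<comment> \<open>Schwartz functions are admissible, so the distribution vanishes on them and
    continuity holds with constant \<open>0\<close> and order \<open>0\<close>.\<close>
  moreover have "\<bar>dist_div (\<lambda>x. w x) \<phi>\<bar> \<le> 0 * (\<Sum>js | length js \<le> 0. SUP x. (1 + norm x) ^ 0 * \<bar>partials js \<phi> x\<bar>)"
    if "\<phi> \<in> schwartz" for \<phi>
    by (simp add: field_dist_div[OF admissible_schwartz[OF that]])
  ultimately show ?thesis unfolding tempered_distribution_def by blast
qed

text \<open>The limit in the truncation radius is that of a constant: the divergence vanishes at the
  truncated potential for every \<open>r\<close>.\<close>

lemma field_has_frac_div: "has_frac_div s (\<lambda>x. w x) (\<lambda>_. 0)"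
proof -
  have "tempered_distribution (\<lambda>_::real^'n \<Rightarrow> real. 0)"
    unfolding tempered_distribution_def by (auto intro!: exI[of _ 0])
  moreover have "((\<lambda>r. dist_div (\<lambda>x. w x) (riesz_trunc s r \<phi>)) \<longlongrightarrow> 0) (at_right 0)" if "\<phi> \<in> schwartz" for \<phi>
    using n by (simp add: field_dist_div[OF admissible_riesz_trunc[OF s _ that]])
  ultimately show ?thesis
    using tempered_fun_field field_dist_div_tempered unfolding has_frac_div_def has_riesz_dist_def by blast
qed

lemma field_weak_equation:
  assumes \<xi>: "\<xi> \<in> schwartz"
  shows "integrable lebesgue (\<lambda>x. w x \<bullet> frac_grad s \<xi> x)" "(LINT x|lebesgue. w x \<bullet> frac_grad s \<xi> x) = 0"
proof -
  have adm: "admissible (riesz_pot s \<xi>)" using n by (intro admissible_riesz_pot s \<xi>) simp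
  note o = field_orthogonal_grad[OF adm]
  have eq: "(\<lambda>x. w x \<bullet> frac_grad s \<xi> x) = (\<lambda>x. \<Sum>j\<in>UNIV. w x $ j * partial j (riesz_pot s \<xi>) x)"
    by (simp add: inner_vec_def frac_grad_def grad_def)
  have int: "integrable lebesgue (\<lambda>x. w x $ j * partial j (riesz_pot s \<xi>) x)" for j
    by (subst integrable_completion) (use o(1) in auto)
  then show "integrable lebesgue (\<lambda>x. w x \<bullet> frac_grad s \<xi> x)" unfolding eq by simp
  have "(LINT x|lebesgue. w x \<bullet> frac_grad s \<xi> x) = (\<Sum>j\<in>UNIV. dist_of_fun (\<lambda>x. w x $ j) (partial j (riesz_pot s \<xi>)))"
    unfolding eq dist_of_fun_def using int by (rule Bochner_Integration.integral_sum)
  then show "(LINT x|lebesgue. w x \<bullet> frac_grad s \<xi> x) = 0" using o(2) by simp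
qed

end

end

theorem theorem5p1:
  fixes i :: "'n::finite" and s \<delta> \<epsilon> :: real
  assumes "CARD('n) \<ge> 2" and "0 < s" "s < 1" and "0 < \<delta>" "\<delta> < real CARD('n) / 2"
    and "0 < \<epsilon>" "\<epsilon> < 1"
  shows
    "(u_fun i s \<delta> \<in> sobolev_frac_loc s 2 (ball (0::real^'n) 1)
      \<and> (\<forall>t q. 0 < t \<and> t < 1 \<and> 1 < q \<longrightarrow>
           (u_fun i s \<delta> \<in> sobolev_frac_loc t q (ball (0::real^'n) 1)
              \<longleftrightarrow> s - \<delta> > t - real CARD('n) / q)))
   \<and> (\<epsilon> = (real CARD('n) - \<delta>) / (real CARD('n) - 1) * \<delta> \<longrightarrow>
      (let u = u_fun i s \<delta>; w = (\<lambda>x. A_mat \<epsilon> x *v frac_grad_pv s u x) in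
        (\<forall>x. riesz_pv_exists s u x)
      \<and> (\<forall>x. x \<noteq> 0 \<longrightarrow> riesz_pv s u differentiable (at x))
      \<and> has_dist_grad (riesz_pv s u) (frac_grad_pv s u)
      \<and> (\<exists>D. has_frac_div s w D \<and> (\<forall>\<phi>\<in>schwartz. - D \<phi> = 0))
      \<and> (\<forall>\<xi>\<in>schwartz. integrable lebesgue (\<lambda>x. w x \<bullet> frac_grad s \<xi> x)
           \<and> (LINT x|lebesgue. w x \<bullet> frac_grad s \<xi> x) = 0)))"
proof (intro conjI impI)
  \<comment> \<open>For t = s and q = 2 the criterion reads \<delta> < d/2.\<close>
  show "u_fun i s \<delta> \<in> sobolev_frac_loc s 2 (ball (0::real^'n) 1)"
    using u_fun_sobolev_frac_loc_iff[of s 2 i s \<delta>] assms(2-5) by simp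
  show "\<forall>t q. 0 < t \<and> t < 1 \<and> 1 < q \<longrightarrow>
      (u_fun i s \<delta> \<in> sobolev_frac_loc t q (ball (0::real^'n) 1) \<longleftrightarrow> s - \<delta> > t - real CARD('n) / q)"
    using u_fun_sobolev_frac_loc_iff[of _ _ i s \<delta>] by blast
next
  note A = assms(1-5)
  assume \<epsilon>: "\<epsilon> = (real CARD('n) - \<delta>) / (real CARD('n) - 1) * \<delta>"
  have "riesz_pv s (u_fun i s \<delta>) differentiable (at x)" if "x \<noteq> 0" for x :: "real^'n"
  proof -
    obtain c where "riesz_pv s (u_fun i s \<delta> :: real^'n \<Rightarrow> real) = (\<lambda>x. c * v_fun i \<delta> x)"
      using riesz_pv_eq_v_fun[OF A] by blast
    then show ?thesis using partial_cmult_v_fun(2)[OF A that] by simp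
  qed
  then show "let u = u_fun i s \<delta>; w = (\<lambda>x. A_mat \<epsilon> x *v frac_grad_pv s u x) in
        (\<forall>x::real^'n. riesz_pv_exists s u x)
      \<and> (\<forall>x. x \<noteq> 0 \<longrightarrow> riesz_pv s u differentiable (at x))
      \<and> has_dist_grad (riesz_pv s u) (frac_grad_pv s u)
      \<and> (\<exists>D. has_frac_div s w D \<and> (\<forall>\<phi>\<in>schwartz. - D \<phi> = 0))
      \<and> (\<forall>\<xi>\<in>schwartz. integrable lebesgue (\<lambda>x. w x \<bullet> frac_grad s \<xi> x)
           \<and> (LINT x|lebesgue. w x \<bullet> frac_grad s \<xi> x) = 0)"
    unfolding Let_def
    using riesz_pv_exists_u_fun[OF A(2-4) \<delta>_bounds(1)[OF A]] u_fun_has_dist_grad[OF A]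
      field_has_frac_div[OF A \<epsilon>] field_weak_equation[OF A \<epsilon>]
    by (intro conjI allI impI ballI exI[of _ "\<lambda>_. 0"]) simp_all
qed

end
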